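(* Let $X$ and $A$ be finite sets, let $\varphi:\mathcal{P}_{XX}\to\mathcal{P}_{AA}$ be a concurrent quantum non-local game, and let $\Gamma:M_{XX}\to M_{AA}$ be a perfect quantum commuting QNS strategy for $\varphi$. Then there exists a tracial state $\tilde\tau:\mathcal{C}_{X,A}\to\mathbb{C}$ such that $\Gamma=\Gamma_{\tilde\tau}$, i.e. $$\Gamma(\epsilon_{x,x'}\otimes\epsilon_{y,y'})=\sum_{a,a',b,b'\in A}\tilde\tau(e_{x,x',a,a'}e_{y',y,b',b})\,\epsilon_{a,a'}\otimes\epsilon_{b,b'},\qquad x,x',y,y'\in X.$$ Moreover, (i) if $\Gamma$ is approximately quantum then $\tilde\tau$ can be chosen to be amenable; (ii) if $\Gamma$ is quantum then $\tilde\tau$ can be chosen to factor through a finite dimensional *-representation of $\mathcal{C}_{X,A}$; (iii) if $\Gamma$ is local then $\tilde\tau$ can be chosen to factor through an abelian *-representation of $\mathcal{C}_{X,A}$.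
   Context: For a finite set $Z$, $M_Z$ is the algebra of complex $Z\times Z$ matrices with matrix units $\epsilon_{z,z'}$; $M_{ZW}=M_Z\otimes M_W$; $\mathcal{P}_{ZW}$ is the lattice of projections in $M_{ZW}$. Put $J_Z=\frac1{|Z|}\sum_{z,z'\in Z}\epsilon_{z,z'}\otimes\epsilon_{z,z'}\in\mathcal{P}_{ZZ}$. A quantum non-local game is a join-preserving map $\varphi:\mathcal{P}_{XY}\to\mathcal{P}_{AB}$ with $\varphi(0)=0$. A game $\varphi:\mathcal{P}_{XX}\to\mathcal{P}_{AA}$ is concurrent if $\varphi(J_X)=J_A$. A QNS (quantum no-signalling) correlation is a completely positive trace preserving map $\Gamma:M_{XY}\to M_{AB}$ such that $\operatorname{Tr}_A\Gamma(\rho_X\otimes\rho_Y)=0$ whenever $\operatorname{Tr}(\rho_X)=0$ and $\operatorname{Tr}_B\Gamma(\rho_X\otimes\rho_Y)=0$ whenever $\operatorname{Tr}(\rho_Y)=0$. It is a perfect strategy for $\varphi$ if $\operatorname{Tr}\big(\Gamma(P)(I-\varphi(P))\big)=0$ for all $P\in\mathcal{P}_{XY}$. A stochastic operator matrix over $(X,A)$ on a Hilbert space $H$ is a positive block operator matrix $(E_{x,x',a,a'})_{x,x'\in X,a,a'\in A}\in M_X\otimes M_A\otimes\mathcal{B}(H)$ with $\sum_{a}E_{x,x',a,a}=\delta_{x,x'}I$. A QNS correlation $\Gamma$ is quantum commuting if there are a Hilbert space $H$, a unit vector $\xi\in H$ and stochastic operator matrices $(E_{x,x',a,a'})$, $(F_{y,y',b,b'})$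 on $H$ whose entries mutually commute ($E_{x,x',a,a'}F_{y,y',b,b'}=F_{y,y',b,b'}E_{x,x',a,a'}$) such that $\Gamma(\epsilon_{x,x'}\otimes\epsilon_{y,y'})=\sum_{a,a',b,b'}\langle E_{x,x',a,a'}F_{y,y',b,b'}\xi,\xi\rangle\epsilon_{a,a'}\otimes\epsilon_{b,b'}$. It is quantum if it has this form with $E_{x,x',a,a'}\otimes F_{y,y',b,b'}$ in place of the product, with $(E_{x,x',a,a'})$, $(F_{y,y',b,b'})$ acting on finite dimensional Hilbert spaces $H_1,H_2$ and $\xi\in H_1\otimes H_2$ a unit vector; approximately quantum if it is a limit of quantum QNS correlations; local if it is a convex combination $\sum_{i=1}^k\lambda_i\Phi_i\otimes\Psi_i$ with $\Phi_i:M_X\to M_A$, $\Psi_i:M_Y\to M_B$ quantum channels. The C*-algebra $\mathcal{C}_{X,A}$: let $\mathcal{V}_{X,A}$ be the universal ternary ring of operators generated by elements $v_{a,x}$ ($a\in A,x\in X$) such that the block matrix $V=(v_{a,x})_{a,x}$ is an isometry; $\mathcal{C}_{X,A}$ is its right C*-algebra, i.e. the unital C*-algebra generated by $e_{x,x',a,a'}=v_{a,x}^*v_{a',x'}$. Its unital *-representations $\pi$ on a Hilbert space $H$ correspond exactly to the stochastic operator matrices $(E_{x,x',a,a'})$ on $H$ via $\pi(e_{x,x',a,a'})=E_{x,x',a,a'}$. A tracial state $\tau$ factors through a finite dimensional (resp. abelian) *-representation if $\tau=\tau_0\circ\pi$ for a unital *-homomorphism $\pi$ into a finite dimensional (resp.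 abelian) C*-algebra with a tracial state $\tau_0$. Amenable traces are understood in the usual sense (Brown–Ozawa); equivalently $z\otimes w^{\rm op}\mapsto\tau(zw)$ extends to a state of $\mathcal{C}_{X,A}\otimes_{\min}\mathcal{C}_{X,A}^{\rm op}$. *)

theory Defs
  imports "HOL-Analysis.Analysis"
begin

section \<open>Complex Hilbert spaces and bounded operators\<close>

text \<open>
  A complex Hilbert space is a complete real inner product space (with inner product
  \<open>Re \<langle>\<cdot>,\<cdot>\<rangle>\<close>) with a compatible complex structure.  The complex inner product is linear in
  its \<^emph>\<open>first\<close> argument.
\<close>

class chilbert_space = real_inner + complete_space +
  fixes scaleC :: "complex \<Rightarrow> 'a \<Rightarrow> 'a"  (infixr \<open>*\<^sub>C\<close> 75)
    and cinner :: "'a \<Rightarrow> 'a \<Rightarrow> complex"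
  assumes scaleC_add_right: "c *\<^sub>C (u + v) = c *\<^sub>C u + c *\<^sub>C v"
    and scaleC_add_left: "(c + d) *\<^sub>C u = c *\<^sub>C u + d *\<^sub>C u"
    and scaleC_scaleC: "c *\<^sub>C (d *\<^sub>C u) = (c * d) *\<^sub>C u"
    and scaleC_of_real: "complex_of_real r *\<^sub>C u = r *\<^sub>R u"
    and cinner_commute: "cinner u v = cnj (cinner v u)"
    and cinner_add_left: "cinner (u + v) w = cinner u w + cinner v w"
    and cinner_scaleC_left: "cinner (c *\<^sub>C u) v = c * cinner u v"
    and inner_eq_Re_cinner: "inner u v = Re (cinner u v)"

instantiation complex :: chilbert_space
begin

definition "scaleC_complex (c::complex) (u::complex) = c * u"
definition "cinner_complex (u::complex) (v::complex) = u * cnj v"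

instance
  by standard (auto simp: scaleC_complex_def cinner_complex_def algebra_simps
      scaleR_conv_of_real inner_complex_def)

end

lemma norm_scaleC: "norm (c *\<^sub>C (u::'h::chilbert_space)) = cmod c * norm u"
proof -
  have "cinner (c *\<^sub>C u) (c *\<^sub>C u) = c * cnj c * cinner u u"
    using cinner_commute[of u "c *\<^sub>C u"] cinner_commute[of u u]
    by (simp add: cinner_scaleC_left)
  also have "c * cnj c = complex_of_real ((cmod c)\<^sup>2)"
    using complex_norm_square[of c] by simp
  finally have "inner (c *\<^sub>C u) (c *\<^sub>C u) = (cmod c)\<^sup>2 * inner u u"
    by (simp add: inner_eq_Re_cinner)
  then show ?thesis
    by (simp add: norm_eq_sqrt_inner real_sqrt_mult)
qed

lemma norm_cinner_le: "cmod (cinner u v) \<le> norm u * norm (v::'h::chilbert_space)"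
proof (cases "cinner u v = 0")
  case False
  define c where "c = cnj (cinner u v) / cmod (cinner u v)"
  have "cinner (c *\<^sub>C u) v = cmod (cinner u v)"
    using False complex_norm_square[of "cinner u v"] unfolding c_def cinner_scaleC_left
    by (simp add: power2_eq_square mult.commute field_simps)
  then have "cmod (cinner u v) = inner (c *\<^sub>C u) v"
    by (simp add: inner_eq_Re_cinner)
  also have "\<dots> \<le> norm (c *\<^sub>C u) * norm v" by (rule norm_cauchy_schwarz)
  also have "norm (c *\<^sub>C u) = norm u"
    using False by (simp add: norm_scaleC c_def norm_divide)
  finally show ?thesis .
qed simp

type_synonym 'h op = "'h \<Rightarrow>\<^sub>L 'h"

text \<open>
  The library type of bounded operators consists of the bounded \<^emph>\<open>real\<close>-linear operators;
  \<open>B(H)\<close> is the subset of the complex-linear ones, on which the operator norm is the usual one.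
\<close>

definition bop :: "'h::chilbert_space op set" where
  "bop = {T. \<forall>c u. blinfun_apply T (c *\<^sub>C u) = c *\<^sub>C blinfun_apply T u}"

definition op_scaleC :: "complex \<Rightarrow> 'h::chilbert_space op \<Rightarrow> 'h op" where
  "op_scaleC c T = Blinfun (\<lambda>u. c *\<^sub>C blinfun_apply T u)"

text \<open>The adjoint exists uniquely, by the Riesz representation theorem, for every \<open>T \<in> B(H)\<close>.\<close>

definition op_adj :: "'h::chilbert_space op \<Rightarrow> 'h op" where
  "op_adj T = (THE S. \<forall>u v. cinner (blinfun_apply T u) v = cinner u (blinfun_apply S v))"

lemma op_scaleC_apply: "blinfun_apply (op_scaleC c T) u = c *\<^sub>C blinfun_apply T u"
proof -
  have "c *\<^sub>C (r *\<^sub>R v) = r *\<^sub>R (c *\<^sub>C v)" for r and v :: 'a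
    by (metis scaleC_of_real scaleC_scaleC mult.commute)
  then have "bounded_linear (\<lambda>v::'a. c *\<^sub>C v)"
    by (intro bounded_linear_intro[where K = "cmod c"])
      (auto simp: scaleC_add_right norm_scaleC)
  then have "bounded_linear (\<lambda>u. c *\<^sub>C blinfun_apply T u)"
    by (rule bounded_linear_compose) (rule blinfun.bounded_linear_right)
  then show ?thesis by (simp add: op_scaleC_def bounded_linear_Blinfun_apply)
qed

section \<open>Hilbert space direct sums\<close>

typedef (overloaded) ('i, 'h::chilbert_space) hsum =
  "{f :: 'i \<Rightarrow> 'h. (\<lambda>i. (norm (f i))\<^sup>2) summable_on UNIV}"
  by (rule exI[of _ "\<lambda>_. 0"]) simp

lemma sq_summable_add:
  fixes f g :: "'i \<Rightarrow> 'h::real_inner"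
  assumes "(\<lambda>i. (norm (f i))\<^sup>2) summable_on A" "(\<lambda>i. (norm (g i))\<^sup>2) summable_on A"
  shows "(\<lambda>i. (norm (f i + g i))\<^sup>2) summable_on A"
proof (rule summable_on_comparison_test)
  show "(\<lambda>i. 2 * (norm (f i))\<^sup>2 + 2 * (norm (g i))\<^sup>2) summable_on A"
    by (intro summable_on_add summable_on_cmult_right assms)
  fix i
  have "(norm (f i + g i))\<^sup>2 \<le> (norm (f i) + norm (g i))\<^sup>2"
    by (intro power_mono norm_triangle_ineq) auto
  also have "\<dots> \<le> 2 * (norm (f i))\<^sup>2 + 2 * (norm (g i))\<^sup>2"
    using sum_squares_bound[of "norm (f i)" "norm (g i)"]
    by (simp add: power2_sum)
  finally show "(norm (f i + g i))\<^sup>2 \<le> 2 * (norm (f i))\<^sup>2 + 2 * (norm (g i))\<^sup>2" .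
qed auto

lemma sq_summable_scaleC:
  fixes f :: "'i \<Rightarrow> 'h::chilbert_space"
  assumes "(\<lambda>i. (norm (f i))\<^sup>2) summable_on A"
  shows "(\<lambda>i. (norm (c *\<^sub>C f i))\<^sup>2) summable_on A"
  using summable_on_cmult_right[OF assms, of "(cmod c)\<^sup>2"]
  by (simp add: norm_scaleC power_mult_distrib)

lemma sq_summable_cinner:
  fixes f g :: "'i \<Rightarrow> 'h::chilbert_space"
  assumes "(\<lambda>i. (norm (f i))\<^sup>2) summable_on A" "(\<lambda>i. (norm (g i))\<^sup>2) summable_on A"
  shows "(\<lambda>i. cinner (f i) (g i)) summable_on A"
proof -
  have "(\<lambda>i. (norm (f i))\<^sup>2 + (norm (g i))\<^sup>2) summable_on A"
    by (intro summable_on_add assms)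
  then have "(\<lambda>i. cmod (cinner (f i) (g i))) summable_on A"
  proof (rule summable_on_comparison_test)
    fix i
    have "cmod (cinner (f i) (g i)) \<le> norm (f i) * norm (g i)" by (rule norm_cinner_le)
    also have "\<dots> \<le> (norm (f i))\<^sup>2 + (norm (g i))\<^sup>2"
    proof -
      have "0 \<le> norm (f i) * norm (g i)" by simp
      then show ?thesis
        using sum_squares_bound[of "norm (f i)" "norm (g i)"] by linarith
    qed
    finally show "cmod (cinner (f i) (g i)) \<le> (norm (f i))\<^sup>2 + (norm (g i))\<^sup>2" .
  qed auto
  then show ?thesis by (rule abs_summable_summable)
qed

definition hsum_scaleC :: "complex \<Rightarrow> ('i, 'h::chilbert_space) hsum \<Rightarrow> ('i, 'h) hsum" where
  "hsum_scaleC c f = Abs_hsum (\<lambda>i. c *\<^sub>C Rep_hsum f i)"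

definition hsum_cinner :: "('i, 'h::chilbert_space) hsum \<Rightarrow> ('i, 'h) hsum \<Rightarrow> complex" where
  "hsum_cinner f g = (\<Sum>\<^sub>\<infinity>i. cinner (Rep_hsum f i) (Rep_hsum g i))"

lemma sq_summable_Rep: "(\<lambda>i. (norm (Rep_hsum f i))\<^sup>2) summable_on UNIV"
  using Rep_hsum[of f] by simp

lemma hsum_eqI: "(\<And>i. Rep_hsum f i = Rep_hsum g i) \<Longrightarrow> f = g"
  by (metis Rep_hsum_inject ext)

lemma Rep_hsum_scaleC: "Rep_hsum (hsum_scaleC c f) i = c *\<^sub>C Rep_hsum f i"
  by (simp add: hsum_scaleC_def Abs_hsum_inverse sq_summable_scaleC sq_summable_Rep)

lemma scaleC_minus1: "(-1) *\<^sub>C (u::'h::chilbert_space) = - u"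
  using scaleC_of_real[of "-1" u] by simp

lemma cinner_self: "cinner u u = complex_of_real ((norm (u::'h::chilbert_space))\<^sup>2)"
proof (rule complex_eqI)
  show "Re (cinner u u) = Re (complex_of_real ((norm u)\<^sup>2))"
    by (simp add: inner_eq_Re_cinner[symmetric] dot_square_norm)
  show "Im (cinner u u) = Im (complex_of_real ((norm u)\<^sup>2))"
    using arg_cong[OF cinner_commute[of u u], of Im] by simp
qed

lemma hsum_cinner_self:
  "Re (hsum_cinner f f) = (\<Sum>\<^sub>\<infinity>i. (norm (Rep_hsum f i))\<^sup>2)"
proof -
  have "Re (hsum_cinner f f) = (\<Sum>\<^sub>\<infinity>i. Re (cinner (Rep_hsum f i) (Rep_hsum f i)))"
    unfolding hsum_cinner_def
    by (intro infsum_Re[symmetric] sq_summable_cinner sq_summable_Rep)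
  then show ?thesis by (simp add: cinner_self)
qed

lemma sq_summable_of_bound:
  fixes f :: "'i \<Rightarrow> 'h::real_normed_vector"
  assumes "\<And>F. finite F \<Longrightarrow> (\<Sum>i\<in>F. (norm (f i))\<^sup>2) \<le> B"
  shows "(\<lambda>i. (norm (f i))\<^sup>2) summable_on UNIV"
    and "(\<Sum>\<^sub>\<infinity>i. (norm (f i))\<^sup>2) \<le> B"
proof -
  show s: "(\<lambda>i. (norm (f i))\<^sup>2) summable_on UNIV"
    by (rule nonneg_bdd_above_summable_on) (auto intro!: bdd_aboveI2 assms)
  show "(\<Sum>\<^sub>\<infinity>i. (norm (f i))\<^sup>2) \<le> B"
    by (rule infsum_le_finite_sums[OF s]) (auto intro: assms)
qed

instantiation hsum :: (type, chilbert_space) real_inner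
begin

definition "zero_hsum = Abs_hsum (\<lambda>_. 0)"
definition "plus_hsum f g = Abs_hsum (\<lambda>i. Rep_hsum f i + Rep_hsum g i)"
definition "uminus_hsum f = hsum_scaleC (-1) f"
definition "minus_hsum f g = f + - (g :: ('a,'b) hsum)"
definition "scaleR_hsum r f = hsum_scaleC (complex_of_real r) f"
definition "inner_hsum f g = Re (hsum_cinner f g)"
definition "norm_hsum f = sqrt (inner f (f :: ('a,'b) hsum))"
definition "dist_hsum f g = norm (f - g :: ('a,'b) hsum)"
definition "sgn_hsum f = inverse (norm f) *\<^sub>R (f :: ('a,'b) hsum)"
definition "uniformity_hsum =
  (INF e\<in>{0<..}. principal {(f, g :: ('a,'b) hsum). dist f g < e})"
definition "open_hsum (U :: ('a,'b) hsum set) =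
  (\<forall>f\<in>U. \<forall>\<^sub>F (f', g) in uniformity. f' = f \<longrightarrow> g \<in> U)"

lemma Rep_hsum_simps:
  fixes f g :: "('a,'b) hsum"
  shows "Rep_hsum (0 :: ('a,'b) hsum) i = 0"
    and "Rep_hsum (f + g) i = Rep_hsum f i + Rep_hsum g i"
    and "Rep_hsum (- f) i = - Rep_hsum f i"
    and "Rep_hsum (f - g) i = Rep_hsum f i - Rep_hsum g i"
    and "Rep_hsum (r *\<^sub>R f) i = r *\<^sub>R Rep_hsum f i"
proof -
  show p: "Rep_hsum (f + g) i = Rep_hsum f i + Rep_hsum g i" for f g :: "('a,'b) hsum"
    by (simp add: plus_hsum_def Abs_hsum_inverse sq_summable_add sq_summable_Rep)
  show m: "Rep_hsum (- f) i = - Rep_hsum f i" for f :: "('a,'b) hsum"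
    by (simp add: uminus_hsum_def Rep_hsum_scaleC scaleC_minus1)
  show "Rep_hsum (f - g) i = Rep_hsum f i - Rep_hsum g i"
    by (simp add: minus_hsum_def p m)
qed (simp_all add: zero_hsum_def Abs_hsum_inverse scaleR_hsum_def Rep_hsum_scaleC scaleC_of_real)

lemma norm_hsum_sq: "(norm (f :: ('a,'b) hsum))\<^sup>2 = (\<Sum>\<^sub>\<infinity>i. (norm (Rep_hsum f i))\<^sup>2)"
  by (simp add: norm_hsum_def inner_hsum_def hsum_cinner_self infsum_nonneg)

lemma sum_le_norm_hsum:
  assumes "finite F"
  shows "(\<Sum>i\<in>F. (norm (Rep_hsum (f :: ('a,'b) hsum) i))\<^sup>2) \<le> (norm f)\<^sup>2"
  unfolding norm_hsum_sq
  by (rule finite_sum_le_infsum) (auto simp: assms sq_summable_Rep)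

lemma norm_Rep_hsum_le: "norm (Rep_hsum (f :: ('a,'b) hsum) i) \<le> norm f"
proof (rule power2_le_imp_le)
  show "(norm (Rep_hsum f i))\<^sup>2 \<le> (norm f)\<^sup>2" using sum_le_norm_hsum[of "{i}" f] by simp
  show "0 \<le> norm f"
    by (simp add: norm_hsum_def inner_hsum_def hsum_cinner_self infsum_nonneg)
qed

lemma hsum_cinner_commute: "hsum_cinner g f = cnj (hsum_cinner f g)"
  unfolding hsum_cinner_def infsum_cnj[symmetric] by (subst cinner_commute) (rule refl)

lemma hsum_cinner_add_left:
  "hsum_cinner (f + g) h = hsum_cinner f h + hsum_cinner (g :: ('a,'b) hsum) h"
  unfolding hsum_cinner_def Rep_hsum_simps cinner_add_left
  by (intro infsum_add sq_summable_cinner sq_summable_Rep)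

lemma hsum_cinner_scaleC_left: "hsum_cinner (hsum_scaleC c f) g = c * hsum_cinner f g"
  unfolding hsum_cinner_def Rep_hsum_scaleC cinner_scaleC_left by (rule infsum_cmult_right')

instance
proof
  note rs = Rep_hsum_simps
  fix f g h :: "('a,'b) hsum" and r s :: real
  show "f + g + h = f + (g + h)" by (rule hsum_eqI) (simp add: rs)
  show "f + g = g + f" by (rule hsum_eqI) (simp add: rs)
  show "0 + f = f" by (rule hsum_eqI) (simp add: rs)
  show "- f + f = 0" by (rule hsum_eqI) (simp add: rs)
  show "f - g = f + - g" by (rule hsum_eqI) (simp add: rs)
  show "r *\<^sub>R (f + g) = r *\<^sub>R f + r *\<^sub>R g" by (rule hsum_eqI) (simp add: rs algebra_simps)
  show "(r + s) *\<^sub>R f = r *\<^sub>R f + s *\<^sub>R f" by (rule hsum_eqI) (simp add: rs algebra_simps)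
  show "r *\<^sub>R s *\<^sub>R f = (r * s) *\<^sub>R f" by (rule hsum_eqI) (simp add: rs)
  show "1 *\<^sub>R f = f" by (rule hsum_eqI) (simp add: rs)
  show "dist f g = norm (f - g)" by (rule dist_hsum_def)
  show "sgn f = inverse (norm f) *\<^sub>R f" by (rule sgn_hsum_def)
  show "uniformity = (INF e\<in>{0<..}. principal {(f, g :: ('a,'b) hsum). dist f g < e})"
    by (rule uniformity_hsum_def)
  show "open U = (\<forall>f\<in>U. \<forall>\<^sub>F (f', g) in uniformity. f' = f \<longrightarrow> g \<in> U)"
    for U :: "('a,'b) hsum set"
    by (rule open_hsum_def)
  show "inner f g = inner g f" unfolding inner_hsum_def by (subst hsum_cinner_commute) simp
  show "inner (f + g) h = inner f h + inner g h"
    by (simp add: inner_hsum_def hsum_cinner_add_left)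
  show "inner (r *\<^sub>R f) g = r * inner f g"
    by (simp add: inner_hsum_def scaleR_hsum_def hsum_cinner_scaleC_left)
  show "0 \<le> inner f f" by (simp add: inner_hsum_def hsum_cinner_self infsum_nonneg)
  show "inner f f = 0 \<longleftrightarrow> f = 0"
  proof
    assume "inner f f = 0"
    then have "norm f = 0" by (simp add: norm_hsum_def)
    then have "Rep_hsum f i = 0" for i using norm_Rep_hsum_le[of f i] by simp
    then show "f = 0" by (intro hsum_eqI) (simp add: rs)
  qed (simp add: inner_hsum_def hsum_cinner_self rs)
  show "norm f = sqrt (inner f f)" by (rule norm_hsum_def)
qed

end

instance hsum :: (type, chilbert_space) complete_space
proof
  fix X :: "nat \<Rightarrow> ('a, 'b) hsum"
  assume X: "Cauchy X"
  have "Cauchy (\<lambda>n. Rep_hsum (X n) i)" for i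
  proof (rule CauchyI)
    fix e :: real assume "0 < e"
    from CauchyD[OF X this] obtain M
      where M: "\<forall>m\<ge>M. \<forall>n\<ge>M. norm (X m - X n) < e" by blast
    show "\<exists>M. \<forall>m\<ge>M. \<forall>n\<ge>M. norm (Rep_hsum (X m) i - Rep_hsum (X n) i) < e"
      using M norm_Rep_hsum_le[of "X m - X n" i for m n, unfolded Rep_hsum_simps]
      by (meson le_less_trans)
  qed
  then have "\<exists>l. (\<lambda>n. Rep_hsum (X n) i) \<longlonglongrightarrow> l" for i
    by (simp add: Cauchy_convergent_iff convergent_def)
  then obtain L where L: "\<And>i. (\<lambda>n. Rep_hsum (X n) i) \<longlonglongrightarrow> L i" by metis
  have tail: "(\<Sum>i\<in>F. (norm (Rep_hsum (X m) i - L i))\<^sup>2) \<le> e\<^sup>2"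
    if M: "\<forall>m\<ge>M. \<forall>n\<ge>M. norm (X m - X n) < e" and "m \<ge> M" and "finite F" for M m e F
  proof (rule tendsto_upperbound)
    show "(\<lambda>n. \<Sum>i\<in>F. (norm (Rep_hsum (X m) i - Rep_hsum (X n) i))\<^sup>2)
        \<longlonglongrightarrow> (\<Sum>i\<in>F. (norm (Rep_hsum (X m) i - L i))\<^sup>2)"
      by (intro tendsto_intros L)
    have "(\<Sum>i\<in>F. (norm (Rep_hsum (X m) i - Rep_hsum (X n) i))\<^sup>2) \<le> e\<^sup>2" if "n \<ge> M" for n
    proof -
      have "(\<Sum>i\<in>F. (norm (Rep_hsum (X m - X n) i))\<^sup>2) \<le> (norm (X m - X n))\<^sup>2"
        by (rule sum_le_norm_hsum) fact
      also have "\<dots> \<le> e\<^sup>2" using M \<open>m \<ge> M\<close> \<open>n \<ge> M\<close> by (intro power_mono) (auto intro: less_imp_le)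
      finally show ?thesis by (simp add: Rep_hsum_simps)
    qed
    then show "\<forall>\<^sub>F n in sequentially.
        (\<Sum>i\<in>F. (norm (Rep_hsum (X m) i - Rep_hsum (X n) i))\<^sup>2) \<le> e\<^sup>2"
      unfolding eventually_sequentially by blast
  qed simp
  from CauchyD[OF X zero_less_one] obtain M
    where M: "\<forall>m\<ge>M. \<forall>n\<ge>M. norm (X m - X n) < 1" by blast
  have "(\<lambda>i. (norm (Rep_hsum (X M) i - L i))\<^sup>2) summable_on UNIV"
    by (rule sq_summable_of_bound) (rule tail[OF M order_refl])
  then have "(\<lambda>i. (norm (Rep_hsum (X M) i + (-1) *\<^sub>C (Rep_hsum (X M) i - L i)))\<^sup>2) summable_on UNIV"
    by (intro sq_summable_add sq_summable_scaleC sq_summable_Rep)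
  then have RepL: "Rep_hsum (Abs_hsum L) i = L i" for i
    by (simp add: Abs_hsum_inverse scaleC_minus1)
  have "X \<longlonglongrightarrow> Abs_hsum L"
  proof (rule LIMSEQ_I)
    fix r :: real assume "0 < r"
    then have "0 < r / 2" by simp
    from CauchyD[OF X this] obtain N
      where N: "\<forall>m\<ge>N. \<forall>n\<ge>N. norm (X m - X n) < r / 2" by blast
    have "norm (X m - Abs_hsum L) < r" if "m \<ge> N" for m
    proof -
      have "(norm (X m - Abs_hsum L))\<^sup>2 \<le> (r / 2)\<^sup>2"
        unfolding norm_hsum_sq Rep_hsum_simps RepL
        by (rule sq_summable_of_bound) (rule tail[OF N that])
      then have "norm (X m - Abs_hsum L) \<le> r / 2"
        by (rule power2_le_imp_le) (use \<open>0 < r\<close> in simp)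
      then show ?thesis using \<open>0 < r\<close> by simp
    qed
    then show "\<exists>N. \<forall>m\<ge>N. norm (X m - Abs_hsum L) < r" by blast
  qed
  then show "convergent X" by (auto simp: convergent_def)
qed

instantiation hsum :: (type, chilbert_space) chilbert_space
begin

definition "scaleC_hsum = (hsum_scaleC :: complex \<Rightarrow> ('a, 'b) hsum \<Rightarrow> ('a, 'b) hsum)"
definition "cinner_hsum = (hsum_cinner :: ('a, 'b) hsum \<Rightarrow> ('a, 'b) hsum \<Rightarrow> complex)"

instance
proof
  fix f g h :: "('a, 'b) hsum" and c d :: complex and r :: real
  note rs = scaleC_hsum_def Rep_hsum_scaleC Rep_hsum_simps
  show "c *\<^sub>C (f + g) = c *\<^sub>C f + c *\<^sub>C g"
    by (rule hsum_eqI) (simp add: rs scaleC_add_right)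
  show "(c + d) *\<^sub>C f = c *\<^sub>C f + d *\<^sub>C f"
    by (rule hsum_eqI) (simp add: rs scaleC_add_left)
  show "c *\<^sub>C (d *\<^sub>C f) = (c * d) *\<^sub>C f"
    by (rule hsum_eqI) (simp add: rs scaleC_scaleC)
  show "complex_of_real r *\<^sub>C f = r *\<^sub>R f"
    by (simp add: scaleC_hsum_def scaleR_hsum_def)
  show "cinner f g = cnj (cinner g f)"
    by (simp add: cinner_hsum_def hsum_cinner_commute[of f g])
  show "cinner (f + g) h = cinner f h + cinner g h"
    by (simp add: cinner_hsum_def hsum_cinner_add_left)
  show "cinner (c *\<^sub>C f) g = c * cinner f g"
    by (simp add: cinner_hsum_def scaleC_hsum_def hsum_cinner_scaleC_left)
  show "inner f g = Re (cinner f g)"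
    by (simp add: cinner_hsum_def inner_hsum_def)
qed

end

type_synonym ell2 = "(nat, complex) hsum"

definition diag_op :: "('i \<Rightarrow> 'h::chilbert_space op) \<Rightarrow> ('i, 'h) hsum op" where
  "diag_op T = Blinfun (\<lambda>f. Abs_hsum (\<lambda>i. blinfun_apply (T i) (Rep_hsum f i)))"

lemma
  fixes T :: "'i \<Rightarrow> 'h::chilbert_space op"
  assumes "\<And>i. norm (T i) \<le> B"
  shows Rep_diag_op: "Rep_hsum (blinfun_apply (diag_op T) f) i = blinfun_apply (T i) (Rep_hsum f i)"
    and diag_op_bop: "(\<And>i. T i \<in> bop) \<Longrightarrow> diag_op T \<in> bop"
proof -
  let ?S = "\<lambda>f. Abs_hsum (\<lambda>i. blinfun_apply (T i) (Rep_hsum f i))"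
  have B: "0 \<le> B" using assms[of undefined] norm_ge_zero order_trans by blast
  have fin: "(\<Sum>i\<in>F. (norm (blinfun_apply (T i) (Rep_hsum f i)))\<^sup>2) \<le> (B * norm f)\<^sup>2"
    if "finite F" for F and f :: "('i, 'h) hsum"
  proof -
    have "norm (blinfun_apply (T i) v) \<le> B * norm v" for i v
      using norm_blinfun[of "T i" v] mult_right_mono[OF assms[of i], of "norm v"] by simp
    then have "(\<Sum>i\<in>F. (norm (blinfun_apply (T i) (Rep_hsum f i)))\<^sup>2)
        \<le> (\<Sum>i\<in>F. (B * norm (Rep_hsum f i))\<^sup>2)"
      by (intro sum_mono power_mono) auto
    also have "\<dots> = B\<^sup>2 * (\<Sum>i\<in>F. (norm (Rep_hsum f i))\<^sup>2)"
      by (simp add: power_mult_distrib sum_distrib_left)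
    also have "\<dots> \<le> B\<^sup>2 * (norm f)\<^sup>2"
      by (intro mult_left_mono sum_le_norm_hsum that) simp
    finally show ?thesis by (simp add: power_mult_distrib)
  qed
  have R: "Rep_hsum (?S f) i = blinfun_apply (T i) (Rep_hsum f i)" for f i
    using sq_summable_of_bound(1)[OF fin] by (simp add: Abs_hsum_inverse)
  have "bounded_linear ?S"
  proof (rule bounded_linear_intro)
    show "?S (f + g) = ?S f + ?S g" for f g
      by (rule hsum_eqI) (subst Rep_hsum_simps(2), (subst R)+, simp add: Rep_hsum_simps blinfun.add_right)
    show "?S (r *\<^sub>R f) = r *\<^sub>R ?S f" for r f
      by (rule hsum_eqI) (subst Rep_hsum_simps(5), (subst R)+, simp add: Rep_hsum_simps blinfun.scaleR_right)
    show "norm (?S f) \<le> norm f * B" for f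
    proof (rule power2_le_imp_le)
      show "(norm (?S f))\<^sup>2 \<le> (norm f * B)\<^sup>2"
        unfolding norm_hsum_sq R
        using sq_summable_of_bound(2)[OF fin] by (simp add: mult.commute)
    qed (use B in simp)
  qed
  then have D: "blinfun_apply (diag_op T) = ?S"
    by (simp add: diag_op_def bounded_linear_Blinfun_apply)
  have RD: "Rep_hsum (blinfun_apply (diag_op T) f) i = blinfun_apply (T i) (Rep_hsum f i)" for f i
    by (simp only: D R)
  show "Rep_hsum (blinfun_apply (diag_op T) f) i = blinfun_apply (T i) (Rep_hsum f i)"
    by (rule RD)
  show "diag_op T \<in> bop" if "\<And>i. T i \<in> bop"
    using that by (auto intro!: hsum_eqI simp: bop_def RD scaleC_hsum_def Rep_hsum_scaleC)
qed

section \<open>The C*-algebra generated by a universal block isometry\<close>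

text \<open>
  The tuples \<open>(v\<^bsub>a,x\<^esub>)\<close> of operators on \<open>\<ell>\<^sup>2(\<nat>)\<close> for which the block operator
  \<open>(v\<^bsub>a,x\<^esub>)\<^bsub>a,x\<^esub> : \<Oplus>\<^bsub>x\<^esub> \<ell>\<^sup>2(\<nat>) \<rightarrow> \<Oplus>\<^bsub>a\<^esub> \<ell>\<^sup>2(\<nat>)\<close> is an isometry.
\<close>

definition is_block_isometry :: "('a::finite \<Rightarrow> 'x::finite \<Rightarrow> ell2 op) \<Rightarrow> bool" where
  "is_block_isometry V \<longleftrightarrow>
     (\<forall>a x. V a x \<in> bop) \<and>
     (\<forall>h. (\<Sum>a\<in>UNIV. (norm (\<Sum>x\<in>UNIV. blinfun_apply (V a x) (h x)))\<^sup>2)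
        = (\<Sum>x\<in>UNIV. (norm (h x))\<^sup>2))"

definition cuntz_shift :: "nat \<Rightarrow> ell2 \<Rightarrow> ell2" where
  "cuntz_shift k f = Abs_hsum (\<lambda>m. case prod_decode m of (j, n) \<Rightarrow> if j = k then Rep_hsum f n else 0)"

lemma Rep_cuntz_shift:
  "Rep_hsum (cuntz_shift k f) m = (case prod_decode m of (j, n) \<Rightarrow> if j = k then Rep_hsum f n else 0)"
  and norm_cuntz_shift: "norm (cuntz_shift k f) = norm f"
proof -
  let ?g = "\<lambda>m. case prod_decode m of (j, n) \<Rightarrow> if j = k then Rep_hsum f n else 0"
  let ?p = "\<lambda>n. prod_encode (k, n)"
  have inj: "inj ?p" by (simp add: inj_on_def)
  have off: "?g m = 0" if "m \<notin> range ?p" for m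
    using that by (auto split: prod.splits) (metis prod_decode_inverse rangeI)
  have "((\<lambda>m. (norm (?g m))\<^sup>2) has_sum (norm f)\<^sup>2) (range ?p)"
    unfolding norm_hsum_sq
    by (subst has_sum_reindex[OF inj]) (simp add: o_def has_sum_infsum sq_summable_Rep)
  then have hs: "((\<lambda>m. (norm (?g m))\<^sup>2) has_sum (norm f)\<^sup>2) UNIV"
    by (rule has_sum_cong_neutral[THEN iffD1, rotated -1]) (auto simp: off)
  then have "(\<lambda>m. (norm (?g m))\<^sup>2) summable_on UNIV" by (rule has_sum_imp_summable)
  then have R: "Rep_hsum (cuntz_shift k f) m = ?g m" for m
    by (simp add: cuntz_shift_def Abs_hsum_inverse)
  show "Rep_hsum (cuntz_shift k f) m = ?g m" by (rule R)
  have "(norm (cuntz_shift k f))\<^sup>2 = (norm f)\<^sup>2"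
    unfolding norm_hsum_sq[of "cuntz_shift k f"] R using hs by (rule infsumI)
  then show "norm (cuntz_shift k f) = norm f" by simp
qed

lemma bounded_linear_cuntz_shift: "bounded_linear (cuntz_shift k)"
  by (rule bounded_linear_intro[where K = 1])
    (auto intro!: hsum_eqI simp: Rep_cuntz_shift Rep_hsum_simps norm_cuntz_shift split: prod.splits)

lemma cuntz_shift_orthogonal:
  assumes "k \<noteq> l" shows "inner (cuntz_shift k f) (cuntz_shift l g) = 0"
proof -
  have "cinner (Rep_hsum (cuntz_shift k f) m) (Rep_hsum (cuntz_shift l g) m) = 0" for m
    using assms by (auto simp: Rep_cuntz_shift cinner_complex_def split: prod.splits)
  then show ?thesis by (simp add: inner_hsum_def hsum_cinner_def)
qed

lemma ex_block_isometry: "\<exists>V :: 'a::finite \<Rightarrow> 'x::finite \<Rightarrow> ell2 op. is_block_isometry V"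
proof -
  define V :: "'a \<Rightarrow> 'x \<Rightarrow> ell2 op"
    where "V a x = (if a = undefined then Blinfun (cuntz_shift (to_nat x)) else 0)" for a x
  have ap: "blinfun_apply (V a x) f = (if a = undefined then cuntz_shift (to_nat x) f else 0)" for a x f
    by (simp add: V_def bounded_linear_Blinfun_apply[OF bounded_linear_cuntz_shift])
  have "V a x \<in> bop" for a x
  proof -
    have "(c *\<^sub>C (0::ell2)) = 0" for c
      by (rule hsum_eqI) (simp add: scaleC_hsum_def Rep_hsum_scaleC Rep_hsum_simps scaleC_complex_def)
    then show ?thesis
      by (auto simp: bop_def ap scaleC_hsum_def Rep_hsum_scaleC Rep_cuntz_shift scaleC_complex_def
          intro!: hsum_eqI split: prod.splits)
  qed
  moreover have "(\<Sum>a\<in>UNIV. (norm (\<Sum>x\<in>UNIV. blinfun_apply (V a x) (h x)))\<^sup>2) = (\<Sum>x\<in>UNIV. (norm (h x))\<^sup>2)" for h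
  proof -
    let ?S = "\<lambda>x. cuntz_shift (to_nat (x::'x)) (h x)"
    have "(\<Sum>a\<in>UNIV. (norm (\<Sum>x\<in>UNIV. blinfun_apply (V a x) (h x)))\<^sup>2)
        = (\<Sum>a\<in>(UNIV::'a set). if a = undefined then (norm (\<Sum>x\<in>UNIV. ?S x))\<^sup>2 else 0)"
      by (intro sum.cong) (auto simp: ap)
    also have "\<dots> = (norm (\<Sum>x\<in>UNIV. ?S x))\<^sup>2" by simp
    also have "\<dots> = inner (\<Sum>x\<in>UNIV. ?S x) (\<Sum>y\<in>UNIV. ?S y)"
      by (simp add: power2_norm_eq_inner)
    also have "\<dots> = (\<Sum>x\<in>UNIV. \<Sum>y\<in>UNIV. inner (?S x) (?S y))"
      by (simp only: inner_sum_left inner_sum_right) (rule sum.swap)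
    also have "\<dots> = (\<Sum>x\<in>UNIV. \<Sum>y\<in>UNIV. if y = x then (norm (h x))\<^sup>2 else 0)"
      by (intro sum.cong refl)
        (auto simp: cuntz_shift_orthogonal dot_square_norm norm_cuntz_shift)
    also have "\<dots> = (\<Sum>x\<in>UNIV. (norm (h x))\<^sup>2)" by simp
    finally show ?thesis .
  qed
  ultimately show ?thesis unfolding is_block_isometry_def by blast
qed

typedef ('x::finite, 'a::finite) block_isometry =
  "{V :: 'a \<Rightarrow> 'x \<Rightarrow> ell2 op. is_block_isometry V}"
  using ex_block_isometry by auto

text \<open>
  The universal block isometry is the direct sum of all block isometries on \<open>\<ell>\<^sup>2(\<nat>)\<close>.  No larger
  Hilbert spaces are needed for universality: given a block isometry in \<open>B(H,K)\<close>, its restrictions to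
  separable subspaces that are invariant under the ternary ring it generates, amplified and padded to
  infinite dimension, already determine all norms.
\<close>

type_synonym ('x, 'a) univ_space = "(('x, 'a) block_isometry, ell2) hsum"

definition univ_v :: "'a::finite \<Rightarrow> 'x::finite \<Rightarrow> ('x, 'a) univ_space op" where
  "univ_v a x = diag_op (\<lambda>V. Rep_block_isometry V a x)"

lemma norm_block_isometry_le: "norm (Rep_block_isometry V a x) \<le> 1"
proof (rule norm_blinfun_bound)
  fix u :: ell2
  let ?h = "\<lambda>y. if y = x then u else 0"
  have ap: "(\<Sum>y\<in>UNIV. blinfun_apply (Rep_block_isometry V b y) (?h y))
      = blinfun_apply (Rep_block_isometry V b x) u" for b
  proof -
    have "(\<Sum>y\<in>UNIV. blinfun_apply (Rep_block_isometry V b y) (?h y))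
        = (\<Sum>y\<in>UNIV. if y = x then blinfun_apply (Rep_block_isometry V b x) u else 0)"
      by (intro sum.cong) auto
    then show ?thesis by simp
  qed
  have "(\<Sum>y\<in>UNIV. (norm (?h y))\<^sup>2) = (\<Sum>y\<in>UNIV. if y = x then (norm u)\<^sup>2 else 0)"
    by (intro sum.cong) auto
  also have "\<dots> = (norm u)\<^sup>2" by simp
  finally have nh: "(\<Sum>y\<in>UNIV. (norm (?h y))\<^sup>2) = (norm u)\<^sup>2" .
  have "is_block_isometry (Rep_block_isometry V)" using Rep_block_isometry[of V] by simp
  then have "(\<Sum>b\<in>UNIV. (norm (\<Sum>y\<in>UNIV. blinfun_apply (Rep_block_isometry V b y) (?h y)))\<^sup>2)
      = (\<Sum>y\<in>UNIV. (norm (?h y))\<^sup>2)"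
    unfolding is_block_isometry_def by (elim conjE) (erule spec[where x = ?h])
  then have "(\<Sum>b\<in>UNIV. (norm (blinfun_apply (Rep_block_isometry V b x) u))\<^sup>2) = (norm u)\<^sup>2"
    unfolding nh ap .
  moreover have "(norm (blinfun_apply (Rep_block_isometry V a x) u))\<^sup>2
      \<le> (\<Sum>b\<in>UNIV. (norm (blinfun_apply (Rep_block_isometry V b x) u))\<^sup>2)"
    by (rule member_le_sum) auto
  ultimately show "norm (blinfun_apply (Rep_block_isometry V a x) u) \<le> 1 * norm u"
    by (simp add: power2_le_iff_abs_le)
qed simp

lemma Rep_univ_v:
  "Rep_hsum (blinfun_apply (univ_v a x) f) V = blinfun_apply (Rep_block_isometry V a x) (Rep_hsum f V)"
  unfolding univ_v_def by (rule Rep_diag_op) (rule norm_block_isometry_le)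

definition univ_e :: "'x::finite \<Rightarrow> 'x \<Rightarrow> 'a::finite \<Rightarrow> 'a \<Rightarrow> ('x, 'a) univ_space op" where
  "univ_e x x' a a' = op_adj (univ_v a x) o\<^sub>L univ_v a' x'"

definition unital_cstar_algebra :: "'h::chilbert_space op set \<Rightarrow> bool" where
  "unital_cstar_algebra \<A> \<longleftrightarrow>
     \<A> \<subseteq> bop \<and> closed \<A> \<and> id_blinfun \<in> \<A> \<and>
     (\<forall>z\<in>\<A>. \<forall>w\<in>\<A>. z + w \<in> \<A> \<and> z o\<^sub>L w \<in> \<A>) \<and>
     (\<forall>z\<in>\<A>. op_adj z \<in> \<A> \<and> (\<forall>c. op_scaleC c z \<in> \<A>))"

definition C_XA :: "('x::finite, 'a::finite) univ_space op set" where
  "C_XA = unital_cstar_algebra hull {univ_e x x' a a' | x x' a a'. True}"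

section \<open>States, traces and representations\<close>

definition clinear_on :: "'h::chilbert_space op set \<Rightarrow> ('h op \<Rightarrow> complex) \<Rightarrow> bool" where
  "clinear_on \<A> \<tau> \<longleftrightarrow>
     (\<forall>z\<in>\<A>. \<forall>w\<in>\<A>. \<tau> (z + w) = \<tau> z + \<tau> w) \<and> (\<forall>c. \<forall>z\<in>\<A>. \<tau> (op_scaleC c z) = c * \<tau> z)"

definition state :: "'h::chilbert_space op set \<Rightarrow> ('h op \<Rightarrow> complex) \<Rightarrow> bool" where
  "state \<A> \<tau> \<longleftrightarrow>
     clinear_on \<A> \<tau> \<and> (\<forall>z\<in>\<A>. \<tau> (op_adj z o\<^sub>L z) \<in> \<real>\<^sub>\<ge>\<^sub>0) \<and> \<tau> id_blinfun = 1"

definition tracial_state :: "'h::chilbert_space op set \<Rightarrow> ('h op \<Rightarrow> complex) \<Rightarrow> bool" where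
  "tracial_state \<A> \<tau> \<longleftrightarrow> state \<A> \<tau> \<and> (\<forall>z\<in>\<A>. \<forall>w\<in>\<A>. \<tau> (z o\<^sub>L w) = \<tau> (w o\<^sub>L z))"

text \<open>
  Amenability as defined by Brown and Ozawa for a concretely represented \<open>\<A> \<subseteq> B(H)\<close>; it does not
  depend on the chosen faithful representation.
\<close>

definition amenable_trace :: "'h::chilbert_space op set \<Rightarrow> ('h op \<Rightarrow> complex) \<Rightarrow> bool" where
  "amenable_trace \<A> \<tau> \<longleftrightarrow>
     tracial_state \<A> \<tau> \<and>
     (\<exists>\<phi>. state bop \<phi> \<and> (\<forall>z\<in>\<A>. \<phi> z = \<tau> z) \<and>
        (\<forall>u\<in>\<A>. op_adj u o\<^sub>L u = id_blinfun \<and> u o\<^sub>L op_adj u = id_blinfun \<longrightarrow>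
           (\<forall>T\<in>bop. \<phi> (u o\<^sub>L T o\<^sub>L op_adj u) = \<phi> T)))"

definition unital_star_hom ::
  "'h::chilbert_space op set \<Rightarrow> 'k::chilbert_space op set \<Rightarrow> ('h op \<Rightarrow> 'k op) \<Rightarrow> bool" where
  "unital_star_hom \<A> \<B> \<pi> \<longleftrightarrow>
     (\<forall>z\<in>\<A>. \<pi> z \<in> \<B>) \<and> \<pi> id_blinfun = id_blinfun \<and>
     (\<forall>z\<in>\<A>. \<forall>w\<in>\<A>. \<pi> (z + w) = \<pi> z + \<pi> w \<and> \<pi> (z o\<^sub>L w) = \<pi> z o\<^sub>L \<pi> w) \<and>
     (\<forall>z\<in>\<A>. \<pi> (op_adj z) = op_adj (\<pi> z) \<and> (\<forall>c. \<pi> (op_scaleC c z) = op_scaleC c (\<pi> z)))"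

text \<open>
  The target \<open>\<B>\<close> ranges over the unital C*-subalgebras of \<open>B(\<ell>\<^sup>2(\<nat>))\<close>.  For separable \<open>\<A>\<close> this is no
  restriction: a target may be replaced by the image of \<open>\<pi>\<close>, and every separable unital C*-algebra
  (in particular every finite dimensional one) has a faithful unital representation on \<open>\<ell>\<^sup>2(\<nat>)\<close>.
\<close>

definition factors_through ::
  "(ell2 op set \<Rightarrow> bool) \<Rightarrow> 'h::chilbert_space op set \<Rightarrow> ('h op \<Rightarrow> complex) \<Rightarrow> bool" where
  "factors_through P \<A> \<tau> \<longleftrightarrow>
     (\<exists>\<B> \<pi> \<tau>\<^sub>0. unital_cstar_algebra \<B> \<and> P \<B> \<and> unital_star_hom \<A> \<B> \<pi> \<and>
        tracial_state \<B> \<tau>\<^sub>0 \<and> (\<forall>z\<in>\<A>. \<tau> z = \<tau>\<^sub>0 (\<pi> z)))"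

definition finite_dimensional :: "'h::chilbert_space op set \<Rightarrow> bool" where
  "finite_dimensional \<B> \<longleftrightarrow> (\<exists>S. finite S \<and> \<B> \<subseteq> span S)"

definition abelian :: "'h::chilbert_space op set \<Rightarrow> bool" where
  "abelian \<B> \<longleftrightarrow> (\<forall>z\<in>\<B>. \<forall>w\<in>\<B>. z o\<^sub>L w = w o\<^sub>L z)"

section \<open>Matrices, projections and quantum games\<close>

type_synonym 'z cmat = "complex ^ 'z ^ 'z"

definition munit :: "'z::finite \<Rightarrow> 'z \<Rightarrow> 'z cmat" where
  "munit z z' = (\<chi> i j. if i = z \<and> j = z' then 1 else 0)"

definition mscale :: "complex \<Rightarrow> 'z::finite cmat \<Rightarrow> 'z cmat" where
  "mscale c T = (\<chi> i j. c * T $ i $ j)"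

definition mtensor :: "'z::finite cmat \<Rightarrow> 'w::finite cmat \<Rightarrow> ('z \<times> 'w) cmat"  (infixr \<open>\<otimes>\<^sub>m\<close> 70) where
  "S \<otimes>\<^sub>m T = (\<chi> i j. S $ fst i $ fst j * T $ snd i $ snd j)"

definition madj :: "'z::finite cmat \<Rightarrow> 'z cmat" where
  "madj T = (\<chi> i j. cnj (T $ j $ i))"

definition ptrace_fst :: "('z::finite \<times> 'w::finite) cmat \<Rightarrow> 'w cmat" where
  "ptrace_fst T = (\<chi> w w'. \<Sum>z\<in>UNIV. T $ (z, w) $ (z, w'))"

definition ptrace_snd :: "('z::finite \<times> 'w::finite) cmat \<Rightarrow> 'z cmat" where
  "ptrace_snd T = (\<chi> z z'. \<Sum>w\<in>UNIV. T $ (z, w) $ (z', w))"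

definition projections :: "'z::finite cmat set" where
  "projections = {P. P ** P = P \<and> madj P = P}"

definition proj_le :: "'z::finite cmat \<Rightarrow> 'z cmat \<Rightarrow> bool" where
  "proj_le P Q \<longleftrightarrow> Q ** P = P"

definition is_proj_join :: "'z::finite cmat \<Rightarrow> 'z cmat \<Rightarrow> 'z cmat \<Rightarrow> bool" where
  "is_proj_join P Q R \<longleftrightarrow>
     R \<in> projections \<and> proj_le P R \<and> proj_le Q R \<and>
     (\<forall>R'\<in>projections. proj_le P R' \<and> proj_le Q R' \<longrightarrow> proj_le R R')"

text \<open>
  Preservation of binary joins; in finite dimensions this is the same as preservation of the joins
  of arbitrary nonempty families.
\<close>

definition quantum_game ::
  "(('x::finite \<times> 'y::finite) cmat \<Rightarrow> ('a::finite \<times> 'b::finite) cmat) \<Rightarrow> bool" where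
  "quantum_game \<phi> \<longleftrightarrow>
     (\<forall>P\<in>projections. \<phi> P \<in> projections) \<and> \<phi> 0 = 0 \<and>
     (\<forall>P\<in>projections. \<forall>Q\<in>projections. \<forall>R. is_proj_join P Q R \<longrightarrow> is_proj_join (\<phi> P) (\<phi> Q) (\<phi> R))"

definition J_proj :: "('z::finite \<times> 'z) cmat" where
  "J_proj = (1 / real CARD('z)) *\<^sub>R (\<Sum>z\<in>UNIV. \<Sum>z'\<in>UNIV. munit z z' \<otimes>\<^sub>m munit z z')"

definition concurrent ::
  "(('x::finite \<times> 'x) cmat \<Rightarrow> ('a::finite \<times> 'a) cmat) \<Rightarrow> bool" where
  "concurrent \<phi> \<longleftrightarrow> \<phi> J_proj = J_proj"

section \<open>No-signalling correlations\<close>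

definition matrix_clinear :: "('z::finite cmat \<Rightarrow> 'w::finite cmat) \<Rightarrow> bool" where
  "matrix_clinear \<Gamma> \<longleftrightarrow>
     (\<forall>S T. \<Gamma> (S + T) = \<Gamma> S + \<Gamma> T) \<and> (\<forall>c T. \<Gamma> (mscale c T) = mscale c (\<Gamma> T))"

text \<open>Positivity of \<open>(T\<^bsub>i,j\<^esub>)\<^bsub>i,j<n\<^esub>\<close> as an operator on \<open>\<complex>\<^sup>n \<otimes> \<complex>\<^sup>Z\<close>.\<close>

definition block_psd :: "nat \<Rightarrow> (nat \<Rightarrow> nat \<Rightarrow> 'z::finite cmat) \<Rightarrow> bool" where
  "block_psd n T \<longleftrightarrow>
     (\<forall>v :: nat \<Rightarrow> complex ^ 'z.
        (\<Sum>i<n. \<Sum>j<n. \<Sum>z\<in>UNIV. (T i j *v v j) $ z * cnj (v i $ z)) \<in> \<real>\<^sub>\<ge>\<^sub>0)"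

definition completely_positive :: "('z::finite cmat \<Rightarrow> 'w::finite cmat) \<Rightarrow> bool" where
  "completely_positive \<Gamma> \<longleftrightarrow>
     matrix_clinear \<Gamma> \<and> (\<forall>n T. block_psd n T \<longrightarrow> block_psd n (\<lambda>i j. \<Gamma> (T i j)))"

definition quantum_channel :: "('z::finite cmat \<Rightarrow> 'w::finite cmat) \<Rightarrow> bool" where
  "quantum_channel \<Gamma> \<longleftrightarrow> completely_positive \<Gamma> \<and> (\<forall>T. trace (\<Gamma> T) = trace T)"

definition QNS_correlation ::
  "(('x::finite \<times> 'y::finite) cmat \<Rightarrow> ('a::finite \<times> 'b::finite) cmat) \<Rightarrow> bool" where
  "QNS_correlation \<Gamma> \<longleftrightarrow>
     quantum_channel \<Gamma> \<and>
     (\<forall>\<rho> \<sigma>. trace \<rho> = 0 \<longrightarrow> ptrace_fst (\<Gamma> (\<rho> \<otimes>\<^sub>m \<sigma>)) = 0) \<and>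
     (\<forall>\<rho> \<sigma>. trace \<sigma> = 0 \<longrightarrow> ptrace_snd (\<Gamma> (\<rho> \<otimes>\<^sub>m \<sigma>)) = 0)"

definition perfect_strategy ::
  "(('x::finite \<times> 'y::finite) cmat \<Rightarrow> ('a::finite \<times> 'b::finite) cmat)
    \<Rightarrow> (('x \<times> 'y) cmat \<Rightarrow> ('a \<times> 'b) cmat) \<Rightarrow> bool" where
  "perfect_strategy \<phi> \<Gamma> \<longleftrightarrow> (\<forall>P\<in>projections. trace (\<Gamma> P ** (mat 1 - \<phi> P)) = 0)"

text \<open>
  The entry \<open>E x x' a a'\<close> is the coefficient of \<open>\<epsilon>\<^bsub>x,x'\<^esub> \<otimes> \<epsilon>\<^bsub>a,a'\<^esub>\<close>, i.e. the entry in row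
  \<open>(x,a)\<close> and column \<open>(x',a')\<close>.
\<close>

definition stochastic_operator_matrix ::
  "('x::finite \<Rightarrow> 'x \<Rightarrow> 'a::finite \<Rightarrow> 'a \<Rightarrow> 'h::chilbert_space op) \<Rightarrow> bool" where
  "stochastic_operator_matrix E \<longleftrightarrow>
     (\<forall>x x' a a'. E x x' a a' \<in> bop) \<and>
     (\<forall>h. (\<Sum>x\<in>UNIV. \<Sum>x'\<in>UNIV. \<Sum>a\<in>UNIV. \<Sum>a'\<in>UNIV.
             cinner (blinfun_apply (E x x' a a') (h x' a')) (h x a)) \<in> \<real>\<^sub>\<ge>\<^sub>0) \<and>
     (\<forall>x x'. (\<Sum>a\<in>UNIV. E x x' a a) = (if x = x' then id_blinfun else 0))"

text \<open>
  The Hilbert space is the type argument \<open>'h\<close>; a theorem assuming this predicate for a type variable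
  \<open>'h\<close> applies to all Hilbert spaces.
\<close>

definition quantum_commuting ::
  "'h::chilbert_space itself
    \<Rightarrow> (('x::finite \<times> 'y::finite) cmat \<Rightarrow> ('a::finite \<times> 'b::finite) cmat) \<Rightarrow> bool" where
  "quantum_commuting _ \<Gamma> \<longleftrightarrow>
     QNS_correlation \<Gamma> \<and>
     (\<exists>(\<xi>::'h) E F.
        norm \<xi> = 1 \<and> stochastic_operator_matrix E \<and> stochastic_operator_matrix F \<and>
        (\<forall>x x' a a' y y' b b'. E x x' a a' o\<^sub>L F y y' b b' = F y y' b b' o\<^sub>L E x x' a a') \<and>
        (\<forall>x x' y y'. \<Gamma> (munit x x' \<otimes>\<^sub>m munit y y') =
           (\<Sum>a\<in>UNIV. \<Sum>a'\<in>UNIV. \<Sum>b\<in>UNIV. \<Sum>b'\<in>UNIV.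
              mscale (cinner (blinfun_apply (E x x' a a' o\<^sub>L F y y' b b') \<xi>) \<xi>)
                (munit a a' \<otimes>\<^sub>m munit b b'))))"

text \<open>
  Stochastic operator matrices on the finite dimensional Hilbert space \<open>\<complex>\<^sup>n\<close>: every entry
  \<open>E x x' a a'\<close> is an \<open>n \<times> n\<close> matrix, given by its coefficients with indices below \<open>n\<close>.
\<close>

definition fd_stochastic_operator_matrix ::
  "nat \<Rightarrow> ('x::finite \<Rightarrow> 'x \<Rightarrow> 'a::finite \<Rightarrow> 'a \<Rightarrow> nat \<Rightarrow> nat \<Rightarrow> complex) \<Rightarrow> bool" where
  "fd_stochastic_operator_matrix n E \<longleftrightarrow>
     (\<forall>h :: 'x \<Rightarrow> 'a \<Rightarrow> nat \<Rightarrow> complex.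
        (\<Sum>x\<in>UNIV. \<Sum>x'\<in>UNIV. \<Sum>a\<in>UNIV. \<Sum>a'\<in>UNIV. \<Sum>i<n. \<Sum>j<n.
           E x x' a a' i j * h x' a' j * cnj (h x a i)) \<in> \<real>\<^sub>\<ge>\<^sub>0) \<and>
     (\<forall>x x'. \<forall>i<n. \<forall>j<n. (\<Sum>a\<in>UNIV. E x x' a a i j) = (if x = x' \<and> i = j then 1 else 0))"

text \<open>\<open>\<langle>(S \<otimes> T)\<xi>,\<xi>\<rangle>\<close> for \<open>\<xi> \<in> \<complex>\<^sup>n \<otimes> \<complex>\<^sup>m\<close>.\<close>

definition fd_tensor_form ::
  "nat \<Rightarrow> nat \<Rightarrow> (nat \<Rightarrow> nat \<Rightarrow> complex) \<Rightarrow> (nat \<Rightarrow> nat \<Rightarrow> complex) \<Rightarrow> (nat \<Rightarrow> nat \<Rightarrow> complex) \<Rightarrow> complex" where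
  "fd_tensor_form n m S T \<xi> =
     (\<Sum>i<n. \<Sum>i'<n. \<Sum>j<m. \<Sum>j'<m. S i i' * T j j' * \<xi> i' j' * cnj (\<xi> i j))"

definition quantum_correlation ::
  "(('x::finite \<times> 'y::finite) cmat \<Rightarrow> ('a::finite \<times> 'b::finite) cmat) \<Rightarrow> bool" where
  "quantum_correlation \<Gamma> \<longleftrightarrow>
     QNS_correlation \<Gamma> \<and>
     (\<exists>n m \<xi> E F.
        (\<Sum>i<n. \<Sum>j<m. (cmod (\<xi> i j))\<^sup>2) = 1 \<and>
        fd_stochastic_operator_matrix n E \<and> fd_stochastic_operator_matrix m F \<and>
        (\<forall>x x' y y'. \<Gamma> (munit x x' \<otimes>\<^sub>m munit y y') =
           (\<Sum>a\<in>UNIV. \<Sum>a'\<in>UNIV. \<Sum>b\<in>UNIV. \<Sum>b'\<in>UNIV.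
              mscale (fd_tensor_form n m (E x x' a a') (F y y' b b') \<xi>)
                (munit a a' \<otimes>\<^sub>m munit b b'))))"

definition approximately_quantum ::
  "(('x::finite \<times> 'y::finite) cmat \<Rightarrow> ('a::finite \<times> 'b::finite) cmat) \<Rightarrow> bool" where
  "approximately_quantum \<Gamma> \<longleftrightarrow>
     QNS_correlation \<Gamma> \<and>
     (\<exists>G. (\<forall>k::nat. quantum_correlation (G k)) \<and> (\<forall>T. (\<lambda>k. G k T) \<longlonglongrightarrow> \<Gamma> T))"

text \<open>The equation on elementary tensors determines the (linear) map \<open>\<Gamma>\<close>.\<close>

definition local_correlation ::
  "(('x::finite \<times> 'y::finite) cmat \<Rightarrow> ('a::finite \<times> 'b::finite) cmat) \<Rightarrow> bool" where
  "local_correlation \<Gamma> \<longleftrightarrow>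
     QNS_correlation \<Gamma> \<and>
     (\<exists>(k::nat) p \<Phi> \<Psi>.
        (\<forall>i<k. 0 \<le> p i \<and> quantum_channel (\<Phi> i) \<and> quantum_channel (\<Psi> i)) \<and>
        (\<Sum>i<k. p i) = (1::real) \<and>
        (\<forall>S T. \<Gamma> (S \<otimes>\<^sub>m T) = (\<Sum>i<k. p i *\<^sub>R (\<Phi> i S \<otimes>\<^sub>m \<Psi> i T))))"

definition is_trace_correlation ::
  "(('x::finite \<times> 'x) cmat \<Rightarrow> ('a::finite \<times> 'a) cmat)
    \<Rightarrow> (('x, 'a) univ_space op \<Rightarrow> complex) \<Rightarrow> bool" where
  "is_trace_correlation \<Gamma> \<tau> \<longleftrightarrow>
     (\<forall>x x' y y'. \<Gamma> (munit x x' \<otimes>\<^sub>m munit y y') =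
        (\<Sum>a\<in>UNIV. \<Sum>a'\<in>UNIV. \<Sum>b\<in>UNIV. \<Sum>b'\<in>UNIV.
           mscale (\<tau> (univ_e x x' a a' o\<^sub>L univ_e y' y b' b)) (munit a a' \<otimes>\<^sub>m munit b b')))"

end

theory Submission
  imports Defs
begin

text \<open>
  Write \<open>\<Gamma>\<close> in terms of commuting stochastic operator matrices \<open>E\<close>, \<open>F\<close> and a unit vector \<open>\<xi>\<close>.  Since
  \<open>\<Gamma>(J_X) = J_A\<close>, the sum of the numbers \<open>\<langle>E\<^bsub>x,x',a,a'\<^esub> F\<^bsub>x,x',a,a'\<^esub> \<xi>, \<xi>\<rangle>\<close> equals \<open>|X| |A|\<close>.  On the
  other hand positivity and normalisation force \<open>\<Sum> \<parallel>E\<^bsub>x,x',a,a'\<^esub> \<xi>\<parallel>\<^sup>2 \<le> |X| |A|\<close>, and likewise for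
  \<open>F\<close>.  Hence the Cauchy--Schwarz inequality is an equality and
  \<open>F\<^bsub>x,x',a,a'\<^esub> \<xi> = E\<^bsub>x',x,a',a\<^esub> \<xi>\<close>.  For \<open>T\<close> in the commutant of \<open>F\<close> this gives
  \<open>\<langle>E T \<xi>, \<xi>\<rangle> = \<langle>T E \<xi>, \<xi>\<rangle>\<close>: the generators lie in the centralizer of the vector state, which is a
  C*-algebra, so the state is tracial on the image of \<open>C_XA\<close>.

  All three refinements come from the choice of the algebra in which the centralizer is taken.
  For a quantum correlation \<open>E\<close> acts on \<open>\<complex>\<^sup>n\<close>, padded to an operator on \<open>\<ell>\<^sup>2\<close>; for a local one \<open>E\<close> is
  diagonal.  For an approximately quantum correlation the defect in the Cauchy--Schwarz inequality
  tends to zero, and a weak* limit point of the states obtained from the approximants has the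
  generators in its centralizer inside the whole of \<open>B(H)\<close>, which is amenability.
\<close>

text \<open>The bound |X| |A| rests on the inequality E \<le> |A|: the blocks that are diagonal in
  the index from A are positive and add up to the identity, and a positive matrix is at most |A|
  times its block diagonal. Hence E^2 \<le> |A| E, and the diagonal entries of this, evaluated at
  \<xi> and summed, give |X| |A|. The Cauchy-Schwarz gap is kept as a number, \<open>defect\<close>,
  so that the same estimates serve the exact case and the limit. The obstacle is that
  \<open>C_XA\<close> is concrete: it is generated by the direct sum of all block isometries on
  \<open>ell2\<close>. A representation sending \<open>univ_e\<close> to E is found by factoring E
  as V adjoint times V and compressing to the summand V. This requires \<open>ell2\<close> as the
  space, and the factorisation comes from a Cholesky decomposition of a scalar kernel instead of a
  square root of operators. The compression is defined on all of B(H) and is multiplicative as soon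
  as one factor is block diagonal, so it also carries states to the whole of B(H). Tensor products
  are realised as direct sums of copies.\<close>

abbreviation (input) app :: "('a::real_normed_vector \<Rightarrow>\<^sub>L 'b::real_normed_vector) \<Rightarrow> 'a \<Rightarrow> 'b" where
  "app \<equiv> blinfun_apply"

section \<open>Inner product calculus\<close>

lemma scaleC_zero_left [simp]: "0 *\<^sub>C (u::'h::chilbert_space) = 0"
  using scaleC_of_real[of 0 u] by simp

lemma scaleC_one [simp]: "1 *\<^sub>C (u::'h::chilbert_space) = u"
  using scaleC_of_real[of 1 u] by simp

lemma scaleC_zero_right [simp]: "c *\<^sub>C (0::'h::chilbert_space) = 0"
  using scaleC_add_right[of c 0 "0::'h"] by simp

lemma scaleC_minus_right: "c *\<^sub>C (- u) = - (c *\<^sub>C (u::'h::chilbert_space))"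
  using scaleC_add_right[of c u "- u"] by (simp add: eq_neg_iff_add_eq_0 add.commute)

lemma scaleC_diff_right: "c *\<^sub>C (u - v) = c *\<^sub>C u - c *\<^sub>C (v::'h::chilbert_space)"
  using scaleC_add_right[of c u "- v"] by (simp add: scaleC_minus_right)

lemma scaleC_diff_left: "(c - d) *\<^sub>C u = c *\<^sub>C u - d *\<^sub>C (u::'h::chilbert_space)"
  using scaleC_add_left[of "c - d" d u] by (simp add: algebra_simps)

lemma scaleC_scaleR: "c *\<^sub>C (r *\<^sub>R u) = r *\<^sub>R (c *\<^sub>C (u::'h::chilbert_space))"
  by (metis scaleC_of_real scaleC_scaleC mult.commute)

lemma cinner_zero_left [simp]: "cinner 0 (v::'h::chilbert_space) = 0"
  using cinner_scaleC_left[of 0 v v] by simp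

lemma cinner_zero_right [simp]: "cinner (v::'h::chilbert_space) 0 = 0"
  using cinner_commute[of v 0] by simp

lemma cinner_add_right: "cinner u (v + w) = cinner u v + cinner u (w::'h::chilbert_space)"
  by (metis cinner_commute cinner_add_left complex_cnj_add)

lemma cinner_scaleC_right: "cinner u (c *\<^sub>C v) = cnj c * cinner u (v::'h::chilbert_space)"
  by (metis cinner_commute cinner_scaleC_left complex_cnj_mult)

lemma cinner_minus_left: "cinner (- u) v = - cinner u (v::'h::chilbert_space)"
  using cinner_add_left[of u "- u" v] by (simp add: eq_neg_iff_add_eq_0 add.commute)

lemma cinner_minus_right: "cinner u (- v) = - cinner u (v::'h::chilbert_space)"
  using cinner_add_right[of u v "- v"] by (simp add: eq_neg_iff_add_eq_0 add.commute)

lemma cinner_diff_left: "cinner (u - w) v = cinner u v - cinner w (v::'h::chilbert_space)"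
  using cinner_add_left[of u "- w" v] by (simp add: cinner_minus_left)

lemma cinner_diff_right: "cinner u (v - w) = cinner u v - cinner u (w::'h::chilbert_space)"
  using cinner_add_right[of u v "- w"] by (simp add: cinner_minus_right)

lemma cinner_scaleR_left: "cinner (r *\<^sub>R u) v = of_real r * cinner u (v::'h::chilbert_space)"
  by (metis cinner_scaleC_left scaleC_of_real)

lemma cinner_scaleR_right: "cinner u (r *\<^sub>R v) = of_real r * cinner u (v::'h::chilbert_space)"
  by (metis cinner_scaleC_right scaleC_of_real complex_cnj_complex_of_real)

lemma cinner_sum_left: "cinner (\<Sum>i\<in>I. f i) (v::'h::chilbert_space) = (\<Sum>i\<in>I. cinner (f i) v)"
  by (induction I rule: infinite_finite_induct) (auto simp: cinner_add_left)

lemma cinner_sum_right: "cinner (v::'h::chilbert_space) (\<Sum>i\<in>I. f i) = (\<Sum>i\<in>I. cinner v (f i))"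
  by (induction I rule: infinite_finite_induct) (auto simp: cinner_add_right)

lemma cinner_eqI: "(\<And>v. cinner u v = cinner w (v::'h::chilbert_space)) \<Longrightarrow> u = w"
  by (metis inner_eq_Re_cinner vector_eq_rdot)

lemma cinner_eqI': "(\<And>v. cinner v u = cinner v (w::'h::chilbert_space)) \<Longrightarrow> u = w"
  by (metis inner_eq_Re_cinner vector_eq_ldot)

lemma bounded_linear_scaleC: "bounded_linear (\<lambda>v::'h::chilbert_space. c *\<^sub>C v)"
  by (rule bounded_linear_intro[where K = "cmod c"])
    (auto simp: scaleC_add_right norm_scaleC scaleC_scaleR)

lemmas continuous_on_scaleC [continuous_intros] = bounded_linear.continuous_on[OF bounded_linear_scaleC]

section \<open>Adjoints\<close>

lemma minimal_norm_orthogonal: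
  fixes w v :: "'a::real_inner"
  assumes "\<And>t. norm w \<le> norm (w + t *\<^sub>R v)"
  shows "inner w v = 0"
proof (rule ccontr)
  assume nz: "inner w v \<noteq> 0"
  then have v: "inner v v > 0" by (metis inner_gt_zero_iff inner_zero_right)
  \<comment> \<open>The minimiser of the quadratic polynomial in t; its value lies below the squared
    norm of \<open>w\<close> by the square of \<open>inner w v\<close> over
    \<open>inner v v\<close>.\<close>
  define t where "t = - inner w v / inner v v"
  have "(norm w)\<^sup>2 \<le> (norm (w + t *\<^sub>R v))\<^sup>2"
    by (intro power_mono assms) auto
  also have "\<dots> = (norm w)\<^sup>2 + 2 * t * inner w v + t\<^sup>2 * inner v v"
    unfolding power2_norm_eq_inner
    by (simp add: inner_add_left inner_add_right inner_commute power2_eq_square algebra_simps)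
  also have "\<dots> = (norm w)\<^sup>2 - (inner w v)\<^sup>2 / inner v v"
    using v by (simp add: t_def power2_eq_square field_simps)
  finally show False using nz v by (simp add: field_simps)
qed

text \<open>Midpoints of a minimising sequence stay in the convex set, so the parallelogram law
  makes the sequence Cauchy.\<close>

lemma ex_minimal_norm:
  fixes C :: "'a::{real_inner,complete_space} set"
  assumes "closed C" "convex C" "C \<noteq> {}"
  shows "\<exists>w\<in>C. \<forall>u\<in>C. norm w \<le> norm u"
proof -
  define d where "d = (INF u\<in>C. (norm u)\<^sup>2)"
  have bdd: "bdd_below ((\<lambda>u. (norm u)\<^sup>2) ` C)" by (rule bdd_belowI[of _ 0]) auto
  have d: "d \<le> (norm u)\<^sup>2" if "u \<in> C" for u
    unfolding d_def by (rule cINF_lower[OF bdd that])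
  have "\<exists>u\<in>C. (norm u)\<^sup>2 < d + 1 / real (Suc n)" for n
    using cInf_lessD[of "(\<lambda>u. (norm u)\<^sup>2) ` C" "d + 1 / real (Suc n)"] assms(3)
    unfolding d_def by auto
  then obtain u where u: "\<And>n. u n \<in> C" "\<And>n. (norm (u n))\<^sup>2 < d + 1 / real (Suc n)" by metis
  have par: "(norm (u m - u n))\<^sup>2 \<le> 2 / real (Suc m) + 2 / real (Suc n)" for m n
  proof -
    have "(1/2) *\<^sub>R u m + (1/2) *\<^sub>R u n \<in> C"
      using u(1) assms(2) by (intro convexD) auto
    then have "d \<le> (norm ((1/2) *\<^sub>R u m + (1/2) *\<^sub>R u n))\<^sup>2" by (rule d)
    then have "4 * d \<le> (norm (u m + u n))\<^sup>2"
      by (simp add: scaleR_add_right[symmetric] power2_eq_square)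
    moreover have "(norm (u m - u n))\<^sup>2 + (norm (u m + u n))\<^sup>2 = 2 * (norm (u m))\<^sup>2 + 2 * (norm (u n))\<^sup>2"
      by (simp add: power2_norm_eq_inner inner_add_left inner_add_right inner_diff_left inner_diff_right)
    ultimately show ?thesis using u(2)[of m] u(2)[of n] by simp
  qed
  have "Cauchy u"
  proof (rule CauchyI)
    fix e :: real assume e: "0 < e"
    \<comment> \<open>Beyond N each of the two terms in \<open>par\<close> is below half of
      \<open>e\<^sup>2\<close>.\<close>
    obtain N where N: "4 / e\<^sup>2 < real N" using reals_Archimedean2 by blast
    have *: "norm (u m - u n) < e" if "m \<ge> N" "n \<ge> N" for m n
    proof -
      have "2 / real (Suc k) < e\<^sup>2 / 2" if "k \<ge> N" for k
      proof -
        have "4 / e\<^sup>2 < real (Suc k)" using N that by simp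
        then show ?thesis using e by (simp add: field_simps)
      qed
      from this[OF \<open>m \<ge> N\<close>] this[OF \<open>n \<ge> N\<close>] have "(norm (u m - u n))\<^sup>2 < e\<^sup>2"
        using par[of m n] by linarith
      then show ?thesis using e by (simp add: power2_less_imp_less)
    qed
    then show "\<exists>M. \<forall>m\<ge>M. \<forall>n\<ge>M. norm (u m - u n) < e" by blast
  qed
  then obtain w where w: "u \<longlonglongrightarrow> w" by (auto simp: Cauchy_convergent_iff convergent_def)
  have "w \<in> C" using closed_sequentially[OF assms(1)] u(1) w by blast
  moreover have "(norm w)\<^sup>2 \<le> d"
  proof (rule LIMSEQ_le)
    show "(\<lambda>n. (norm (u n))\<^sup>2) \<longlonglongrightarrow> (norm w)\<^sup>2" by (intro tendsto_intros w)
    show "(\<lambda>n. d + 1 / real (Suc n)) \<longlonglongrightarrow> d"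
      using LIMSEQ_inverse_real_of_nat_add[of d] by (simp add: inverse_eq_divide)
    show "\<exists>N. \<forall>n\<ge>N. (norm (u n))\<^sup>2 \<le> d + 1 / real (Suc n)" using u(2) less_imp_le by blast
  qed
  moreover have "norm w \<le> norm u" if "u \<in> C" for u
    by (rule power2_le_imp_le[OF order_trans[OF \<open>(norm w)\<^sup>2 \<le> d\<close> d[OF that]]]) simp
  ultimately show ?thesis by blast
qed

text \<open>The vector of minimal norm on the hyperplane f = 1 is orthogonal to the kernel of f;
  rescaled, it represents f.\<close>

lemma riesz_representation:
  fixes f :: "'a::{real_inner,complete_space} \<Rightarrow> real"
  assumes "bounded_linear f"
  shows "\<exists>w. \<forall>u. f u = inner u w"
proof (cases "\<forall>u. f u = 0")
  case False
  interpret f: bounded_linear f by fact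
  from False obtain u0 where u0: "f u0 \<noteq> 0" by blast
  let ?C = "{u. f u = 1}"
  have "closed ?C"
    by (intro closed_Collect_eq f.continuous_on continuous_intros)
  moreover have "convex ?C" by (auto simp: convex_def f.add f.scaleR)
  moreover have "(1 / f u0) *\<^sub>R u0 \<in> ?C" using u0 by (simp add: f.scaleR)
  ultimately obtain w where w: "f w = 1" "\<And>u. f u = 1 \<Longrightarrow> norm w \<le> norm u"
    using ex_minimal_norm[of ?C] by blast
  have orth: "inner w v = 0" if "f v = 0" for v
    by (rule minimal_norm_orthogonal) (auto intro!: w(2) simp: f.add f.scaleR w(1) that)
  have "w \<noteq> 0" using w(1) f.zero by auto
  have "f u = inner u ((1 / inner w w) *\<^sub>R w)" for u
  proof -
    have "inner w (u - f u *\<^sub>R w) = 0" by (rule orth) (simp add: f.diff f.scaleR w(1))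
    then have "inner u w = f u * inner w w" by (simp add: inner_diff_right inner_commute)
    then show ?thesis using \<open>w \<noteq> 0\<close> by simp
  qed
  then show ?thesis by blast
qed (auto intro: exI[of _ 0])

text \<open>The condition of \<open>bop\<close> for maps between two different spaces, such as
  coordinate maps and synthesis operators.\<close>

definition clin :: "('h::chilbert_space \<Rightarrow>\<^sub>L 'k::chilbert_space) \<Rightarrow> bool" where
  "clin T \<longleftrightarrow> (\<forall>c u. app T (c *\<^sub>C u) = c *\<^sub>C app T u)"

lemma bop_iff_clin: "T \<in> bop \<longleftrightarrow> clin T"
  by (simp add: bop_def clin_def)

lemma clinD: "clin T \<Longrightarrow> app T (c *\<^sub>C u) = c *\<^sub>C app T u"
  by (simp add: clin_def)

lemma bopD: "T \<in> bop \<Longrightarrow> app T (c *\<^sub>C u) = c *\<^sub>C app T u"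
  by (simp add: bop_def)

lemma ex_adjoint:
  fixes T :: "'h::chilbert_space \<Rightarrow>\<^sub>L 'k::chilbert_space"
  assumes "clin T"
  shows "\<exists>S. clin S \<and> norm S \<le> norm T \<and>
    (\<forall>u v. cinner (app T u) v = cinner u (app S v))"
proof -
  have "\<exists>w. \<forall>u. inner (app T u) v = inner u w" for v
    by (rule riesz_representation)
      (auto intro!: bounded_linear_intros)
  then obtain S where S: "\<And>u v. inner (app T u) v = inner u (S v)" by metis
  have C: "cinner (app T u) v = cinner u (S v)" for u v
  proof (rule complex_eqI)
    show "Re (cinner (app T u) v) = Re (cinner u (S v))"
      using S by (simp add: inner_eq_Re_cinner)
    \<comment> \<open>The imaginary part of z is the real part of -i z, so the real identity at (-i)
      u supplies the other half.\<close>
    have "Im (cinner (app T u) v) = Re (cinner (app T ((-\<i>) *\<^sub>C u)) v)"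
      by (simp add: clinD[OF assms] cinner_scaleC_left)
    also have "\<dots> = Re (cinner ((-\<i>) *\<^sub>C u) (S v))"
      using S by (simp add: inner_eq_Re_cinner)
    also have "\<dots> = Im (cinner u (S v))" by (simp add: cinner_scaleC_left)
    finally show "Im (cinner (app T u) v) = Im (cinner u (S v))" .
  qed
  have CS: "cinner (S v) u = cinner v (app T u)" for u v
    using C[of u v] by (metis cinner_commute)
  have bnd: "norm (S v) \<le> norm T * norm v" for v
  proof (cases "S v = 0")
    case False
    have "norm (S v) * norm (S v) = inner (S v) (S v)"
      by (simp add: dot_square_norm power2_eq_square)
    also have "\<dots> = inner (app T (S v)) v" by (simp add: S)
    also have "\<dots> \<le> norm (app T (S v)) * norm v" by (rule norm_cauchy_schwarz)
    also have "\<dots> \<le> (norm T * norm (S v)) * norm v"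
      by (intro mult_right_mono norm_blinfun) auto
    finally have "norm (S v) * norm (S v) \<le> (norm T * norm v) * norm (S v)"
      by (simp add: mult_ac)
    then show ?thesis using False by simp
  qed simp
  have bl: "bounded_linear S"
  proof (rule bounded_linear_intro)
    show "S (u + v) = S u + S v" for u v
      by (rule cinner_eqI) (simp add: CS cinner_add_left)
    show "S (r *\<^sub>R u) = r *\<^sub>R S u" for r u
      by (rule cinner_eqI) (simp add: CS cinner_scaleR_left)
    show "norm (S v) \<le> norm v * norm T" for v using bnd by (simp add: mult.commute)
  qed
  have ap: "app (Blinfun S) = S" by (rule bounded_linear_Blinfun_apply[OF bl])
  have "S (c *\<^sub>C u) = c *\<^sub>C S u" for c u
    by (rule cinner_eqI) (simp add: CS cinner_scaleC_left)
  moreover have "norm (Blinfun S) \<le> norm T"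
    by (rule norm_blinfun_bound) (auto simp: ap bnd)
  ultimately show ?thesis
    using C by (intro exI[of _ "Blinfun S"]) (auto simp: clin_def ap)
qed

lemma op_adj_eqI:
  assumes "\<And>u v. cinner (app T u) v = cinner u (app S v)"
  shows "op_adj T = S"
  unfolding op_adj_def
proof (rule the_equality)
  fix R assume R: "\<forall>u v. cinner (app T u) v = cinner u (app R v)"
  show "R = S"
  proof (rule blinfun_eqI)
    fix v show "app R v = app S v"
      by (rule cinner_eqI) (simp add: cinner_commute[of "app _ v"] R[rule_format, symmetric]
          assms[symmetric])
  qed
qed (use assms in blast)

lemma
  assumes "T \<in> bop"
  shows cinner_op_adj: "cinner (app T u) v = cinner u (app (op_adj T) v)"
    and op_adj_bop: "op_adj T \<in> bop"
proof -
  obtain S where S: "clin S"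
    "\<forall>u v. cinner (app T u) v = cinner u (app S v)"
    using ex_adjoint assms unfolding bop_iff_clin by blast
  have "op_adj T = S" by (rule op_adj_eqI) (use S in blast)
  with S show "cinner (app T u) v = cinner u (app (op_adj T) v)"
    and "op_adj T \<in> bop"
    by (auto simp: bop_iff_clin)
qed

lemma cinner_op_adj':
  "T \<in> bop \<Longrightarrow> cinner (app (op_adj T) u) v = cinner u (app T v)"
  using cinner_op_adj[of T v u] cinner_commute[of "app (op_adj T) u" v]
    cinner_commute[of u "app T v"] by simp

lemma bop_intros:
  shows "id_blinfun \<in> bop" "0 \<in> bop"
    and "S \<in> bop \<Longrightarrow> T \<in> bop \<Longrightarrow> S + T \<in> bop"
    and "S \<in> bop \<Longrightarrow> T \<in> bop \<Longrightarrow> S - T \<in> bop"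
    and "S \<in> bop \<Longrightarrow> T \<in> bop \<Longrightarrow> S o\<^sub>L T \<in> bop"
    and "T \<in> bop \<Longrightarrow> op_scaleC c T \<in> bop"
  by (auto simp: bop_def op_scaleC_apply scaleC_add_right scaleC_diff_right blinfun.add_left
      blinfun.diff_left scaleC_scaleC mult.commute)

lemma bop_sum: "(\<And>i. i \<in> I \<Longrightarrow> f i \<in> bop) \<Longrightarrow> (\<Sum>i\<in>I. f i) \<in> bop"
  by (induction I rule: infinite_finite_induct) (auto intro: bop_intros)

lemma op_adj_adj: "T \<in> bop \<Longrightarrow> op_adj (op_adj T) = T"
  by (rule op_adj_eqI) (simp add: cinner_op_adj')

lemma op_adj_compose: "S \<in> bop \<Longrightarrow> T \<in> bop \<Longrightarrow> op_adj (S o\<^sub>L T) = op_adj T o\<^sub>L op_adj S"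
  by (rule op_adj_eqI) (simp add: cinner_op_adj)

lemma op_scaleC_compose: "op_scaleC c (S o\<^sub>L T) = op_scaleC c S o\<^sub>L T"
  by (rule blinfun_eqI) (simp add: op_scaleC_apply)

lemma compose_op_scaleC: "S \<in> bop \<Longrightarrow> S o\<^sub>L op_scaleC c T = op_scaleC c (S o\<^sub>L T)"
  by (rule blinfun_eqI) (simp add: op_scaleC_apply bopD)

lemmas blinfun_compose_distrib =
  bounded_bilinear.add_left[OF bounded_bilinear_blinfun_compose]
  bounded_bilinear.add_right[OF bounded_bilinear_blinfun_compose]
  bounded_bilinear.diff_left[OF bounded_bilinear_blinfun_compose]
  bounded_bilinear.diff_right[OF bounded_bilinear_blinfun_compose]

lemma blinfun_compose_assoc: "(R o\<^sub>L S) o\<^sub>L T = R o\<^sub>L (S o\<^sub>L T)"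
  by (rule blinfun_eqI) simp

lemma blinfun_compose_id [simp]: "id_blinfun o\<^sub>L T = T" "T o\<^sub>L id_blinfun = T"
  by (auto intro: blinfun_eqI)

lemma closed_bop: "closed (bop :: 'h::chilbert_space op set)"
proof -
  have "bop = (\<Inter>c. \<Inter>u. {T :: 'h op. app T (c *\<^sub>C u) = c *\<^sub>C app T u})"
    by (auto simp: bop_def)
  also have "closed \<dots>"
    by (intro closed_INT ballI closed_Collect_eq continuous_intros)
  finally show ?thesis .
qed

section \<open>Commutants and centralizers\<close>

lemma op_scaleC_minus_one: "op_scaleC (-1) T = - T"
  by (rule blinfun_eqI) (simp add: op_scaleC_apply scaleC_minus1 blinfun.minus_left)

lemma unital_cstar_algebraD:
  assumes "unital_cstar_algebra \<A>"
  shows "\<A> \<subseteq> bop" "closed \<A>" "id_blinfun \<in> \<A>"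
    and "z \<in> \<A> \<Longrightarrow> w \<in> \<A> \<Longrightarrow> z + w \<in> \<A>"
    and "z \<in> \<A> \<Longrightarrow> w \<in> \<A> \<Longrightarrow> z o\<^sub>L w \<in> \<A>"
    and "z \<in> \<A> \<Longrightarrow> op_adj z \<in> \<A>"
    and "z \<in> \<A> \<Longrightarrow> op_scaleC c z \<in> \<A>"
    and "z \<in> \<A> \<Longrightarrow> w \<in> \<A> \<Longrightarrow> z - w \<in> \<A>"
proof -
  show "z - w \<in> \<A>" if "z \<in> \<A>" "w \<in> \<A>"
  proof -
    have "z + op_scaleC (-1) w \<in> \<A>" using assms that unfolding unital_cstar_algebra_def by blast
    then show ?thesis by (simp add: op_scaleC_minus_one)
  qed
qed (use assms in \<open>auto simp: unital_cstar_algebra_def\<close>)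

lemma unital_cstar_algebra_bop: "unital_cstar_algebra bop"
  unfolding unital_cstar_algebra_def using closed_bop by (auto intro: bop_intros op_adj_bop)

definition commutant :: "'h::chilbert_space op set \<Rightarrow> 'h op set" where
  "commutant \<S> = {T \<in> bop. \<forall>S\<in>\<S>. T o\<^sub>L S = S o\<^sub>L T}"

lemma unital_cstar_algebra_commutant:
  assumes "\<S> \<subseteq> bop" "\<And>S. S \<in> \<S> \<Longrightarrow> op_adj S \<in> \<S>"
  shows "unital_cstar_algebra (commutant \<S>)"
  unfolding unital_cstar_algebra_def
proof (intro conjI ballI allI)
  show "commutant \<S> \<subseteq> bop" by (auto simp: commutant_def)
  have "commutant \<S> = bop \<inter> (\<Inter>S\<in>\<S>. {T. T o\<^sub>L S = S o\<^sub>L T})" by (auto simp: commutant_def)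
  also have "closed \<dots>"
    by (intro closed_Int closed_bop closed_INT ballI closed_Collect_eq
        bounded_bilinear.continuous_on[OF bounded_bilinear_blinfun_compose] continuous_intros)
  finally show "closed (commutant \<S>)" .
  show "id_blinfun \<in> commutant \<S>" by (auto simp: commutant_def intro: bop_intros)
  fix z assume z: "z \<in> commutant \<S>"
  then have zb: "z \<in> bop" and zc: "\<And>S. S \<in> \<S> \<Longrightarrow> z o\<^sub>L S = S o\<^sub>L z" by (auto simp: commutant_def)
  show "op_scaleC c z \<in> commutant \<S>" for c
    using zb zc assms(1)
    by (auto simp: commutant_def op_scaleC_compose[symmetric] compose_op_scaleC subset_iff intro: bop_intros)
  have "op_adj z o\<^sub>L S = S o\<^sub>L op_adj z" if S: "S \<in> \<S>" for S
  proof -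
    have Sb: "S \<in> bop" using S assms(1) by blast
    have "op_adj (op_adj S o\<^sub>L z) = op_adj (z o\<^sub>L op_adj S)"
      using zc[OF assms(2)[OF S]] by simp
    then show ?thesis using Sb zb by (simp add: op_adj_compose op_adj_adj op_adj_bop)
  qed
  then show "op_adj z \<in> commutant \<S>" using zb by (auto simp: commutant_def op_adj_bop)
  fix w assume w: "w \<in> commutant \<S>"
  then have wb: "w \<in> bop" and wc: "\<And>S. S \<in> \<S> \<Longrightarrow> w o\<^sub>L S = S o\<^sub>L w" by (auto simp: commutant_def)
  show "z + w \<in> commutant \<S>"
    using zb zc wb wc by (auto simp: commutant_def blinfun_compose_distrib intro: bop_intros)
  have "(z o\<^sub>L w) o\<^sub>L S = S o\<^sub>L (z o\<^sub>L w)" if "S \<in> \<S>" for S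
    by (metis blinfun_compose_assoc zc wc that)
  then show "z o\<^sub>L w \<in> commutant \<S>"
    using zb wb by (auto simp: commutant_def intro: bop_intros)
qed

text \<open>The two properties of a state that make its centralizer a C*-algebra: contractivity for
  closedness, hermitian symmetry for adjoints. Carrying them along avoids deriving them from
  positivity.\<close>

definition bounded_hermitian :: "'h::chilbert_space op set \<Rightarrow> ('h op \<Rightarrow> complex) \<Rightarrow> bool" where
  "bounded_hermitian \<A> \<tau> \<longleftrightarrow>
     clinear_on \<A> \<tau> \<and> (\<forall>z\<in>\<A>. cmod (\<tau> z) \<le> norm z \<and> \<tau> (op_adj z) = cnj (\<tau> z))"

definition centralizer :: "'h::chilbert_space op set \<Rightarrow> ('h op \<Rightarrow> complex) \<Rightarrow> 'h op set" where
  "centralizer \<A> \<tau> = {z \<in> \<A>. \<forall>w\<in>\<A>. \<tau> (z o\<^sub>L w) = \<tau> (w o\<^sub>L z)}"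

text \<open>Products move around the functional one factor at a time. Adjoints reduce to z itself,
  because both sides are conjugates of values of \<tau> on products of z with the adjoint of
  w.\<close>

lemma unital_cstar_algebra_centralizer:
  assumes A: "unital_cstar_algebra \<A>" and \<tau>: "bounded_hermitian \<A> \<tau>"
  shows "unital_cstar_algebra (centralizer \<A> \<tau>)"
proof -
  note AD = unital_cstar_algebraD[OF A]
  have Ab: "z \<in> bop" if "z \<in> \<A>" for z using that AD(1) by blast
  have add: "\<tau> (z + w) = \<tau> z + \<tau> w" and scl: "\<tau> (op_scaleC c z) = c * \<tau> z"
    and bnd: "cmod (\<tau> z) \<le> norm z" and her: "\<tau> (op_adj z) = cnj (\<tau> z)"
    if "z \<in> \<A>" "w \<in> \<A>" for z w c
    using \<tau> that by (auto simp: bounded_hermitian_def clinear_on_def)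
  have diff: "\<tau> (z - w) = \<tau> z - \<tau> w" if "z \<in> \<A>" "w \<in> \<A>" for z w
    using add[of "z - w" w] that AD(8) by simp
  have cont: "(\<lambda>n. \<tau> (f n)) \<longlonglongrightarrow> \<tau> z" if "f \<longlonglongrightarrow> z" "\<And>n. f n \<in> \<A>" "z \<in> \<A>" for f z
  proof (rule LIM_zero_cancel, rule Lim_null_comparison)
    show "\<forall>\<^sub>F n in sequentially. norm (\<tau> (f n) - \<tau> z) \<le> norm (f n - z)"
      using that bnd AD(8) by (auto simp: diff[symmetric])
    show "(\<lambda>n. norm (f n - z)) \<longlonglongrightarrow> 0"
      using that(1) by (intro tendsto_norm_zero LIM_zero)
  qed
  show ?thesis
    unfolding unital_cstar_algebra_def
  proof (intro conjI ballI allI)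
    show "centralizer \<A> \<tau> \<subseteq> bop" using AD(1) by (auto simp: centralizer_def)
    show "closed (centralizer \<A> \<tau>)"
      unfolding closed_sequential_limits
    proof (intro allI impI, elim conjE)
      fix f z assume f: "\<forall>n. f n \<in> centralizer \<A> \<tau>" and lim: "f \<longlonglongrightarrow> z"
      have fA: "f n \<in> \<A>" for n using f by (auto simp: centralizer_def)
      have zA: "z \<in> \<A>" using closed_sequentially[OF AD(2) _ lim] fA by blast
      have "\<tau> (z o\<^sub>L w) = \<tau> (w o\<^sub>L z)" if w: "w \<in> \<A>" for w
      proof (rule LIMSEQ_unique)
        show "(\<lambda>n. \<tau> (f n o\<^sub>L w)) \<longlonglongrightarrow> \<tau> (z o\<^sub>L w)"
          by (intro cont bounded_bilinear.tendsto[OF bounded_bilinear_blinfun_compose] lim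
              tendsto_const AD(5) fA zA w)
        have "(\<lambda>n. \<tau> (w o\<^sub>L f n)) \<longlonglongrightarrow> \<tau> (w o\<^sub>L z)"
          by (intro cont bounded_bilinear.tendsto[OF bounded_bilinear_blinfun_compose] lim
              tendsto_const AD(5) fA zA w)
        then show "(\<lambda>n. \<tau> (f n o\<^sub>L w)) \<longlonglongrightarrow> \<tau> (w o\<^sub>L z)"
          using f w by (simp add: centralizer_def)
      qed
      with zA show "z \<in> centralizer \<A> \<tau>" by (auto simp: centralizer_def)
    qed
    show "id_blinfun \<in> centralizer \<A> \<tau>" using AD by (auto simp: centralizer_def)
    fix z assume "z \<in> centralizer \<A> \<tau>"
    then have z: "z \<in> \<A>" "\<And>w. w \<in> \<A> \<Longrightarrow> \<tau> (z o\<^sub>L w) = \<tau> (w o\<^sub>L z)" by (auto simp: centralizer_def)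
    show "op_scaleC c z \<in> centralizer \<A> \<tau>" for c
      using z AD by (auto simp: centralizer_def op_scaleC_compose[symmetric] compose_op_scaleC Ab scl)
    have "\<tau> (op_adj z o\<^sub>L w) = \<tau> (w o\<^sub>L op_adj z)" if w: "w \<in> \<A>" for w
    proof -
      have "op_adj z o\<^sub>L w = op_adj (op_adj w o\<^sub>L z)" "w o\<^sub>L op_adj z = op_adj (z o\<^sub>L op_adj w)"
        using z w by (auto simp: op_adj_compose op_adj_adj Ab op_adj_bop)
      then show ?thesis using z w AD by (simp add: her)
    qed
    then show "op_adj z \<in> centralizer \<A> \<tau>" using z AD by (auto simp: centralizer_def)
    fix z' assume "z' \<in> centralizer \<A> \<tau>"
    then have z': "z' \<in> \<A>" "\<And>w. w \<in> \<A> \<Longrightarrow> \<tau> (z' o\<^sub>L w) = \<tau> (w o\<^sub>L z')" by (auto simp: centralizer_def)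
    show "z + z' \<in> centralizer \<A> \<tau>"
      using z z' AD by (auto simp: centralizer_def blinfun_compose_distrib add)
    have "\<tau> ((z o\<^sub>L z') o\<^sub>L w) = \<tau> (w o\<^sub>L (z o\<^sub>L z'))" if w: "w \<in> \<A>" for w
    proof -
      have "\<tau> ((z o\<^sub>L z') o\<^sub>L w) = \<tau> (z o\<^sub>L (z' o\<^sub>L w))" by (simp add: blinfun_compose_assoc)
      also have "\<dots> = \<tau> ((z' o\<^sub>L w) o\<^sub>L z)" by (rule z(2)[OF AD(5)[OF z'(1) w]])
      also have "\<dots> = \<tau> (z' o\<^sub>L (w o\<^sub>L z))" by (simp add: blinfun_compose_assoc)
      also have "\<dots> = \<tau> ((w o\<^sub>L z) o\<^sub>L z')" by (rule z'(2)[OF AD(5)[OF w z(1)]])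
      finally show ?thesis by (simp add: blinfun_compose_assoc)
    qed
    then show "z o\<^sub>L z' \<in> centralizer \<A> \<tau>" using z z' AD by (auto simp: centralizer_def)
  qed
qed

text \<open>\<open>C_XA_minimal\<close> is the induction principle of the algebra: a property that
  holds for the generators and cuts out a unital C*-algebra holds throughout, with no approximation
  by words.\<close>

lemma unital_cstar_algebra_C_XA:
  "unital_cstar_algebra (C_XA :: ('x::finite, 'a::finite) univ_space op set)"
  and univ_e_C_XA: "univ_e x x' a a' \<in> (C_XA :: ('x::finite, 'a::finite) univ_space op set)"
  and C_XA_minimal: "unital_cstar_algebra \<A> \<Longrightarrow> (\<And>x x' a a'. univ_e x x' a a' \<in> \<A>) \<Longrightarrow>
    (C_XA :: ('x::finite, 'a::finite) univ_space op set) \<subseteq> \<A>"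
proof -
  show "C_XA \<subseteq> \<A>" if "unital_cstar_algebra \<A>" "\<And>x x' a a'. univ_e x x' a a' \<in> \<A>"
    for \<A> :: "('x::finite, 'a::finite) univ_space op set"
    unfolding C_XA_def by (rule hull_minimal) (use that in auto)
  show "univ_e x x' a a' \<in> (C_XA :: ('x::finite, 'a::finite) univ_space op set)"
    unfolding C_XA_def by (rule subsetD[OF hull_subset]) blast
  have v: "univ_v a x \<in> (bop :: ('x::finite, 'a::finite) univ_space op set)" for a x
  proof -
    have "is_block_isometry (Rep_block_isometry (V :: ('x, 'a) block_isometry))" for V
      using Rep_block_isometry[of V] by simp
    then have "Rep_block_isometry V a x \<in> bop" for V :: "('x, 'a) block_isometry"
      by (simp add: is_block_isometry_def)
    then show ?thesis
      unfolding univ_v_def by (intro diag_op_bop[where B = 1] norm_block_isometry_le)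
  qed
  have e: "univ_e x x' a a' \<in> (bop :: ('x::finite, 'a::finite) univ_space op set)" for x x' a a'
    unfolding univ_e_def by (intro bop_intros op_adj_bop v)
  let ?G = "{univ_e x x' a a' | x x' a a'. True} :: ('x::finite, 'a::finite) univ_space op set"
  \<comment> \<open>An empty intersection would consist of all real-linear operators; having
    \<open>bop\<close> in the family puts the hull inside \<open>bop\<close>.\<close>
  have "bop \<in> {\<A>. unital_cstar_algebra \<A> \<and> ?G \<subseteq> \<A>}"
    using unital_cstar_algebra_bop e by blast
  then have "(\<Inter>{\<A>. unital_cstar_algebra \<A> \<and> ?G \<subseteq> \<A>}) \<subseteq> bop" by blast
  then show "unital_cstar_algebra (C_XA :: ('x::finite, 'a::finite) univ_space op set)"
    unfolding C_XA_def hull_def unital_cstar_algebra_def[of "\<Inter>_"]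
    by (auto intro!: closed_Inter dest: unital_cstar_algebraD)
qed

section \<open>Coordinates of direct sums\<close>

definition emb :: "'i \<Rightarrow> 'h \<Rightarrow>\<^sub>L ('i, 'h::chilbert_space) hsum" where
  "emb i = Blinfun (\<lambda>u. Abs_hsum (\<lambda>j. if j = i then u else 0))"

definition proj :: "'i \<Rightarrow> ('i, 'h::chilbert_space) hsum \<Rightarrow>\<^sub>L 'h" where
  "proj i = Blinfun (\<lambda>f. Rep_hsum f i)"

lemma proj_apply: "app (proj i) (f :: ('i, 'h::chilbert_space) hsum) = Rep_hsum f i"
proof -
  have "bounded_linear (\<lambda>f :: ('i, 'h) hsum. Rep_hsum f i)"
    by (rule bounded_linear_intro[where K = 1]) (auto simp: Rep_hsum_simps norm_Rep_hsum_le)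
  then show ?thesis by (simp add: proj_def bounded_linear_Blinfun_apply)
qed

lemma Abs_hsum_single:
  fixes u :: "'h::chilbert_space"
  shows "Rep_hsum (Abs_hsum (\<lambda>j. if j = i then u else 0)) j = (if j = i then u else 0)"
    and "norm (Abs_hsum (\<lambda>j. if j = i then u else 0)) = norm u"
proof -
  have s: "((\<lambda>j. (norm (if j = i then u else 0))\<^sup>2) has_sum (norm u)\<^sup>2) UNIV"
    by (rule has_sum_finite_neutralI[of "{i}"]) auto
  show R: "Rep_hsum (Abs_hsum (\<lambda>j. if j = i then u else 0)) j = (if j = i then u else 0)" for j
    using has_sum_imp_summable[OF s] by (simp add: Abs_hsum_inverse)
  have "(norm (Abs_hsum (\<lambda>j. if j = i then u else 0)))\<^sup>2 = (norm u)\<^sup>2"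
    unfolding norm_hsum_sq R using s by (rule infsumI)
  then show "norm (Abs_hsum (\<lambda>j. if j = i then u else 0)) = norm u" by simp
qed

lemma emb_apply:
  "app (emb i) u = Abs_hsum (\<lambda>j. if j = i then u else (0::'h::chilbert_space))"
proof -
  have "bounded_linear (\<lambda>u::'h. Abs_hsum (\<lambda>j. if j = i then u else 0))"
    by (rule bounded_linear_intro[where K = 1])
      (auto intro!: hsum_eqI simp: Rep_hsum_simps Abs_hsum_single)
  then show ?thesis by (simp add: emb_def bounded_linear_Blinfun_apply)
qed

lemma Rep_emb: "Rep_hsum (app (emb i) u) j = (if j = i then u else 0)"
  and norm_emb [simp]: "norm (app (emb i) u) = norm u"
  by (simp_all add: emb_apply Abs_hsum_single)

lemma proj_emb [simp]: "app (proj i) (app (emb j) u) = (if i = j then u else 0)"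
  by (simp add: proj_apply Rep_emb)

lemma clin_emb: "clin (emb i)"
  by (auto simp: clin_def scaleC_hsum_def Rep_hsum_scaleC Rep_emb intro!: hsum_eqI)

lemma clin_proj: "clin (proj i)"
  by (auto simp: clin_def scaleC_hsum_def Rep_hsum_scaleC proj_apply)

lemma hsum_eq_proj: "(\<And>i. app (proj i) f = app (proj i) g) \<Longrightarrow> f = g"
  by (auto simp: proj_apply intro: hsum_eqI)

lemma cinner_emb_right: "cinner f (app (emb i) u) = cinner (app (proj i) f) u"
proof -
  have "cinner f (app (emb i) u) = (\<Sum>\<^sub>\<infinity>j\<in>{i}. cinner (Rep_hsum f j) u)"
    unfolding cinner_hsum_def hsum_cinner_def
    by (rule infsum_cong_neutral) (auto simp: Rep_emb)
  then show ?thesis by (simp add: proj_apply)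
qed

lemma cinner_emb_left: "cinner (app (emb i) u) f = cinner u (app (proj i) f)"
  by (metis cinner_commute cinner_emb_right)

text \<open>The coordinates of an adjoint are determined by the values of the operator on the
  summands. Comparing adjoints therefore replaces the density of finite sums.\<close>

lemma blinfun_hsum_eqI:
  fixes S T :: "('i, 'h::chilbert_space) hsum \<Rightarrow>\<^sub>L 'k::chilbert_space"
  assumes "clin S" "clin T"
    and "\<And>i u. app S (app (emb i) u) = app T (app (emb i) u)"
  shows "S = T"
proof -
  obtain S' where S': "\<And>u v. cinner (app S u) v = cinner u (app S' v)"
    using ex_adjoint[OF assms(1)] by blast
  obtain T' where T': "\<And>u v. cinner (app T u) v = cinner u (app T' v)"
    using ex_adjoint[OF assms(2)] by blast
  have "cinner (app (proj i) (app S' v)) u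
      = cinner (app (proj i) (app T' v)) u" for i u v
    by (subst (1 2) cinner_commute)
      (simp add: cinner_emb_left[symmetric] S'[symmetric] T'[symmetric] assms(3))
  then have "app S' v = app T' v" for v
    by (rule hsum_eq_proj[OF cinner_eqI])
  then show ?thesis
    by (intro blinfun_eqI[OF cinner_eqI]) (simp only: S' T')
qed

section \<open>The standard basis of \<open>ell2\<close>\<close>

abbreviation ket :: "nat \<Rightarrow> ell2" where "ket n \<equiv> app (emb n) 1"

lemma emb_complex: "app (emb n) (c::complex) = c *\<^sub>C app (emb n) 1"
  using clinD[OF clin_emb, of n c "1::complex"] by (simp add: scaleC_complex_def)

lemma blinfun_ell2_eqI:
  fixes S T :: "ell2 \<Rightarrow>\<^sub>L 'k::chilbert_space"
  assumes "clin S" "clin T" "\<And>n. app S (ket n) = app T (ket n)"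
  shows "S = T"
  by (rule blinfun_hsum_eqI[OF assms(1,2)])
    (subst (1 2) emb_complex, simp add: clinD assms)

lemma clin_compose: "clin S \<Longrightarrow> clin T \<Longrightarrow> clin (S o\<^sub>L T)"
  by (simp add: clin_def)

text \<open>The corner map of the i-th summand. It is meaningful for every operator, also where it
  is not multiplicative, and this is how states on one summand become states on operators of the
  whole sum.\<close>

definition compress :: "'i \<Rightarrow> ('i, 'h::chilbert_space) hsum op \<Rightarrow> 'h op" where
  "compress i T = proj i o\<^sub>L T o\<^sub>L emb i"

lemma compress_apply: "app (compress i T) u = app (proj i) (app T (app (emb i) u))"
  by (simp add: compress_def)

lemma compress_simps:
  shows "compress i id_blinfun = id_blinfun" "compress i (S + T) = compress i S + compress i T"
    and "compress i (op_scaleC c T) = op_scaleC c (compress i T)"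
    and "T \<in> bop \<Longrightarrow> compress i T \<in> bop"
  by (auto intro!: blinfun_eqI simp: compress_apply blinfun.add_left blinfun.add_right op_scaleC_apply
      clinD[OF clin_proj] clinD[OF clin_emb] bop_def)

lemma compress_adj: "T \<in> bop \<Longrightarrow> compress i (op_adj T) = op_adj (compress i T)"
  by (rule op_adj_eqI[symmetric])
    (simp add: compress_apply cinner_emb_right[symmetric] cinner_op_adj cinner_emb_left)

lemma norm_compress_le: "norm (compress i T) \<le> norm T"
proof (rule norm_blinfun_bound)
  fix u
  have "norm (app (compress i T) u) \<le> norm (app T (app (emb i) u))"
    by (simp add: compress_apply proj_apply norm_Rep_hsum_le)
  also have "\<dots> \<le> norm T * norm u" using norm_blinfun[of T "app (emb i) u"] by simp
  finally show "norm (app (compress i T) u) \<le> norm T * norm u" .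
qed simp

text \<open>Ket-bra: the matrix unit at (i, j), with the identity of the summand as its
  entry.\<close>

definition kb :: "'i \<Rightarrow> 'i \<Rightarrow> ('i, 'h::chilbert_space) hsum op" where
  "kb i j = emb i o\<^sub>L proj j"

lemma kb_bop: "kb i j \<in> bop"
  by (simp add: kb_def bop_iff_clin clin_compose clin_emb clin_proj)

lemma kb_adj: "op_adj (kb i j) = kb j i"
  by (rule op_adj_eqI) (simp add: kb_def cinner_emb_left cinner_emb_right)

lemma kb_apply: "app (kb i j) f = app (emb i) (app (proj j) f)"
  by (simp add: kb_def)

text \<open>\<open>compress i\<close> is multiplicative on the operators that commute with the projection onto the \<open>i\<close>-th
  summand.\<close>

definition block_diag :: "'i \<Rightarrow> ('i, 'h::chilbert_space) hsum op set" where
  "block_diag i = commutant {kb i i}"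

lemma unital_cstar_algebra_block_diag: "unital_cstar_algebra (block_diag i)"
  unfolding block_diag_def by (rule unital_cstar_algebra_commutant) (auto simp: kb_bop kb_adj)

lemma block_diag_emb:
  assumes "T \<in> block_diag i"
  shows "app T (app (emb i) u) = app (emb i) (app (compress i T) u)"
proof -
  have "app (T o\<^sub>L kb i i) (app (emb i) u) = app (kb i i o\<^sub>L T) (app (emb i) u)"
    using assms by (simp add: block_diag_def commutant_def)
  then show ?thesis by (simp add: kb_apply compress_apply)
qed

lemma block_diag_proj:
  assumes "T \<in> block_diag i"
  shows "app (proj i) (app T f) = app (compress i T) (app (proj i) f)"
proof -
  have "app (kb i i) (app T f) = app (T o\<^sub>L kb i i) f"
    using assms by (simp add: block_diag_def commutant_def)
  then have "app (proj i) (app (kb i i) (app T f))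
      = app (proj i) (app (T o\<^sub>L kb i i) f)" by (rule arg_cong)
  then show ?thesis by (simp add: kb_apply compress_apply)
qed

text \<open>One block diagonal factor suffices and the other is arbitrary; the amenable case takes a
  generator as the first and any T in \<open>bop\<close> as the second.\<close>

lemma compress_compose:
  "S \<in> block_diag i \<Longrightarrow> compress i (S o\<^sub>L T) = compress i S o\<^sub>L compress i T"
  "T \<in> block_diag i \<Longrightarrow> compress i (S o\<^sub>L T) = compress i S o\<^sub>L compress i T"
proof -
  show "S \<in> block_diag i \<Longrightarrow> compress i (S o\<^sub>L T) = compress i S o\<^sub>L compress i T"
    by (rule blinfun_eqI) (simp add: compress_apply[of i "S o\<^sub>L T"] compress_apply[of i T] block_diag_proj)
  show "T \<in> block_diag i \<Longrightarrow> compress i (S o\<^sub>L T) = compress i S o\<^sub>L compress i T"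
    by (rule blinfun_eqI) (simp add: compress_apply[of i "S o\<^sub>L T"] block_diag_emb compress_apply[of i S])
qed

lemma diag_op_emb:
  assumes "\<And>i. norm (T i) \<le> B"
  shows "app (diag_op T) (app (emb i) u) = app (emb i) (app (T i) u)"
  by (rule hsum_eqI) (auto simp: Rep_diag_op[OF assms] Rep_emb)

lemma diag_op_proj:
  assumes "\<And>i. norm (T i) \<le> B"
  shows "app (proj i) (app (diag_op T) f) = app (T i) (app (proj i) f)"
  by (auto simp: Rep_diag_op[OF assms] proj_apply)

lemma diag_op_block_diag:
  assumes "\<And>i. norm (T i) \<le> B" "\<And>i. T i \<in> bop"
  shows "diag_op T \<in> block_diag i"
  using diag_op_bop[OF assms]
  by (auto simp: block_diag_def commutant_def kb_apply diag_op_emb[OF assms(1)] diag_op_proj[OF assms(1)]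
      intro!: blinfun_eqI)

lemma compress_diag_op:
  assumes "\<And>i. norm (T i) \<le> B"
  shows "compress i (diag_op T) = T i"
  by (rule blinfun_eqI) (simp add: compress_apply diag_op_emb[OF assms])

lemma
  fixes V :: "('x::finite, 'a::finite) block_isometry"
  shows univ_e_block_diag: "univ_e x x' a a' \<in> block_diag V"
    and compress_univ_e:
    "compress V (univ_e x x' a a') = op_adj (Rep_block_isometry V a x) o\<^sub>L Rep_block_isometry V a' x'"
proof -
  have "is_block_isometry (Rep_block_isometry V)" for V :: "('x, 'a) block_isometry"
    using Rep_block_isometry[of V] by simp
  then have b: "Rep_block_isometry V a x \<in> bop" for V :: "('x, 'a) block_isometry" and a x
    by (simp add: is_block_isometry_def)
  have v: "univ_v a x \<in> block_diag V" for a x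
    unfolding univ_v_def by (intro diag_op_block_diag[where B = 1] norm_block_isometry_le b)
  note D = unital_cstar_algebraD[OF unital_cstar_algebra_block_diag[of V]]
  show "univ_e x x' a a' \<in> block_diag V"
    unfolding univ_e_def using v D(5,6) by blast
  have "compress V (univ_v a x) = Rep_block_isometry V a x" for a x
    unfolding univ_v_def by (rule compress_diag_op) (rule norm_block_isometry_le)
  then show "compress V (univ_e x x' a a') = op_adj (Rep_block_isometry V a x) o\<^sub>L Rep_block_isometry V a' x'"
    unfolding univ_e_def using v subsetD[OF D(1) v] by (simp add: compress_compose(2) compress_adj)
qed

section \<open>Gram vectors of positive kernels\<close>

definition psd_kernel :: "('i \<Rightarrow> 'i \<Rightarrow> complex) \<Rightarrow> bool" where
  "psd_kernel K \<longleftrightarrow> (\<forall>F c. finite F \<longrightarrow> (\<Sum>i\<in>F. \<Sum>j\<in>F. K i j * c j * cnj (c i)) \<in> \<real>\<^sub>\<ge>\<^sub>0)"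

lemma psd_kernelD: "psd_kernel K \<Longrightarrow> finite F \<Longrightarrow> (\<Sum>i\<in>F. \<Sum>j\<in>F. K i j * c j * cnj (c i)) \<in> \<real>\<^sub>\<ge>\<^sub>0"
  by (simp add: psd_kernel_def)

text \<open>Coefficients extend by 0 to a larger set, so positivity need only be checked on
  arbitrarily large finite sets of convenient shape.\<close>

lemma psd_kernelI:
  assumes "\<And>F. finite F \<Longrightarrow>
    \<exists>G. finite G \<and> F \<subseteq> G \<and> (\<forall>c. (\<Sum>i\<in>G. \<Sum>j\<in>G. K i j * c j * cnj (c i)) \<in> \<real>\<^sub>\<ge>\<^sub>0)"
  shows "psd_kernel K"
  unfolding psd_kernel_def
proof (intro allI impI)
  fix F :: "'a set" and c :: "'a \<Rightarrow> complex"
  assume F: "finite F"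
  obtain G where G: "finite G" "F \<subseteq> G" "\<And>c. (\<Sum>i\<in>G. \<Sum>j\<in>G. K i j * c j * cnj (c i)) \<in> \<real>\<^sub>\<ge>\<^sub>0"
    using assms[OF F] by blast
  let ?c = "\<lambda>i. if i \<in> F then c i else 0"
  have "(\<Sum>i\<in>G. \<Sum>j\<in>G. K i j * ?c j * cnj (?c i)) = (\<Sum>i\<in>F. \<Sum>j\<in>F. K i j * c j * cnj (c i))"
    using G(1,2) by (intro sum.mono_neutral_cong_right) auto
  then show "(\<Sum>i\<in>F. \<Sum>j\<in>F. K i j * c j * cnj (c i)) \<in> \<real>\<^sub>\<ge>\<^sub>0" using G(3)[of ?c] by simp
qed

lemma psd_kernel_pullback:
  assumes "psd_kernel K" "inj f"
  shows "psd_kernel (\<lambda>i j. K (f i) (f j))"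
  unfolding psd_kernel_def
proof (intro allI impI)
  fix F :: "'b set" and c :: "'b \<Rightarrow> complex"
  assume "finite F"
  then have "(\<Sum>i\<in>f ` F. \<Sum>j\<in>f ` F. K i j * c (inv f j) * cnj (c (inv f i))) \<in> \<real>\<^sub>\<ge>\<^sub>0"
    by (intro psd_kernelD assms) auto
  then show "(\<Sum>i\<in>F. \<Sum>j\<in>F. K (f i) (f j) * c j * cnj (c i)) \<in> \<real>\<^sub>\<ge>\<^sub>0"
    by (simp add: sum.reindex inj_on_subset[OF assms(2)] inv_f_f[OF assms(2)])
qed

lemma psd_kernel_diag: "psd_kernel K \<Longrightarrow> K i i \<in> \<real>\<^sub>\<ge>\<^sub>0"
  using psd_kernelD[of K "{i}" "\<lambda>_. 1"] by simp

lemma psd_kernel_two: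
  assumes "psd_kernel K" "i \<noteq> j"
  shows "K i i * c * cnj c + K i j * d * cnj c + K j i * c * cnj d + K j j * d * cnj d \<in> \<real>\<^sub>\<ge>\<^sub>0"
  using psd_kernelD[OF assms(1), of "{i, j}" "\<lambda>k. if k = i then c else d"] assms(2)
  by (simp add: add.assoc)

lemma psd_kernel_hermitian:
  assumes "psd_kernel K"
  shows "K j i = cnj (K i j)"
proof (cases "i = j")
  case True
  then show ?thesis using psd_kernel_diag[OF assms, of i] by (simp add: complex_nonneg_Reals_iff complex_eq_iff)
next
  case False
  have "Im (K i i) = 0" "Im (K j j) = 0"
    using psd_kernel_diag[OF assms] by (auto simp: complex_nonneg_Reals_iff)
  \<comment> \<open>Coefficients (1, 1) make the imaginary parts of \<open>K i j\<close> and
    \<open>K j i\<close> opposite; 1 and the imaginary unit make their real parts equal.\<close>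
  then show ?thesis
    using psd_kernel_two[OF assms False, of 1 1] psd_kernel_two[OF assms False, of 1 \<i>]
    by (simp add: complex_nonneg_Reals_iff complex_eq_iff)
qed

lemma psd_kernel_zero_diag:
  assumes "psd_kernel K" "K i i = 0"
  shows "K i j = 0"
proof (rule ccontr)
  assume nz: "K i j \<noteq> 0"
  then have ij: "i \<noteq> j" using assms(2) by auto
  \<comment> \<open>With this s the form at the coefficients - s \<open>K i j\<close> and 1 equals -
    \<open>K j j\<close> - 2, which is negative.\<close>
  define s where "s = (Re (K j j) + 1) / (cmod (K i j))\<^sup>2"
  have sq: "K i j * cnj (K i j) = of_real ((cmod (K i j))\<^sup>2)" using complex_norm_square[of "K i j"] by simp
  have "K i i * (- s * K i j) * cnj (- s * K i j) + K i j * 1 * cnj (- s * K i j)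
      + K j i * (- s * K i j) * cnj 1 + K j j * 1 * cnj 1 \<in> \<real>\<^sub>\<ge>\<^sub>0"
    by (rule psd_kernel_two[OF assms(1) ij])
  also have "K i i * (- s * K i j) * cnj (- s * K i j) + K i j * 1 * cnj (- s * K i j)
      + K j i * (- s * K i j) * cnj 1 + K j j * 1 * cnj 1 = K j j - 2 * s * (K i j * cnj (K i j))"
    using assms(2) psd_kernel_hermitian[OF assms(1), of j i] by (simp add: algebra_simps)
  finally have "Re (K j j - 2 * s * (K i j * cnj (K i j))) \<ge> 0"
    by (simp add: complex_nonneg_Reals_iff)
  then have "2 * (s * (cmod (K i j))\<^sup>2) \<le> Re (K j j)"
    unfolding sq by (simp flip: of_real_mult add: mult.assoc)
  moreover have "s * (cmod (K i j))\<^sup>2 = Re (K j j) + 1" using nz by (simp add: s_def)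
  moreover have "Re (K j j) \<ge> 0"
    using psd_kernel_diag[OF assms(1), of j] by (simp add: complex_nonneg_Reals_iff)
  ultimately show False by simp
qed

text \<open>Eliminating all indices in turn gives the Cholesky decomposition of a kernel on \<open>\<nat>\<close>.  A vanishing
  pivot \<open>K n n = 0\<close> does no harm: the quotient is then \<open>0\<close>, and so is the whole row of the kernel.\<close>

definition schur_step :: "'i \<Rightarrow> ('i \<Rightarrow> 'i \<Rightarrow> complex) \<Rightarrow> 'i \<Rightarrow> 'i \<Rightarrow> complex" where
  "schur_step n K i j = K i j - K i n * K n j / K n n"

text \<open>Completing the square: the form of the new kernel at c is the form of K at d, where d
  differs from c only in its coefficient at the pivot.\<close>

lemma psd_kernel_schur_step:
  assumes K: "psd_kernel K"
  shows "psd_kernel (schur_step n K)"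
proof (cases "K n n = 0")
  case True
  then have "schur_step n K = K" by (intro ext) (simp add: schur_step_def)
  then show ?thesis using K by simp
next
  case False
  show ?thesis
  proof (rule psd_kernelI)
    fix F :: "'a set" assume F: "finite F"
    \<comment> \<open>The pivot must be in the summation set, since passing from c to d changes the
      coefficient there.\<close>
    define G where "G = insert n F"
    have G: "finite G" "n \<in> G" using F by (auto simp: G_def)
    have "(\<Sum>i\<in>G. \<Sum>j\<in>G. schur_step n K i j * c j * cnj (c i)) \<in> \<real>\<^sub>\<ge>\<^sub>0" for c
    proof -
      define u where "u = (\<Sum>j\<in>G. K n j * c j)"
      define s where "s = u / K n n"
      define d where "d j = c j - (if j = n then s else 0)" for j
      have her: "K i n = cnj (K n i)" for i by (rule psd_kernel_hermitian[OF K])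
      have cu: "cnj u = (\<Sum>i\<in>G. K i n * cnj (c i))"
        by (simp add: u_def cnj_sum her)
      have cs: "cnj s = cnj u / K n n" using her[of n] by (simp add: s_def)
      have z: "(u - K n n * s) * cnj s = 0" using False by (simp add: s_def)
      have inner: "(\<Sum>j\<in>G. K i j * d j) = (\<Sum>j\<in>G. K i j * c j) - K i n * s" for i
      proof -
        have "(\<Sum>j\<in>G. K i j * d j) = (\<Sum>j\<in>G. K i j * c j - (if j = n then K i n * s else 0))"
          by (intro sum.cong) (auto simp: d_def algebra_simps)
        then show ?thesis using G by (simp add: sum_subtractf)
      qed
      have "(\<Sum>i\<in>G. \<Sum>j\<in>G. K i j * d j * cnj (d i))
          = (\<Sum>i\<in>G. (\<Sum>j\<in>G. K i j * d j) * cnj (d i))"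
        by (simp add: sum_distrib_right)
      also have "\<dots> = (\<Sum>i\<in>G. ((\<Sum>j\<in>G. K i j * c j) - K i n * s) * cnj (c i)
          - (if i = n then (u - K n n * s) * cnj s else 0))"
        unfolding inner by (intro sum.cong) (auto simp: d_def u_def algebra_simps)
      also have "\<dots> = (\<Sum>i\<in>G. ((\<Sum>j\<in>G. K i j * c j) - K i n * s) * cnj (c i))"
        by (simp only: z if_cancel diff_zero)
      also have "\<dots> = (\<Sum>i\<in>G. (\<Sum>j\<in>G. K i j * c j) * cnj (c i)) - s * cnj u"
      proof -
        have "((\<Sum>j\<in>G. K i j * c j) - K i n * s) * cnj (c i)
            = (\<Sum>j\<in>G. K i j * c j) * cnj (c i) - s * (K i n * cnj (c i))" for i
          by (simp add: algebra_simps)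
        then show ?thesis unfolding cu by (simp only: sum_subtractf sum_distrib_left)
      qed
      finally have L: "(\<Sum>i\<in>G. \<Sum>j\<in>G. K i j * d j * cnj (d i))
          = (\<Sum>i\<in>G. (\<Sum>j\<in>G. K i j * c j) * cnj (c i)) - s * cnj u" .
      have "(\<Sum>i\<in>G. \<Sum>j\<in>G. schur_step n K i j * c j * cnj (c i))
          = (\<Sum>i\<in>G. (\<Sum>j\<in>G. K i j * c j) * cnj (c i) - K i n * cnj (c i) * s)"
        unfolding schur_step_def s_def u_def
        by (intro sum.cong refl)
          (simp add: sum_distrib_left sum_distrib_right sum_divide_distrib sum_subtractf algebra_simps)
      also have "\<dots> = (\<Sum>i\<in>G. (\<Sum>j\<in>G. K i j * c j) * cnj (c i)) - s * cnj u"
        by (simp add: sum_subtractf cu sum_distrib_left mult_ac)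
      finally show ?thesis
        using L psd_kernelD[OF K G(1), of d] by simp
    qed
    then show "\<exists>G. finite G \<and> F \<subseteq> G \<and> (\<forall>c. (\<Sum>i\<in>G. \<Sum>j\<in>G. schur_step n K i j * c j * cnj (c i)) \<in> \<real>\<^sub>\<ge>\<^sub>0)"
      using G by (intro exI[of _ G]) (auto simp: G_def)
  qed
qed

primrec schur_iter :: "(nat \<Rightarrow> nat \<Rightarrow> complex) \<Rightarrow> nat \<Rightarrow> nat \<Rightarrow> nat \<Rightarrow> complex" where
  "schur_iter K 0 = K"
| "schur_iter K (Suc n) = schur_step n (schur_iter K n)"

definition cholesky :: "(nat \<Rightarrow> nat \<Rightarrow> complex) \<Rightarrow> nat \<Rightarrow> nat \<Rightarrow> complex" where
  "cholesky K i n = schur_iter K n i n / complex_of_real (sqrt (Re (schur_iter K n n n)))"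

lemma psd_kernel_schur_iter: "psd_kernel K \<Longrightarrow> psd_kernel (schur_iter K n)"
  by (induction n) (auto intro: psd_kernel_schur_step)

text \<open>Step n clears row n, and a row that is already zero stays zero because both terms of
  \<open>schur_step\<close> contain a factor from it.\<close>

lemma schur_iter_eq_0:
  assumes K: "psd_kernel K"
  shows "i < n \<Longrightarrow> schur_iter K n i j = 0"
proof (induction n arbitrary: i j)
  case (Suc n)
  let ?K = "schur_iter K n"
  have P: "psd_kernel ?K" by (rule psd_kernel_schur_iter[OF K])
  show ?case
  proof (cases "i = n")
    case True
    show ?thesis
    proof (cases "?K n n = 0")
      case True
      then show ?thesis using psd_kernel_zero_diag[OF P True] \<open>i = n\<close> by (simp add: schur_step_def)
    qed (simp add: schur_step_def \<open>i = n\<close>)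
  next
    case False
    then show ?thesis using Suc by (simp add: schur_step_def)
  qed
qed simp

lemma cholesky_decomp:
  assumes K: "psd_kernel K"
  shows "K i j = (\<Sum>m<n. cholesky K i m * cnj (cholesky K j m)) + schur_iter K n i j"
proof (induction n)
  case (Suc n)
  let ?K = "schur_iter K n"
  have P: "psd_kernel ?K" by (rule psd_kernel_schur_iter[OF K])
  define r where "r = Re (?K n n)"
  have r: "?K n n = complex_of_real r" "r \<ge> 0"
    using psd_kernel_diag[OF P, of n] by (auto simp: complex_nonneg_Reals_iff r_def complex_eq_iff)
  have sq: "complex_of_real (sqrt r) * complex_of_real (sqrt r) = complex_of_real r"
    using r(2) by (simp flip: of_real_mult)
  have "cholesky K i n * cnj (cholesky K j n)
      = ?K i n * cnj (?K j n) / (complex_of_real (sqrt r) * complex_of_real (sqrt r))"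
    by (simp add: cholesky_def r_def)
  also have "\<dots> = ?K i n * ?K n j / ?K n n"
    unfolding sq r(1) using psd_kernel_hermitian[OF P, of n j] by simp
  finally have "schur_iter K n i j = cholesky K i n * cnj (cholesky K j n) + schur_iter K (Suc n) i j"
    by (simp add: schur_step_def)
  then show ?case using Suc by simp
qed simp


lemma proj_sum_ket: "app (proj m) (\<Sum>n<N. c n *\<^sub>C ket n) = (if m < N then c m else 0)"
proof -
  have "app (proj m) (\<Sum>n<N. c n *\<^sub>C ket n) = (\<Sum>n<N. if m = n then c n else 0)"
    by (simp add: blinfun.sum_right clinD[OF clin_proj] scaleC_complex_def if_distrib cong: if_cong)
  then show ?thesis by simp
qed

lemma cinner_ket_right: "cinner f (ket n) = app (proj n) f"
  by (simp add: cinner_emb_right cinner_complex_def)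

lemma cinner_ket_left: "cinner (ket n) f = cnj (app (proj n) f)"
  by (simp add: cinner_emb_left cinner_complex_def)

lemma cinner_sum_ket: "cinner (\<Sum>n<N. c n *\<^sub>C ket n) (\<Sum>n<M. d n *\<^sub>C ket n) = (\<Sum>n<min N M. c n * cnj (d n))"
proof -
  have "cinner (\<Sum>n<N. c n *\<^sub>C ket n) (\<Sum>n<M. d n *\<^sub>C ket n) = (\<Sum>m<M. if m < N then c m * cnj (d m) else 0)"
    by (simp add: cinner_sum_right cinner_scaleC_right cinner_ket_right proj_sum_ket mult.commute
        if_distrib cong: if_cong)
  also have "\<dots> = (\<Sum>n<min N M. c n * cnj (d n))"
    by (intro sum.mono_neutral_cong_right) auto
  finally show ?thesis .
qed

text \<open>The rows of the Cholesky factor are Gram vectors. They have finite support, so they are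
  finite combinations of basis vectors and no completion is formed. The kernel is moved to \<nat>
  along \<open>to_nat\<close> and is 0 off its range.\<close>

lemma ex_gram_vectors:
  fixes K :: "'i::countable \<Rightarrow> 'i \<Rightarrow> complex"
  assumes "psd_kernel K"
  shows "\<exists>g :: 'i \<Rightarrow> ell2. \<forall>i j. cinner (g i) (g j) = K i j"
proof -
  let ?f = "from_nat :: nat \<Rightarrow> 'i"
  define K' where "K' i j = (if i \<in> range (to_nat :: 'i \<Rightarrow> nat) \<and> j \<in> range (to_nat :: 'i \<Rightarrow> nat) then K (?f i) (?f j) else 0)" for i j
  have P: "psd_kernel K'"
  proof -
    have "(\<Sum>i\<in>F. \<Sum>j\<in>F. K' i j * c j * cnj (c i)) \<in> \<real>\<^sub>\<ge>\<^sub>0" if F: "finite F" for F c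
    proof -
      let ?R = "range (to_nat :: 'i \<Rightarrow> nat)"
      have "(\<Sum>i\<in>F. \<Sum>j\<in>F. K' i j * c j * cnj (c i)) = (\<Sum>i\<in>F \<inter> ?R. \<Sum>j\<in>F. K' i j * c j * cnj (c i))"
        by (intro sum.mono_neutral_right ballI sum.neutral) (auto simp: F K'_def)
      also have "\<dots> = (\<Sum>i\<in>F \<inter> ?R. \<Sum>j\<in>F \<inter> ?R. K' i j * c j * cnj (c i))"
        by (intro sum.cong[OF refl] sum.mono_neutral_right) (auto simp: F K'_def)
      also have "F \<inter> ?R = to_nat ` {i::'i. to_nat i \<in> F}" by auto
      also have "(\<Sum>i\<in>to_nat ` {i::'i. to_nat i \<in> F}. \<Sum>j\<in>to_nat ` {i::'i. to_nat i \<in> F}. K' i j * c j * cnj (c i))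
          = (\<Sum>i\<in>{i::'i. to_nat i \<in> F}. \<Sum>j\<in>{i::'i. to_nat i \<in> F}. K i j * c (to_nat j) * cnj (c (to_nat i)))"
        by (simp add: sum.reindex K'_def)
      also have "\<dots> \<in> \<real>\<^sub>\<ge>\<^sub>0"
        using finite_vimageI[OF F inj_to_nat] by (intro psd_kernelD[OF assms]) (simp add: vimage_def)
      finally show ?thesis .
    qed
    then show ?thesis by (simp add: psd_kernel_def)
  qed
  define g where "g i = (\<Sum>n<Suc i. cholesky K' i n *\<^sub>C ket n)" for i
  have "cinner (g i) (g j) = K' i j" for i j
  proof -
    \<comment> \<open>Row i is exhausted once the indices up to i are eliminated, hence the
      \<open>Suc\<close>. The inner product sees the shorter of the two supports, and the remainder
      vanishes by its row or, through hermitian symmetry, by its column.\<close>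
    have "schur_iter K' (min (Suc i) (Suc j)) i j = 0"
    proof (cases "i < min (Suc i) (Suc j)")
      case False
      then have "schur_iter K' (min (Suc i) (Suc j)) j i = 0" by (intro schur_iter_eq_0 P) auto
      then show ?thesis
        by (simp only: psd_kernel_hermitian[OF psd_kernel_schur_iter[OF P], where i = j and j = i]
            complex_cnj_zero)
    qed (intro schur_iter_eq_0 P)
    then show ?thesis
      unfolding g_def cinner_sum_ket using cholesky_decomp[OF P, of i j "min (Suc i) (Suc j)"] by simp
  qed
  then show ?thesis by (intro exI[of _ "\<lambda>i. g (to_nat i)"]) (simp add: K'_def)
qed

section \<open>Synthesis operators\<close>

text \<open>The analysis operator, sending u to its coefficients against g, is defined everywhere
  and bounded by Bessel's inequality. Its adjoint is the synthesis operator, so nothing is extended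
  from finite combinations.\<close>

lemma ex_synthesis_operator:
  fixes g :: "nat \<Rightarrow> 'k::chilbert_space"
  assumes g: "\<And>N c. (norm (\<Sum>n<N. c n *\<^sub>C g n))\<^sup>2 \<le> (\<Sum>n<N. (cmod (c n))\<^sup>2)"
  shows "\<exists>S :: ell2 \<Rightarrow>\<^sub>L 'k. clin S \<and> norm S \<le> 1 \<and> (\<forall>n. app S (ket n) = g n)"
proof -
  have B: "(\<Sum>n\<in>F. (norm (cinner u (g n)))\<^sup>2) \<le> (norm u)\<^sup>2" if F: "finite F" for F u
  proof -
    obtain N where N: "F \<subseteq> {..<N}" using F finite_nat_iff_bounded by blast
    \<comment> \<open>The hypothesis on the coefficients of u itself bounds the square of t by t
      times the squared norm of u; dividing by t gives Bessel's inequality.\<close>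
    let ?c = "\<lambda>n. cinner u (g n)"
    define t where "t = (\<Sum>n<N. (cmod (?c n))\<^sup>2)"
    define v where "v = (\<Sum>n<N. ?c n *\<^sub>C g n)"
    have t0: "t \<ge> 0" by (simp add: t_def sum_nonneg)
    have "cinner u v = complex_of_real t"
      by (simp add: v_def t_def cinner_sum_right cinner_scaleC_right mult.commute complex_norm_square[symmetric]
          del: of_real_power)
    then have "t = cmod (cinner u v)" using t0 by simp
    also have "\<dots> \<le> norm u * norm v" by (rule norm_cinner_le)
    finally have "t\<^sup>2 \<le> (norm u * norm v)\<^sup>2" using t0 by (intro power_mono)
    also have "\<dots> \<le> (norm u)\<^sup>2 * t"
      using g[of ?c N] by (simp add: power_mult_distrib v_def t_def mult_left_mono)
    finally have "t \<le> (norm u)\<^sup>2"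
      using t0 by (cases "t = 0") (auto simp: power2_eq_square)
    moreover have "(\<Sum>n\<in>F. (norm (?c n))\<^sup>2) \<le> t"
      unfolding t_def by (intro sum_mono2 N) auto
    ultimately show ?thesis by simp
  qed
  define W where "W u = Abs_hsum (\<lambda>n. cinner u (g n))" for u
  have R: "Rep_hsum (W u) n = cinner u (g n)" for u n
    using sq_summable_of_bound(1)[OF B, of u] by (simp add: W_def Abs_hsum_inverse)
  have bl: "bounded_linear W"
  proof (rule bounded_linear_intro[where K = 1])
    show "norm (W u) \<le> norm u * 1" for u
    proof (rule power2_le_imp_le)
      show "(norm (W u))\<^sup>2 \<le> (norm u * 1)\<^sup>2"
        unfolding norm_hsum_sq R using sq_summable_of_bound(2)[OF B, of u] by simp
    qed simp
  qed (auto intro!: hsum_eqI simp: R Rep_hsum_simps cinner_add_left cinner_scaleR_left scaleR_conv_of_real)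
  define W' where "W' = Blinfun W"
  have ap: "app W' = W" by (simp add: W'_def bounded_linear_Blinfun_apply[OF bl])
  have "clin W'"
    by (auto simp: clin_def ap intro!: hsum_eqI
        simp: R scaleC_hsum_def Rep_hsum_scaleC cinner_scaleC_left scaleC_complex_def)
  then obtain S where S: "clin S" "norm S \<le> norm W'"
    "\<And>u v. cinner (app W' u) v = cinner u (app S v)"
    using ex_adjoint by blast
  have "norm (W u) \<le> 1 * norm u" for u
  proof (rule power2_le_imp_le)
    show "(norm (W u))\<^sup>2 \<le> (1 * norm u)\<^sup>2"
      unfolding norm_hsum_sq R using sq_summable_of_bound(2)[OF B, of u] by simp
  qed simp
  then have "norm W' \<le> 1" by (intro norm_blinfun_bound) (auto simp: ap)
  moreover have "app S (ket n) = g n" for n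
  proof -
    have "cinner u (app S (ket n)) = cinner u (g n)" for u
      by (simp add: S(3)[symmetric] cinner_ket_right proj_apply ap R)
    then show ?thesis by (rule cinner_eqI')
  qed
  ultimately show ?thesis using S(1,2) by (intro exI[of _ S]) auto
qed

section \<open>Positive operator matrices\<close>

lemma sum_UNIV_single:
  fixes b :: "'a::finite"
  assumes "\<And>a. a \<noteq> b \<Longrightarrow> f a = (0::'b::comm_monoid_add)"
  shows "(\<Sum>a\<in>UNIV. f a) = f b"
proof -
  have "(\<Sum>a\<in>UNIV. f a) = (\<Sum>a\<in>{b}. f a)"
    by (rule sum.mono_neutral_right) (auto simp: assms)
  then show ?thesis by simp
qed

lemma sum_UNIV_single2:
  fixes b :: "'a::finite" and c :: "'c::finite"
  assumes "\<And>a a'. a \<noteq> b \<or> a' \<noteq> c \<Longrightarrow> f a a' = (0::'b::comm_monoid_add)"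
  shows "(\<Sum>a\<in>UNIV. \<Sum>a'\<in>UNIV. f a a') = f b c"
  by (subst sum_UNIV_single[of b], simp add: assms, rule sum_UNIV_single, simp add: assms)

definition psd_op_matrix :: "('p::finite \<Rightarrow> 'p \<Rightarrow> 'h::chilbert_space op) \<Rightarrow> bool" where
  "psd_op_matrix M \<longleftrightarrow> (\<forall>h. (\<Sum>p\<in>UNIV. \<Sum>q\<in>UNIV. cinner (app (M p q) (h q)) (h p)) \<in> \<real>\<^sub>\<ge>\<^sub>0)"

abbreviation flat :: "('x \<Rightarrow> 'x \<Rightarrow> 'a \<Rightarrow> 'a \<Rightarrow> 'b) \<Rightarrow> 'x \<times> 'a \<Rightarrow> 'x \<times> 'a \<Rightarrow> 'b" where
  "flat E p q \<equiv> E (fst p) (fst q) (snd p) (snd q)"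

lemma sum_flat:
  fixes f :: "'x::finite \<Rightarrow> 'x \<Rightarrow> 'a::finite \<Rightarrow> 'a \<Rightarrow> 'b::comm_monoid_add"
  shows "(\<Sum>p\<in>UNIV. \<Sum>q\<in>UNIV. flat f p q) = (\<Sum>x\<in>UNIV. \<Sum>x'\<in>UNIV. \<Sum>a\<in>UNIV. \<Sum>a'\<in>UNIV. f x x' a a')"
proof -
  have "(\<Sum>p\<in>UNIV. \<Sum>q\<in>UNIV. flat f p q) = (\<Sum>x\<in>UNIV. \<Sum>a\<in>UNIV. \<Sum>x'\<in>UNIV. \<Sum>a'\<in>UNIV. f x x' a a')"
    by (simp add: UNIV_Times_UNIV[symmetric] sum.cartesian_product' del: UNIV_Times_UNIV)
  also have "\<dots> = (\<Sum>x\<in>UNIV. \<Sum>x'\<in>UNIV. \<Sum>a\<in>UNIV. \<Sum>a'\<in>UNIV. f x x' a a')"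
    by (intro sum.cong[OF refl] sum.swap)
  finally show ?thesis .
qed

lemma sum_swap22:
  "(\<Sum>b\<in>B. \<Sum>a\<in>A. \<Sum>x\<in>X. \<Sum>y\<in>Y. f b a x y) = (\<Sum>x\<in>X. \<Sum>y\<in>Y. \<Sum>b\<in>B. \<Sum>a\<in>A. f b a x y)"
proof -
  have "(\<Sum>p\<in>B \<times> A. \<Sum>q\<in>X \<times> Y. f (fst p) (snd p) (fst q) (snd q))
      = (\<Sum>q\<in>X \<times> Y. \<Sum>p\<in>B \<times> A. f (fst p) (snd p) (fst q) (snd q))"
    by (rule sum.swap)
  then show ?thesis by (simp add: sum.cartesian_product')
qed

lemma stochastic_operator_matrix_iff:
  "stochastic_operator_matrix E \<longleftrightarrow>
     (\<forall>x x' a a'. E x x' a a' \<in> bop) \<and> psd_op_matrix (flat E) \<and>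
     (\<forall>x x'. (\<Sum>a\<in>UNIV. E x x' a a) = (if x = x' then id_blinfun else 0))"
proof -
  have 1: "(\<Sum>p\<in>UNIV. \<Sum>q\<in>UNIV. cinner (app (flat E p q) (h q)) (h p)) =
      (\<Sum>x\<in>UNIV. \<Sum>x'\<in>UNIV. \<Sum>a\<in>UNIV. \<Sum>a'\<in>UNIV.
         cinner (app (E x x' a a') (h (x', a'))) (h (x, a)))" for h
    using sum_flat[of "\<lambda>x x' a a'. cinner (app (E x x' a a') (h (x', a'))) (h (x, a))"] by simp
  have "(\<forall>h. P (\<lambda>x a. h (x, a))) \<longleftrightarrow> (\<forall>h. P h)" for P :: "('a \<Rightarrow> 'b \<Rightarrow> 'c) \<Rightarrow> bool"
  proof (intro iffI allI)
    fix h assume "\<forall>h. P (\<lambda>x a. h (x, a))"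
    from spec[OF this, of "case_prod h"] show "P h" by simp
  qed simp
  from this[of "\<lambda>h. (\<Sum>x\<in>UNIV. \<Sum>x'\<in>UNIV. \<Sum>a\<in>UNIV. \<Sum>a'\<in>UNIV.
         cinner (app (E x x' a a') (h x' a')) (h x a)) \<in> \<real>\<^sub>\<ge>\<^sub>0"]
  show ?thesis
    unfolding stochastic_operator_matrix_def psd_op_matrix_def 1 by simp
qed

text \<open>Indexing by pairs of a block and a vector turns an operator matrix into a scalar kernel.
  Hermitian symmetry and, on basis vectors, the factorisation then come from the scalar
  theory.\<close>

lemma psd_kernel_op_matrix:
  fixes M :: "'p::finite \<Rightarrow> 'p \<Rightarrow> 'h::chilbert_space op"
  assumes "psd_op_matrix M" "\<And>p q. M p q \<in> bop"
  shows "psd_kernel (\<lambda>i j. cinner (app (M (fst i) (fst j)) (snd j)) (snd i))"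
proof (rule psd_kernelI)
  fix F :: "('p \<times> 'h) set" assume F: "finite F"
  \<comment> \<open>F is enlarged to a rectangle, over which the coefficients belonging to one p
    combine into a single vector \<open>h p\<close>.\<close>
  let ?D = "snd ` F"
  have "(\<Sum>i\<in>UNIV \<times> ?D. \<Sum>j\<in>UNIV \<times> ?D.
      cinner (app (M (fst i) (fst j)) (snd j)) (snd i) * c j * cnj (c i)) \<in> \<real>\<^sub>\<ge>\<^sub>0" for c
  proof -
    define h where "h p = (\<Sum>u\<in>?D. c (p, u) *\<^sub>C u)" for p
    have "(\<Sum>p\<in>UNIV. \<Sum>q\<in>UNIV. cinner (app (M p q) (h q)) (h p)) \<in> \<real>\<^sub>\<ge>\<^sub>0"
      using assms(1) by (simp add: psd_op_matrix_def)
    also have "(\<Sum>p\<in>UNIV. \<Sum>q\<in>UNIV. cinner (app (M p q) (h q)) (h p))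
        = (\<Sum>p\<in>UNIV. \<Sum>q\<in>UNIV. \<Sum>v\<in>?D. \<Sum>u\<in>?D. cinner (app (M p q) u) v * c (q, u) * cnj (c (p, v)))"
      unfolding h_def
      by (simp add: blinfun.sum_right cinner_sum_left cinner_sum_right bopD[OF assms(2)]
          cinner_scaleC_left cinner_scaleC_right sum_distrib_left mult_ac)
    also have "\<dots> = (\<Sum>i\<in>UNIV \<times> ?D. \<Sum>j\<in>UNIV \<times> ?D.
        cinner (app (M (fst i) (fst j)) (snd j)) (snd i) * c j * cnj (c i))"
      unfolding sum.cartesian_product' by (simp, intro sum.cong[OF refl] sum.swap)
    finally show ?thesis .
  qed
  moreover have "F \<subseteq> UNIV \<times> ?D" by force
  ultimately show "\<exists>G. finite G \<and> F \<subseteq> G \<and> (\<forall>c. (\<Sum>i\<in>G. \<Sum>j\<in>G.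
      cinner (app (M (fst i) (fst j)) (snd j)) (snd i) * c j * cnj (c i)) \<in> \<real>\<^sub>\<ge>\<^sub>0)"
    using F by (intro exI[of _ "UNIV \<times> ?D"]) auto
qed

lemma psd_op_matrix_hermitian:
  assumes "psd_op_matrix M" "\<And>p q. M p q \<in> bop"
  shows "cinner (app (M p q) u) v = cinner u (app (M q p) v)"
  using psd_kernel_hermitian[OF psd_kernel_op_matrix[OF assms], of "(p, v)" "(q, u)"]
  by (simp add: cinner_commute[of u])

text \<open>Positivity of the form at \<open>h - k / N\<close>, where \<open>k = M h\<close>, bounds \<open>\<parallel>M h\<parallel>\<^sup>2\<close> without taking square roots of \<open>M\<close>.\<close>

lemma psd_op_matrix_norm_le:
  fixes M :: "'p::finite \<Rightarrow> 'p \<Rightarrow> 'h::chilbert_space op"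
  assumes M: "psd_op_matrix M" "\<And>p q. M p q \<in> bop"
    and N: "\<And>h. Re (\<Sum>p\<in>UNIV. \<Sum>q\<in>UNIV. cinner (app (M p q) (h q)) (h p)) \<le> N * (\<Sum>p\<in>UNIV. (norm (h p))\<^sup>2)"
    and "N > 0"
  shows "(\<Sum>p\<in>UNIV. (norm (\<Sum>q\<in>UNIV. app (M p q) (h q)))\<^sup>2)
    \<le> N * Re (\<Sum>p\<in>UNIV. \<Sum>q\<in>UNIV. cinner (app (M p q) (h q)) (h p))"
proof -
  define B where "B h k = (\<Sum>p\<in>UNIV. \<Sum>q\<in>UNIV. cinner (app (M p q) (h q)) (k p))" for h k
  define k where "k p = (\<Sum>q\<in>UNIV. app (M p q) (h q))" for p
  define s where "s = (\<Sum>p\<in>UNIV. (norm (k p))\<^sup>2)"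
  have Bhk: "B h k = complex_of_real s"
    by (simp add: B_def s_def cinner_sum_left[symmetric] k_def[symmetric] cinner_self)
  have "B k h = (\<Sum>p\<in>UNIV. \<Sum>q\<in>UNIV. cinner (k q) (app (M q p) (h p)))"
    unfolding B_def by (simp add: psd_op_matrix_hermitian[OF M])
  also have "\<dots> = (\<Sum>q\<in>UNIV. cinner (k q) (k q))"
    by (subst sum.swap) (simp add: cinner_sum_right[symmetric] k_def[symmetric])
  finally have Bkh: "B k h = complex_of_real s" by (simp add: s_def cinner_self)
  define t where "t = 1 / N"
  have "B (\<lambda>p. h p - t *\<^sub>R k p) (\<lambda>p. h p - t *\<^sub>R k p)
      = B h h - t * B h k - t * B k h + t * t * B k k"
    by (simp add: B_def blinfun.diff_right blinfun.scaleR_right cinner_diff_left cinner_diff_right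
        cinner_scaleR_left cinner_scaleR_right sum_subtractf sum.distrib sum_distrib_left algebra_simps)
  moreover have "B (\<lambda>p. h p - t *\<^sub>R k p) (\<lambda>p. h p - t *\<^sub>R k p) \<in> \<real>\<^sub>\<ge>\<^sub>0"
    using M(1) by (simp add: psd_op_matrix_def B_def)
  ultimately have "0 \<le> Re (B h h) - 2 * t * s + t * t * Re (B k k)"
    unfolding Bhk Bkh by (simp add: complex_nonneg_Reals_iff flip: of_real_mult)
  also have "t * t * Re (B k k) \<le> t * t * (N * s)"
    using N[of k] unfolding B_def s_def by (intro mult_left_mono) auto
  finally show ?thesis
    using \<open>N > 0\<close> unfolding B_def[symmetric] k_def[symmetric] s_def[symmetric]
    by (simp add: t_def field_simps)
qed

section \<open>Stochastic operator matrices\<close>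

locale stochastic =
  fixes E :: "'x::finite \<Rightarrow> 'x \<Rightarrow> 'a::finite \<Rightarrow> 'a \<Rightarrow> 'h::chilbert_space op"
  assumes stochastic: "stochastic_operator_matrix E"
begin

lemma bop: "E x x' a a' \<in> bop"
  and psd: "psd_op_matrix (flat E)"
  and sum_diag: "(\<Sum>a\<in>UNIV. E x x' a a) = (if x = x' then id_blinfun else 0)"
  using stochastic by (auto simp: stochastic_operator_matrix_iff)

lemma hermitian: "cinner (app (E x x' a a') u) v = cinner u (app (E x' x a' a) v)"
  using psd_op_matrix_hermitian[OF psd, of "(x, a)" "(x', a')"] bop by simp

lemma op_adj_E: "op_adj (E x x' a a') = E x' x a' a"
  by (rule op_adj_eqI) (rule hermitian)

lemma psd4: "(\<Sum>x\<in>UNIV. \<Sum>x'\<in>UNIV. \<Sum>a\<in>UNIV. \<Sum>a'\<in>UNIV.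
    cinner (app (E x x' a a') (h x' a')) (h x a)) \<in> \<real>\<^sub>\<ge>\<^sub>0"
  using stochastic by (simp add: stochastic_operator_matrix_def)

lemma form_diag_nonneg:
  "(\<Sum>x\<in>UNIV. \<Sum>x'\<in>UNIV. cinner (app (E x x' b b) (h x')) (h x)) \<in> \<real>\<^sub>\<ge>\<^sub>0"
proof -
  have "(\<Sum>a\<in>UNIV. \<Sum>a'\<in>UNIV.
      cinner (app (E x x' a a') (if a' = b then h x' else 0)) (if a = b then h x else 0))
      = cinner (app (E x x' b b) (h x')) (h x)" for x x'
    by (subst sum_UNIV_single2[of b b]) auto
  then show ?thesis using psd4[of "\<lambda>x a. if a = b then h x else 0"] by simp
qed

text \<open>The diagonal blocks are positive and add up to the identity over the outcomes, so each
  of them is at most the identity.\<close>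

lemma form_diag_le:
  "Re (\<Sum>x\<in>UNIV. \<Sum>x'\<in>UNIV. cinner (app (E x x' b b) (h x')) (h x)) \<le> (\<Sum>x\<in>UNIV. (norm (h x))\<^sup>2)"
proof -
  let ?f = "\<lambda>a. (\<Sum>x\<in>UNIV. \<Sum>x'\<in>UNIV. cinner (app (E x x' a a) (h x')) (h x))"
  have "Re (?f b) \<le> (\<Sum>a\<in>UNIV. Re (?f a))"
    using form_diag_nonneg by (intro member_le_sum) (auto simp: complex_nonneg_Reals_iff)
  also have "\<dots> = Re (\<Sum>a\<in>UNIV. ?f a)" by simp
  also have "(\<Sum>a\<in>UNIV. ?f a)
      = (\<Sum>x\<in>UNIV. \<Sum>x'\<in>UNIV. \<Sum>a\<in>UNIV. cinner (app (E x x' a a) (h x')) (h x))"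
    by (subst sum.swap, intro sum.cong[OF refl]) (rule sum.swap)
  also have "\<dots> = (\<Sum>x\<in>UNIV. \<Sum>x'\<in>UNIV. cinner (app (if x = x' then id_blinfun else 0) (h x')) (h x))"
    by (simp add: cinner_sum_left[symmetric] blinfun.sum_left[symmetric] sum_diag)
  also have "\<dots> = (\<Sum>x\<in>UNIV. \<Sum>x'\<in>UNIV. if x = x' then cinner (h x) (h x) else 0)"
    by (intro sum.cong refl) auto
  also have "\<dots> = complex_of_real (\<Sum>x\<in>UNIV. (norm (h x))\<^sup>2)" by (simp add: cinner_self)
  finally show ?thesis by simp
qed

text \<open>The pinching inequality: positivity at the coefficients 1 and -1 bounds each
  off-diagonal block by the mean of two diagonal ones. The matrix is thus at most |A| times its
  block diagonal, which \<open>form_diag_le\<close> bounds.\<close>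

lemma form_le:
  "Re (\<Sum>p\<in>UNIV. \<Sum>q\<in>UNIV. cinner (app (flat E p q) (h q)) (h p))
    \<le> real CARD('a) * (\<Sum>p\<in>UNIV. (norm (h p))\<^sup>2)"
proof -
  define G where "G b a = (\<Sum>x\<in>UNIV. \<Sum>x'\<in>UNIV. cinner (app (E x x' b a) (h (x', a))) (h (x, b)))"
    for a b
  have "psd_kernel G"
  proof (rule psd_kernelI, intro exI conjI allI)
    fix c :: "'a \<Rightarrow> complex"
    have "(\<Sum>b\<in>UNIV. \<Sum>a\<in>UNIV. G b a * c a * cnj (c b))
        = (\<Sum>b\<in>UNIV. \<Sum>a\<in>UNIV. \<Sum>x\<in>UNIV. \<Sum>x'\<in>UNIV.
            cinner (app (E x x' b a) (c a *\<^sub>C h (x', a))) (c b *\<^sub>C h (x, b)))"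
      by (simp add: G_def sum_distrib_left sum_distrib_right bopD[OF bop] cinner_scaleC_left
          cinner_scaleC_right mult_ac)
    also have "\<dots> = (\<Sum>x\<in>UNIV. \<Sum>x'\<in>UNIV. \<Sum>b\<in>UNIV. \<Sum>a\<in>UNIV.
            cinner (app (E x x' b a) (c a *\<^sub>C h (x', a))) (c b *\<^sub>C h (x, b)))"
      by (rule sum_swap22)
    also have "\<dots> \<in> \<real>\<^sub>\<ge>\<^sub>0" using psd4[of "\<lambda>x a. c a *\<^sub>C h (x, a)"] .
    finally show "(\<Sum>b\<in>UNIV. \<Sum>a\<in>UNIV. G b a * c a * cnj (c b)) \<in> \<real>\<^sub>\<ge>\<^sub>0" .
  qed auto
  have two: "Re (G b a) + Re (G a b) \<le> Re (G a a) + Re (G b b)" for a b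
  proof (cases "a = b")
    case False
    from psd_kernel_two[OF \<open>psd_kernel G\<close> this, of 1 "-1"] show ?thesis
      by (simp add: complex_nonneg_Reals_iff)
  qed simp
  have "(\<Sum>p\<in>UNIV. \<Sum>q\<in>UNIV. cinner (app (flat E p q) (h q)) (h p))
      = (\<Sum>x\<in>UNIV. \<Sum>x'\<in>UNIV. \<Sum>b\<in>UNIV. \<Sum>a\<in>UNIV. cinner (app (E x x' b a) (h (x', a))) (h (x, b)))"
    using sum_flat[of "\<lambda>x x' a a'. cinner (app (E x x' a a') (h (x', a'))) (h (x, a))"] by simp
  also have "\<dots> = (\<Sum>b\<in>UNIV. \<Sum>a\<in>UNIV. G b a)"
    unfolding G_def by (rule sum_swap22)
  finally have S: "(\<Sum>p\<in>UNIV. \<Sum>q\<in>UNIV. cinner (app (flat E p q) (h q)) (h p))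
      = (\<Sum>b\<in>UNIV. \<Sum>a\<in>UNIV. G b a)" .
  have "2 * Re (\<Sum>b\<in>UNIV. \<Sum>a\<in>UNIV. G b a)
      = (\<Sum>b\<in>UNIV. \<Sum>a\<in>UNIV. Re (G b a)) + (\<Sum>b\<in>UNIV. \<Sum>a\<in>UNIV. Re (G a b))"
    by (subst (3) sum.swap) simp
  also have "\<dots> = (\<Sum>b\<in>UNIV. \<Sum>a\<in>UNIV. Re (G b a) + Re (G a b))" by (simp add: sum.distrib)
  also have "\<dots> \<le> (\<Sum>b\<in>UNIV. \<Sum>a\<in>UNIV. Re (G a a) + Re (G b b))"
    by (intro sum_mono two)
  also have "\<dots> = 2 * (real CARD('a) * (\<Sum>a\<in>UNIV. Re (G a a)))"
    by (simp add: sum.distrib sum_distrib_left)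
  finally have "Re (\<Sum>b\<in>UNIV. \<Sum>a\<in>UNIV. G b a) \<le> real CARD('a) * (\<Sum>a\<in>UNIV. Re (G a a))" by simp
  also have "(\<Sum>a\<in>UNIV. Re (G a a)) \<le> (\<Sum>a\<in>UNIV. \<Sum>x\<in>UNIV. (norm (h (x, a)))\<^sup>2)"
    unfolding G_def by (intro sum_mono form_diag_le)
  also have "\<dots> = (\<Sum>x\<in>UNIV. \<Sum>a\<in>UNIV. (norm (h (x, a)))\<^sup>2)" by (rule sum.swap)
  also have "\<dots> = (\<Sum>p\<in>UNIV. (norm (h p))\<^sup>2)"
    by (simp add: UNIV_Times_UNIV[symmetric] sum.cartesian_product' del: UNIV_Times_UNIV)
  finally show ?thesis unfolding S by (simp add: mult_left_mono)
qed

text \<open>The inequality E^2 \<le> |A| E, read at the diagonal entry (x', a').\<close>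

lemma column_norm_le:
  "(\<Sum>x\<in>UNIV. \<Sum>a\<in>UNIV. (norm (app (E x x' a a') \<xi>))\<^sup>2)
    \<le> real CARD('a) * Re (cinner (app (E x' x' a' a') \<xi>) \<xi>)"
proof -
  let ?h = "\<lambda>q. if q = (x', a') then \<xi> else 0"
  have ap: "(\<Sum>q\<in>UNIV. app (flat E p q) (?h q)) = app (flat E p (x', a')) \<xi>" for p
    by (subst sum_UNIV_single[of "(x', a')"]) auto
  have "(\<Sum>p\<in>UNIV. (norm (\<Sum>q\<in>UNIV. app (flat E p q) (?h q)))\<^sup>2)
      \<le> real CARD('a) * Re (\<Sum>p\<in>UNIV. \<Sum>q\<in>UNIV. cinner (app (flat E p q) (?h q)) (?h p))"
    by (rule psd_op_matrix_norm_le[OF psd bop form_le]) simp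
  also have "(\<Sum>p\<in>UNIV. \<Sum>q\<in>UNIV. cinner (app (flat E p q) (?h q)) (?h p))
      = cinner (app (E x' x' a' a') \<xi>) \<xi>"
    by (subst sum_UNIV_single2[of "(x', a')" "(x', a')"]) auto
  finally show ?thesis unfolding ap
    by (simp add: UNIV_Times_UNIV[symmetric] sum.cartesian_product' del: UNIV_Times_UNIV)
qed

text \<open>Summing the columns over a' turns the right-hand side into |A| for each x', by the
  normalisation of E.\<close>

lemma total_norm_le:
  assumes "norm \<xi> = 1"
  shows "(\<Sum>x\<in>UNIV. \<Sum>x'\<in>UNIV. \<Sum>a\<in>UNIV. \<Sum>a'\<in>UNIV. (norm (app (E x x' a a') \<xi>))\<^sup>2)
    \<le> real CARD('x) * real CARD('a)"
proof -
  have "(\<Sum>x\<in>UNIV. \<Sum>x'\<in>UNIV. \<Sum>a\<in>UNIV. \<Sum>a'\<in>UNIV. (norm (app (E x x' a a') \<xi>))\<^sup>2)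
      = (\<Sum>x'\<in>UNIV. \<Sum>x\<in>UNIV. \<Sum>a'\<in>UNIV. \<Sum>a\<in>UNIV. (norm (app (E x x' a a') \<xi>))\<^sup>2)"
    by (rule trans[OF sum.swap]) (intro sum.cong[OF refl] sum.swap)
  also have "\<dots> = (\<Sum>x'\<in>UNIV. \<Sum>a'\<in>UNIV. \<Sum>x\<in>UNIV. \<Sum>a\<in>UNIV. (norm (app (E x x' a a') \<xi>))\<^sup>2)"
    by (intro sum.cong[OF refl] sum.swap)
  also have "\<dots> \<le> (\<Sum>x'\<in>(UNIV::'x set). \<Sum>a'\<in>UNIV. real CARD('a) * Re (cinner (app (E x' x' a' a') \<xi>) \<xi>))"
    by (intro sum_mono column_norm_le)
  also have "\<dots> = real CARD('a) * (\<Sum>x'\<in>(UNIV::'x set). Re (\<Sum>a'\<in>UNIV. cinner (app (E x' x' a' a') \<xi>) \<xi>))"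
    by (simp add: sum_distrib_left)
  also have "\<dots> = real CARD('a) * real CARD('x)"
    by (simp add: cinner_sum_left[symmetric] blinfun.sum_left[symmetric] sum_diag cinner_self assms)
  finally show ?thesis by (simp add: mult.commute)
qed

lemma norm_sq_le:
  assumes "norm \<xi> = 1"
  shows "(norm (app (E x x' a a') \<xi>))\<^sup>2 \<le> real CARD('x) * real CARD('a)"
proof -
  let ?f = "\<lambda>x x' a a'. (norm (app (E x x' a a') \<xi>))\<^sup>2"
  have "?f x x' a a' \<le> (\<Sum>p\<in>UNIV. \<Sum>q\<in>UNIV. flat ?f p q)"
    by (rule order_trans[OF _ member_le_sum[of "(x, a)"]], rule order_trans[OF _ member_le_sum[of "(x', a')"]])
      (auto intro: sum_nonneg)
  also have "\<dots> = (\<Sum>x\<in>UNIV. \<Sum>x'\<in>UNIV. \<Sum>a\<in>UNIV. \<Sum>a'\<in>UNIV. ?f x x' a a')"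
    by (rule sum_flat[of ?f])
  finally show ?thesis using total_norm_le[OF assms] by linarith
qed

end

section \<open>Comparison of two commuting stochastic matrices at a unit vector\<close>

locale commuting_pair = E: stochastic E + F: stochastic F
  for E F :: "'x::finite \<Rightarrow> 'x \<Rightarrow> 'a::finite \<Rightarrow> 'a \<Rightarrow> 'h::chilbert_space op" +
  fixes \<xi> :: 'h
  assumes norm_xi: "norm \<xi> = 1"
    and commute: "E x x' a a' o\<^sub>L F y y' b b' = F y y' b b' o\<^sub>L E x x' a a'"
begin

text \<open>Its square bounds the total squared distance between the vectors
  \<open>F x x' a a'\<close> \<xi> and \<open>E x' x a' a\<close> \<xi>. It vanishes when the
  correlation attains |X| |A|.\<close>

definition defect :: real where
  "defect = sqrt (2 * (real CARD('x) * real CARD('a) -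
    Re (\<Sum>x\<in>UNIV. \<Sum>x'\<in>UNIV. \<Sum>a\<in>UNIV. \<Sum>a'\<in>UNIV. cinner (app (E x x' a a' o\<^sub>L F x x' a a') \<xi>) \<xi>)))"

text \<open>When the squares are expanded, the two sums of squared norms are at most |X| |A| each,
  and the cross terms are the correlation because \<open>E x' x a' a\<close> is the adjoint of
  \<open>E x x' a a'\<close>.\<close>

lemma defect_bound:
  "norm (app (F x x' a a') \<xi> - app (E x' x a' a) \<xi>) \<le> defect"
proof -
  let ?d = "\<lambda>x x' a a'. (norm (app (F x x' a a') \<xi> - app (E x' x a' a) \<xi>))\<^sup>2"
  let ?S = "\<Sum>x\<in>UNIV. \<Sum>x'\<in>UNIV. \<Sum>a\<in>UNIV. \<Sum>a'\<in>UNIV. cinner (app (E x x' a a' o\<^sub>L F x x' a a') \<xi>) \<xi>"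
  let ?SF = "\<Sum>x\<in>UNIV. \<Sum>x'\<in>UNIV. \<Sum>a\<in>UNIV. \<Sum>a'\<in>UNIV. (norm (app (F x x' a a') \<xi>))\<^sup>2"
  let ?SE = "\<Sum>x\<in>UNIV. \<Sum>x'\<in>UNIV. \<Sum>a\<in>UNIV. \<Sum>a'\<in>UNIV. (norm (app (E x x' a a') \<xi>))\<^sup>2"
  have exp: "?d x x' a a' = (norm (app (F x x' a a') \<xi>))\<^sup>2 + (norm (app (E x' x a' a) \<xi>))\<^sup>2
      - 2 * Re (cinner (app (E x x' a a' o\<^sub>L F x x' a a') \<xi>) \<xi>)" for x x' a a'
  proof -
    have "cinner (app (E x x' a a' o\<^sub>L F x x' a a') \<xi>) \<xi>
        = cinner (app (F x x' a a') \<xi>) (app (E x' x a' a) \<xi>)"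
      by (simp add: E.hermitian)
    then show ?thesis
      by (simp add: inner_eq_Re_cinner[symmetric] power2_norm_eq_inner inner_diff_left inner_diff_right inner_commute)
  qed
  have "?d x x' a a' \<le> (\<Sum>p\<in>UNIV. \<Sum>q\<in>UNIV. flat ?d p q)"
    by (rule order_trans[OF _ member_le_sum[of "(x, a)"]], rule order_trans[OF _ member_le_sum[of "(x', a')"]])
      (auto intro: sum_nonneg)
  also have "\<dots> = (\<Sum>x\<in>UNIV. \<Sum>x'\<in>UNIV. \<Sum>a\<in>UNIV. \<Sum>a'\<in>UNIV. ?d x x' a a')"
    by (rule sum_flat[of ?d])
  also have "\<dots> = (\<Sum>x\<in>UNIV. \<Sum>x'\<in>UNIV. \<Sum>a\<in>UNIV. \<Sum>a'\<in>UNIV. (norm (app (F x x' a a') \<xi>))\<^sup>2)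
      + (\<Sum>x\<in>UNIV. \<Sum>x'\<in>UNIV. \<Sum>a\<in>UNIV. \<Sum>a'\<in>UNIV. (norm (app (E x' x a' a) \<xi>))\<^sup>2)
      - 2 * Re (\<Sum>x\<in>UNIV. \<Sum>x'\<in>UNIV. \<Sum>a\<in>UNIV. \<Sum>a'\<in>UNIV. cinner (app (E x x' a a' o\<^sub>L F x x' a a') \<xi>) \<xi>)"
    unfolding exp by (simp add: sum.distrib sum_subtractf sum_distrib_left)
  also have "(\<Sum>x\<in>UNIV. \<Sum>x'\<in>UNIV. \<Sum>a\<in>UNIV. \<Sum>a'\<in>UNIV. (norm (app (E x' x a' a) \<xi>))\<^sup>2)
      = (\<Sum>x\<in>UNIV. \<Sum>x'\<in>UNIV. \<Sum>a\<in>UNIV. \<Sum>a'\<in>UNIV. (norm (app (E x x' a a') \<xi>))\<^sup>2)"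
    by (rule trans[OF sum.swap]) (intro sum.cong[OF refl] sum.swap)
  finally have fin: "?d x x' a a' \<le> ?SF + ?SE - 2 * Re ?S" .
  have "?d x x' a a' \<le> 2 * (real CARD('x) * real CARD('a) - Re ?S)"
  proof -
    have "d \<le> 2 * (n - s)" if "d \<le> f + e - 2 * s" "f \<le> n" "e \<le> n" for d f e s n :: real
      using that by simp
    from this[OF fin F.total_norm_le[OF norm_xi] E.total_norm_le[OF norm_xi]]
    show ?thesis .
  qed
  then show ?thesis unfolding defect_def by (rule real_le_rsqrt)
qed

lemma defect_nonneg: "0 \<le> defect"
  using order_trans[OF norm_ge_zero defect_bound] .

text \<open>Move E to the right-hand vector, exchange it for F, move F back, let it pass T, and
  exchange it for E again. Each of the two exchanges costs \<open>norm T * defect\<close>.\<close>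

lemma approx_trace:
  assumes T: "T \<in> bop" and comm: "\<And>y y' b b'. T o\<^sub>L F y y' b b' = F y y' b b' o\<^sub>L T"
  shows "cmod (cinner (app (E x x' a a' o\<^sub>L T) \<xi>) \<xi> - cinner (app (T o\<^sub>L E x x' a a') \<xi>) \<xi>)
    \<le> 2 * norm T * defect"
proof -
  let ?E = "\<lambda>x x' a a'. app (E x x' a a') \<xi>" and ?F = "\<lambda>x x' a a'. app (F x x' a a') \<xi>"
  have nT: "norm (app T u) \<le> norm T * norm u" for u by (rule norm_blinfun)
  have 1: "cinner (app (E x x' a a' o\<^sub>L T) \<xi>) \<xi> = cinner (app T \<xi>) (?E x' x a' a)"
    by (simp add: E.hermitian)
  have "cinner (app T \<xi>) (?F x x' a a') = cinner (app (F x' x a' a o\<^sub>L T) \<xi>) \<xi>"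
    by (simp add: F.hermitian)
  then have 2: "cinner (app T \<xi>) (?F x x' a a') = cinner (app T (?F x' x a' a)) \<xi>"
    by (simp add: comm[symmetric])
  have "cinner (app (E x x' a a' o\<^sub>L T) \<xi>) \<xi> - cinner (app (T o\<^sub>L E x x' a a') \<xi>) \<xi>
      = cinner (app T (?F x' x a' a - ?E x x' a a')) \<xi>
        - cinner (app T \<xi>) (?F x x' a a' - ?E x' x a' a)"
    unfolding 1 blinfun.diff_right cinner_diff_left cinner_diff_right 2 by simp
  also have "cmod \<dots> \<le> norm (app T (?F x' x a' a - ?E x x' a a')) * norm \<xi>
      + norm (app T \<xi>) * norm (?F x x' a a' - ?E x' x a' a)"
    by (rule order_trans[OF norm_triangle_ineq4]) (intro add_mono norm_cinner_le)
  also have "\<dots> \<le> (norm T * defect) * 1 + norm T * defect"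
    using nT[of \<xi>]
    by (intro add_mono mult_mono order_trans[OF nT] mult_left_mono defect_bound) (auto simp: norm_xi defect_nonneg)
  finally show ?thesis by simp
qed

text \<open>Exchanging F for E at \<xi> costs \<open>defect\<close>; the root bounds the norm of the
  vector on the other side.\<close>

lemma approx_correlation:
  "cmod (cinner (app (E x x' a a' o\<^sub>L F y y' b b') \<xi>) \<xi>
      - cinner (app (E x x' a a' o\<^sub>L E y' y b' b) \<xi>) \<xi>)
    \<le> defect * sqrt (real CARD('x) * real CARD('a))"
proof -
  have "cinner (app (E x x' a a' o\<^sub>L F y y' b b') \<xi>) \<xi>
      - cinner (app (E x x' a a' o\<^sub>L E y' y b' b) \<xi>) \<xi>
      = cinner (app (F y y' b b') \<xi> - app (E y' y b' b) \<xi>) (app (E x' x a' a) \<xi>)"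
    by (simp add: E.hermitian cinner_diff_left)
  also have "cmod \<dots> \<le> norm (app (F y y' b b') \<xi> - app (E y' y b' b) \<xi>)
      * norm (app (E x' x a' a) \<xi>)"
    by (rule norm_cinner_le)
  also have "\<dots> \<le> defect * sqrt (real CARD('x) * real CARD('a))"
  proof (intro mult_mono defect_bound)
    show "norm (app (E x' x a' a) \<xi>) \<le> sqrt (real CARD('x) * real CARD('a))"
      by (rule real_le_rsqrt) (rule E.norm_sq_le[OF norm_xi])
  qed (auto simp: defect_nonneg)
  finally show ?thesis .
qed

end

section \<open>Block isometries\<close>

text \<open>Mediates between two conventions: \<open>psd_kernel_op_matrix\<close> has the operator
  on the left of the inner product, a Gram matrix for V adjoint times V has it on the right.\<close>

lemma psd_kernel_transpose: "psd_kernel K \<Longrightarrow> psd_kernel (\<lambda>i j. K j i)"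
  for K :: "'a \<Rightarrow> 'a \<Rightarrow> complex"
  unfolding psd_kernel_def
proof (intro allI impI)
  fix F :: "'a set" and c :: "'a \<Rightarrow> complex"
  assume K: "\<forall>F c. finite F \<longrightarrow> (\<Sum>i\<in>F. \<Sum>j\<in>F. K i j * c j * cnj (c i)) \<in> \<real>\<^sub>\<ge>\<^sub>0" and F: "finite F"
  from K[rule_format, OF F, of "\<lambda>i. cnj (c i)"]
  show "(\<Sum>i\<in>F. \<Sum>j\<in>F. K j i * c j * cnj (c i)) \<in> \<real>\<^sub>\<ge>\<^sub>0"
    by (subst sum.swap) (simp add: mult_ac)
qed

lemma ell2_op_eqI:
  assumes "S \<in> bop" "T \<in> bop"
    and "\<And>n m. cinner (ket n) (app S (ket m)) = cinner (ket n) (app T (ket m))"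
  shows "S = T"
proof (rule blinfun_ell2_eqI)
  show "app S (ket m) = app T (ket m)" for m
    using assms(3)[of _ m] by (intro hsum_eq_proj) (simp add: cinner_ket_left)
qed (use assms in \<open>auto simp: bop_iff_clin\<close>)

text \<open>Factors E without a square root: Gram vectors of its scalar kernel on basis vectors
  serve as the columns of V. The isometry property of V is the normalisation of E.\<close>

lemma ex_block_isometry_factor:
  fixes E :: "'x::finite \<Rightarrow> 'x \<Rightarrow> 'a::finite \<Rightarrow> 'a \<Rightarrow> ell2 op"
  assumes "stochastic_operator_matrix E"
  shows "\<exists>V. is_block_isometry V \<and> (\<forall>x x' a a'. op_adj (V a x) o\<^sub>L V a' x' = E x x' a a')"
proof -
  interpret stochastic E by standard (rule assms)
  define f :: "('x \<times> 'a) \<times> nat \<Rightarrow> ('x \<times> 'a) \<times> ell2" where "f = (\<lambda>(p, n). (p, ket n))"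
  have "n = m" if "ket n = ket m" for n m
    using arg_cong[OF that, of "app (proj m)"] by (simp split: if_splits)
  then have "inj f" by (auto simp: inj_on_def f_def)
  define K :: "('x \<times> 'a) \<times> nat \<Rightarrow> ('x \<times> 'a) \<times> nat \<Rightarrow> complex" where
    "K i j = cinner (ket (snd i)) (app (flat E (fst i) (fst j)) (ket (snd j)))" for i j
  have "psd_kernel K"
    using psd_kernel_pullback[OF psd_kernel_transpose[OF psd_kernel_op_matrix[OF psd bop]] \<open>inj f\<close>]
    by (simp add: f_def K_def[abs_def] case_prod_unfold hermitian)
  then obtain g :: "('x \<times> 'a) \<times> nat \<Rightarrow> ell2" where g: "\<And>i j. cinner (g i) (g j) = K i j" using ex_gram_vectors[OF \<open>psd_kernel K\<close>] by blast
  have "\<exists>S :: ell2 \<Rightarrow>\<^sub>L ell2. clin S \<and> norm S \<le> 1 \<and> (\<forall>n. app S (ket n) = g ((x, a), n))" for a x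
  proof (rule ex_synthesis_operator)
    fix N and c :: "nat \<Rightarrow> complex"
    define u where "u = (\<Sum>n<N. c n *\<^sub>C ket n)"
    have "cinner (\<Sum>n<N. c n *\<^sub>C g ((x, a), n)) (\<Sum>n<N. c n *\<^sub>C g ((x, a), n)) = cinner u (app (E x x a a) u)"
      by (simp add: u_def cinner_sum_left cinner_sum_right cinner_scaleC_left cinner_scaleC_right g K_def
          blinfun.sum_right bopD[OF bop])
    \<comment> \<open>The diagonal block \<open>E x x a a\<close> is at most 1, so the Gram vectors
      with fixed (x, a) satisfy the contraction bound of
      \<open>ex_synthesis_operator\<close>.\<close>
    also have "Re \<dots> \<le> (norm u)\<^sup>2"
    proof -
      let ?h = "\<lambda>y. if y = x then u else 0"
      have "(\<Sum>y\<in>UNIV. \<Sum>y'\<in>UNIV. cinner (app (E y y' a a) (?h y')) (?h y))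
          = cinner (app (E x x a a) u) u"
        by (subst sum_UNIV_single2[of x x]) auto
      moreover have "(\<Sum>y\<in>UNIV. (norm (?h y))\<^sup>2) = (norm u)\<^sup>2"
        by (subst sum_UNIV_single[of x]) auto
      ultimately show ?thesis using form_diag_le[of a ?h] by (simp add: hermitian)
    qed
    also have "(norm u)\<^sup>2 = (\<Sum>n<N. (cmod (c n))\<^sup>2)"
    proof -
      have "complex_of_real ((norm u)\<^sup>2) = (\<Sum>n<N. c n * cnj (c n))"
        unfolding cinner_self[symmetric] u_def cinner_sum_ket by simp
      also have "\<dots> = complex_of_real (\<Sum>n<N. (cmod (c n))\<^sup>2)" by (simp add: complex_norm_square[symmetric])
      finally show ?thesis by (simp only: of_real_eq_iff)
    qed
    finally show "(norm (\<Sum>n<N. c n *\<^sub>C g ((x, a), n)))\<^sup>2 \<le> (\<Sum>n<N. (cmod (c n))\<^sup>2)"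
      by (simp add: cinner_self)
  qed
  note ex = this
  define V :: "'a \<Rightarrow> 'x \<Rightarrow> ell2 op" where
    "V a x = (SOME S. clin S \<and> norm S \<le> 1 \<and> (\<forall>n. app S (ket n) = g ((x, a), n)))" for a x
  have V: "V a x \<in> bop" "app (V a x) (ket n) = g ((x, a), n)" for a x n
    using someI_ex[OF ex[of x a]] by (auto simp: V_def bop_iff_clin)
  have VV: "op_adj (V a x) o\<^sub>L V a' x' = E x x' a a'" for a x a' x'
    by (rule ell2_op_eqI)
      (simp_all add: bop_intros op_adj_bop V bop cinner_op_adj[symmetric] g K_def)
  have "(\<Sum>a\<in>UNIV. (norm (\<Sum>x\<in>UNIV. app (V a x) (h x)))\<^sup>2) = (\<Sum>x\<in>UNIV. (norm (h x))\<^sup>2)" for h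
  proof -
    have ip: "cinner (app (V a x) u) (app (V a x') v) = cinner u (app (E x x' a a) v)"
      for a x x' u v
      using VV[of a x a x', symmetric] by (simp add: cinner_op_adj V)
    have "complex_of_real (\<Sum>a\<in>UNIV. (norm (\<Sum>x\<in>UNIV. app (V a x) (h x)))\<^sup>2)
        = (\<Sum>a\<in>UNIV. \<Sum>x'\<in>UNIV. \<Sum>x\<in>UNIV. cinner (h x) (app (E x x' a a) (h x')))"
      by (simp add: cinner_self[symmetric] cinner_sum_left cinner_sum_right ip del: of_real_power)
    also have "\<dots> = (\<Sum>x'\<in>UNIV. \<Sum>x\<in>UNIV. \<Sum>a\<in>UNIV. cinner (h x) (app (E x x' a a) (h x')))"
      by (subst sum.swap, intro sum.cong[OF refl]) (rule sum.swap)
    also have "\<dots> = (\<Sum>x'\<in>UNIV. \<Sum>x\<in>UNIV. if x = x' then cinner (h x) (h x) else 0)"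
      unfolding cinner_sum_right[symmetric] blinfun.sum_left[symmetric] sum_diag
      by (intro sum.cong refl) auto
    also have "\<dots> = complex_of_real (\<Sum>x\<in>UNIV. (norm (h x))\<^sup>2)" by (simp add: cinner_self)
    finally show ?thesis by (simp only: of_real_eq_iff)
  qed
  then show ?thesis using V VV by (intro exI[of _ V]) (auto simp: is_block_isometry_def)
qed

section \<open>Reduction to a separable Hilbert space\<close>

lemma sum_nonneg_Reals: "(\<And>i. i \<in> I \<Longrightarrow> f i \<in> \<real>\<^sub>\<ge>\<^sub>0) \<Longrightarrow> (\<Sum>i\<in>I. f i) \<in> (\<real>\<^sub>\<ge>\<^sub>0 :: complex set)"
  by (induction I rule: infinite_finite_induct) auto

text \<open>As \<open>sgn\<close> of 0 is 0, a vector that depends on its predecessors yields 0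
  instead of being skipped. The family is orthonormal up to zero vectors, and later identities are
  phrased to hold for both.\<close>

fun gram_schmidt :: "(nat \<Rightarrow> 'h::chilbert_space) \<Rightarrow> nat \<Rightarrow> 'h" where
  "gram_schmidt u n = sgn (u n - (\<Sum>k<n. cinner (u n) (gram_schmidt u k) *\<^sub>C gram_schmidt u k))"

declare gram_schmidt.simps [simp del]

lemma gram_schmidt_norm:
  "cinner (gram_schmidt u n) (gram_schmidt u n) *\<^sub>C gram_schmidt u n = gram_schmidt u n"
  "norm (gram_schmidt u n) \<le> 1"
proof -
  have "norm (gram_schmidt u n) = 0 \<or> norm (gram_schmidt u n) = 1"
    by (subst (1 2) gram_schmidt.simps) (simp add: norm_sgn)
  then show "cinner (gram_schmidt u n) (gram_schmidt u n) *\<^sub>C gram_schmidt u n = gram_schmidt u n"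
    "norm (gram_schmidt u n) \<le> 1"
    by (auto simp: cinner_self)
qed

lemma gram_schmidt_orthogonal_less: "m < n \<Longrightarrow> cinner (gram_schmidt u n) (gram_schmidt u m) = 0"
proof (induction n arbitrary: m rule: less_induct)
  case (less n)
  let ?e = "gram_schmidt u"
  have orth: "cinner (?e k) (?e m) = 0" if "k < n" "k \<noteq> m" for k
  proof (cases "k < m")
    case True
    then have "cinner (?e m) (?e k) = 0" using less by auto
    then show ?thesis using cinner_commute[of "?e k" "?e m"] by simp
  next
    case False
    then show ?thesis using less.IH[of k m] that by auto
  qed
  have "(\<Sum>k<n. cinner (u n) (?e k) * cinner (?e k) (?e m)) = cinner (u n) (?e m) * cinner (?e m) (?e m)"
  proof -
    have "(\<Sum>k<n. cinner (u n) (?e k) * cinner (?e k) (?e m))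
        = (\<Sum>k\<in>{m}. cinner (u n) (?e k) * cinner (?e k) (?e m))"
      by (rule sum.mono_neutral_right) (use less.prems orth in auto)
    then show ?thesis by simp
  qed
  also have "\<dots> = cinner (u n) (cinner (?e m) (?e m) *\<^sub>C ?e m)"
    by (simp add: cinner_scaleC_right cinner_self)
  also have "\<dots> = cinner (u n) (?e m)" by (simp only: gram_schmidt_norm)
  finally have "cinner (u n - (\<Sum>k<n. cinner (u n) (?e k) *\<^sub>C ?e k)) (?e m) = 0"
    by (simp add: cinner_diff_left cinner_sum_left cinner_scaleC_left)
  then show ?case
    by (subst gram_schmidt.simps) (simp add: sgn_div_norm cinner_scaleR_left)
qed

lemma gram_schmidt_orthogonal: "m \<noteq> n \<Longrightarrow> cinner (gram_schmidt u n) (gram_schmidt u m) = 0"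
  using gram_schmidt_orthogonal_less[of m n u] gram_schmidt_orthogonal_less[of n m u]
    cinner_commute[of "gram_schmidt u n" "gram_schmidt u m"] by (cases "m < n") auto

lemma gram_schmidt_expand:
  "\<exists>r. u n = r *\<^sub>R gram_schmidt u n + (\<Sum>k<n. cinner (u n) (gram_schmidt u k) *\<^sub>C gram_schmidt u k)"
proof -
  define f where "f = u n - (\<Sum>k<n. cinner (u n) (gram_schmidt u k) *\<^sub>C gram_schmidt u k)"
  have "gram_schmidt u n = sgn f" unfolding f_def by (rule gram_schmidt.simps)
  then have "norm f *\<^sub>R gram_schmidt u n = f"
    by (cases "f = 0") (auto simp: sgn_div_norm)
  then show ?thesis by (intro exI[of _ "norm f"]) (simp add: f_def)
qed

context
  fixes u :: "nat \<Rightarrow> 'h::chilbert_space"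
begin

text \<open>Zero vectors in the Gram-Schmidt family make S a partial isometry only, so S W S = S
  stands in for W S = 1, and S W is the projection onto the closed span.\<close>

lemma ex_coordinate_maps:
  "\<exists>(S :: ell2 \<Rightarrow>\<^sub>L 'h) (W :: 'h \<Rightarrow>\<^sub>L ell2). clin S \<and> clin W \<and> norm S \<le> 1 \<and>
     (\<forall>f v. cinner (app S f) v = cinner f (app W v)) \<and>
     (\<forall>n. app S (ket n) = gram_schmidt u n) \<and>
     (\<forall>f. app S (app W (app S f)) = app S f)"
proof -
  let ?e = "gram_schmidt u"
  have "(norm (\<Sum>n<N. c n *\<^sub>C ?e n))\<^sup>2 \<le> (\<Sum>n<N. (cmod (c n))\<^sup>2)" for N and c :: "nat \<Rightarrow> complex"
  proof -
    have "cinner (\<Sum>n<N. c n *\<^sub>C ?e n) (\<Sum>n<N. c n *\<^sub>C ?e n)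
        = (\<Sum>m<N. \<Sum>n<N. c n * cnj (c m) * cinner (?e n) (?e m))"
      by (simp add: cinner_sum_left cinner_sum_right cinner_scaleC_left cinner_scaleC_right mult_ac sum_distrib_left)
    also have "\<dots> = (\<Sum>m<N. \<Sum>n<N. if n = m then complex_of_real ((cmod (c m))\<^sup>2 * (norm (?e m))\<^sup>2) else 0)"
      by (intro sum.cong refl)
        (auto simp: gram_schmidt_orthogonal cinner_self complex_norm_square[symmetric] simp flip: of_real_power)
    also have "\<dots> = complex_of_real (\<Sum>m<N. (cmod (c m))\<^sup>2 * (norm (?e m))\<^sup>2)" by simp
    finally have "(norm (\<Sum>n<N. c n *\<^sub>C ?e n))\<^sup>2 = (\<Sum>m<N. (cmod (c m))\<^sup>2 * (norm (?e m))\<^sup>2)"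
      by (simp only: cinner_self of_real_eq_iff)
    also have "\<dots> \<le> (\<Sum>m<N. (cmod (c m))\<^sup>2)"
      by (intro sum_mono mult_left_le power_le_one gram_schmidt_norm) auto
    finally show ?thesis .
  qed
  then obtain S :: "ell2 \<Rightarrow>\<^sub>L 'h" where S: "clin S" "norm S \<le> 1" "\<And>n. app S (ket n) = ?e n"
    using ex_synthesis_operator[of ?e] by blast
  obtain W :: "'h \<Rightarrow>\<^sub>L ell2" where W: "clin W" "norm W \<le> norm S"
    "\<And>f v. cinner (app S f) v = cinner f (app W v)"
    using ex_adjoint[OF S(1)] by blast
  have We: "app W (?e n) = cinner (?e n) (?e n) *\<^sub>C ket n" for n
  proof (rule hsum_eq_proj)
    fix m
    have "cnj (app (proj m) (app W (?e n))) = cinner (?e m) (?e n)"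
      by (simp add: cinner_ket_left[symmetric] W(3)[symmetric] S(3))
    also have "\<dots> = cnj (if m = n then cinner (?e n) (?e n) else 0)"
      by (auto simp: gram_schmidt_orthogonal cinner_self)
    finally have "app (proj m) (app W (?e n)) = (if m = n then cinner (?e n) (?e n) else 0)"
      by (simp only: complex_cnj_cancel_iff)
    then show "app (proj m) (app W (?e n)) = app (proj m) (cinner (?e n) (?e n) *\<^sub>C ket n)"
      by (simp add: clinD[OF clin_proj] scaleC_complex_def)
  qed
  have "S o\<^sub>L W o\<^sub>L S = S"
    by (rule blinfun_ell2_eqI)
      (auto simp: S W clin_compose We clinD[OF S(1)] gram_schmidt_norm)
  then have "app S (app W (app S f)) = app S f" for f
    by (metis blinfun_apply_blinfun_compose)
  then show ?thesis using S W by blast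
qed

end

text \<open>\<open>C_XA\<close> only sees block isometries on \<open>\<ell>\<^sup>2\<close>.  Compress to the closed span of all words in \<open>E\<close> and \<open>F\<close>
  applied to \<open>\<xi>\<close>, embed it into \<open>\<ell>\<^sup>2\<close> by an orthonormal basis, and use a scalar stochastic matrix
  on the complement.\<close>

lemma (in commuting_pair) ex_ell2_pair:
  "\<exists>E' F' \<xi>'. commuting_pair (E' :: 'x \<Rightarrow> 'x \<Rightarrow> 'a \<Rightarrow> 'a \<Rightarrow> ell2 op) F' \<xi>' \<and>
     (\<forall>x x' a a' y y' b b'. cinner (app (E' x x' a a' o\<^sub>L F' y y' b b') \<xi>') \<xi>'
        = cinner (app (E x x' a a' o\<^sub>L F y y' b b') \<xi>) \<xi>)"
proof -
  \<comment> \<open>One finite alphabet for both families, the flag telling them apart; words are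
    then lists that \<open>from_nat\<close> enumerates.\<close>
  define gen where "gen = (\<lambda>(i::bool, x, x', a, a'). if i then E x x' a a' else F x x' a a')"
  define act where "act w = foldr (\<lambda>q. app (gen q)) w \<xi>" for w
  define u where "u n = act (from_nat n)" for n
  let ?e = "gram_schmidt u"
  obtain S :: "ell2 \<Rightarrow>\<^sub>L 'h" and W :: "'h \<Rightarrow>\<^sub>L ell2" where
    S: "clin S" and W: "clin W" and nS: "norm S \<le> 1" and
    SW: "\<And>f v. cinner (app S f) v = cinner f (app W v)" and
    Sk: "\<And>n. app S (ket n) = ?e n" and
    SWS: "\<And>f. app S (app W (app S f)) = app S f"
    using ex_coordinate_maps[of u] by blast
  have WS: "cinner (app W v) f = cinner v (app S f)" for v f
    using SW[of f v] cinner_commute[of "app W v" f] cinner_commute[of v "app S f"] by simp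
  \<comment> \<open>The closed span of the words, described as the fixed points of the projection S
    W, so that closures need not be mentioned.\<close>
  define M where "M = {v. app S (app W v) = v}"
  have M_diff: "v - w \<in> M" and M_add: "v + w \<in> M" if "v \<in> M" "w \<in> M" for v w
    using that by (auto simp: M_def blinfun.add_right blinfun.diff_right)
  have M_scaleC: "c *\<^sub>C v \<in> M" and M_scaleR: "r *\<^sub>R v \<in> M" if "v \<in> M" for v c r
    using that by (auto simp: M_def blinfun.scaleR_right clinD[OF S] clinD[OF W])
  have M_sum: "(\<Sum>k\<in>I. f k) \<in> M" if "\<And>k. k \<in> I \<Longrightarrow> f k \<in> M" for f and I :: "nat set"
    using that by (simp add: M_def blinfun.sum_right)
  have eM: "?e n \<in> M" for n using SWS[of "ket n"] by (simp add: M_def Sk)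
  have uM: "u n \<in> M" for n
  proof -
    obtain r where "u n = r *\<^sub>R ?e n + (\<Sum>k<n. cinner (u n) (?e k) *\<^sub>C ?e k)"
      using gram_schmidt_expand by blast
    moreover have "r *\<^sub>R ?e n + (\<Sum>k<n. cinner (u n) (?e k) *\<^sub>C ?e k) \<in> M"
      by (intro M_add M_sum M_scaleR M_scaleC eM)
    ultimately show ?thesis by simp
  qed
  have actM: "act w \<in> M" for w using uM[of "to_nat w"] by (simp add: u_def)
  have gen_bop: "gen q \<in> bop" for q by (auto simp: gen_def E.bop F.bop split: prod.splits)
  \<comment> \<open>Generators send words to words, but \<open>?e n\<close> is a normalised
    difference of the word \<open>u n\<close> and earlier basis vectors; hence the
    induction.\<close>
  have gen_e: "app (gen q) (?e n) \<in> M" for q n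
  proof (induction n rule: less_induct)
    case (less n)
    have "app (gen q) (u n) = act (q # from_nat n)" by (simp add: u_def act_def)
    then have "app (gen q) (u n) \<in> M" by (simp add: actM)
    then have "app (gen q) (u n) - (\<Sum>k<n. cinner (u n) (?e k) *\<^sub>C app (gen q) (?e k)) \<in> M"
      by (intro M_diff M_sum M_scaleC) (use less in auto)
    then have "app (gen q) (u n - (\<Sum>k<n. cinner (u n) (?e k) *\<^sub>C ?e k)) \<in> M"
      by (simp add: blinfun.diff_right blinfun.sum_right bopD[OF gen_bop])
    then show ?case
      by (subst gram_schmidt.simps) (simp add: sgn_div_norm blinfun.scaleR_right M_scaleR)
  qed
  have SWgS: "app S (app W (app (gen q) (app S f)))
      = app (gen q) (app S f)" for q f
  proof -
    have "S o\<^sub>L W o\<^sub>L gen q o\<^sub>L S = gen q o\<^sub>L S"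
      using gen_bop[of q] gen_e[of q]
      by (intro blinfun_ell2_eqI clin_compose S W) (auto simp: bop_iff_clin Sk M_def)
    then show ?thesis by (metis blinfun_apply_blinfun_compose)
  qed
  have gE: "gen (True, x, x', a, a') = E x x' a a'" and gF: "gen (False, x, x', a, a') = F x x' a a'"
    for x x' a a' by (auto simp: gen_def)
  note SWES = SWgS[of "(True, x, x', a, a')" for x x' a a', unfolded gE]
  note SWFS = SWgS[of "(False, x, x', a, a')" for x x' a a', unfolded gF]
  have xiM: "app S (app W \<xi>) = \<xi>"
    using actM[of "[]"] by (simp add: act_def M_def)
  have FxiM: "app S (app W (app (F x x' a a') \<xi>)) = app (F x x' a a') \<xi>"
    for x x' a a'
    using actM[of "[(False, x, x', a, a')]"] by (simp add: act_def M_def gF)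
  \<comment> \<open>The scalar stochastic matrix for the complement; \<open>undefined\<close> is an
    arbitrary fixed outcome that receives all the weight.\<close>
  define c :: "'x \<Rightarrow> 'x \<Rightarrow> 'a \<Rightarrow> 'a \<Rightarrow> complex" where
    "c x x' a a' = (if x = x' \<and> a = undefined \<and> a' = undefined then 1 else 0)" for x x' a a'
  define D where "D G x x' a a' = (W o\<^sub>L G x x' a a' o\<^sub>L S) + op_scaleC (c x x' a a') (id_blinfun - (W o\<^sub>L S))"
    for G :: "'x \<Rightarrow> 'x \<Rightarrow> 'a \<Rightarrow> 'a \<Rightarrow> 'h op" and x x' a a'
  have D_apply: "app (D G x x' a a') f = app W (app (G x x' a a') (app S f))
      + c x x' a a' *\<^sub>C (f - app W (app S f))" for G x x' a a' f
    by (simp add: D_def blinfun.add_left op_scaleC_apply blinfun.diff_left)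
  have D_stoch: "stochastic_operator_matrix (D G)" if "stochastic_operator_matrix G" for G
  proof -
    interpret G: stochastic G by standard (rule that)
    show ?thesis unfolding stochastic_operator_matrix_def
    proof (intro conjI allI)
      show "D G x x' a a' \<in> bop" for x x' a a'
        by (simp add: bop_def D_apply clinD[OF S] clinD[OF W] bopD[OF G.bop] scaleC_add_right
            scaleC_diff_right scaleC_scaleC mult.commute)
      show "(\<Sum>a\<in>UNIV. D G x x' a a) = (if x = x' then id_blinfun else 0)" for x x'
      proof (rule blinfun_eqI)
        fix f
        have "(\<Sum>a\<in>UNIV. c x x' a a *\<^sub>C v) = (if x = x' then v else 0)" for v :: ell2
          by (subst sum_UNIV_single[of undefined]) (auto simp: c_def)
        moreover have "(\<Sum>a\<in>UNIV. app W (app (G x x' a a) (app S f)))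
            = (if x = x' then app W (app S f) else 0)"
          unfolding blinfun.sum_right[symmetric] blinfun.sum_left[symmetric] G.sum_diag by simp
        ultimately show "app (\<Sum>a\<in>UNIV. D G x x' a a) f
            = app (if x = x' then id_blinfun else 0) f"
          by (simp add: blinfun.sum_left D_apply sum.distrib)
      qed
      fix h :: "'x \<Rightarrow> 'a \<Rightarrow> ell2"
      define r where "r x = cinner (h x undefined - app W (app S (h x undefined))) (h x undefined)" for x
      have r: "r x \<in> \<real>\<^sub>\<ge>\<^sub>0" for x
      proof -
        let ?v = "h x undefined"
        have "norm (app S ?v) \<le> norm S * norm ?v" by (rule norm_blinfun)
        also have "\<dots> \<le> 1 * norm ?v" by (intro mult_right_mono nS) simp
        finally have "(norm (app S ?v))\<^sup>2 \<le> (norm ?v)\<^sup>2" by (intro power_mono) auto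
        moreover have "r x = complex_of_real ((norm ?v)\<^sup>2 - (norm (app S ?v))\<^sup>2)"
          by (simp add: r_def cinner_diff_left WS cinner_self)
        ultimately show ?thesis by (simp add: complex_nonneg_Reals_iff del: of_real_diff)
      qed
      have "(\<Sum>x\<in>UNIV. \<Sum>x'\<in>UNIV. \<Sum>a\<in>UNIV. \<Sum>a'\<in>UNIV. cinner (app (D G x x' a a') (h x' a')) (h x a))
          = (\<Sum>x\<in>UNIV. \<Sum>x'\<in>UNIV. \<Sum>a\<in>UNIV. \<Sum>a'\<in>UNIV.
              cinner (app (G x x' a a') (app S (h x' a'))) (app S (h x a)))
          + (\<Sum>x\<in>UNIV. \<Sum>x'\<in>UNIV. \<Sum>a\<in>UNIV. \<Sum>a'\<in>UNIV. c x x' a a' *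
              cinner (h x' a' - app W (app S (h x' a'))) (h x a))"
        by (simp add: D_apply cinner_add_left cinner_scaleC_left WS sum.distrib)
      also have "(\<Sum>x\<in>UNIV. \<Sum>x'\<in>UNIV. \<Sum>a\<in>UNIV. \<Sum>a'\<in>UNIV. c x x' a a' *
              cinner (h x' a' - app W (app S (h x' a'))) (h x a)) = (\<Sum>x\<in>UNIV. r x)"
      proof (intro sum.cong refl)
        fix x
        have "(\<Sum>a\<in>UNIV. \<Sum>a'\<in>UNIV. c x x' a a' *
              cinner (h x' a' - app W (app S (h x' a'))) (h x a)) = (if x' = x then r x else 0)" for x'
          by (subst sum_UNIV_single2[of undefined undefined]) (auto simp: c_def r_def)
        then show "(\<Sum>x'\<in>UNIV. \<Sum>a\<in>UNIV. \<Sum>a'\<in>UNIV. c x x' a a' *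
              cinner (h x' a' - app W (app S (h x' a'))) (h x a)) = r x"
          by simp
      qed
      also have "(\<Sum>x\<in>UNIV. \<Sum>x'\<in>UNIV. \<Sum>a\<in>UNIV. \<Sum>a'\<in>UNIV.
              cinner (app (G x x' a a') (app S (h x' a'))) (app S (h x a)))
          + (\<Sum>x\<in>UNIV. r x) \<in> \<real>\<^sub>\<ge>\<^sub>0"
        by (intro nonneg_Reals_add_I G.psd4 sum_nonneg_Reals r)
      finally show "(\<Sum>x\<in>UNIV. \<Sum>x'\<in>UNIV. \<Sum>a\<in>UNIV. \<Sum>a'\<in>UNIV.
          cinner (app (D G x x' a a') (h x' a')) (h x a)) \<in> \<real>\<^sub>\<ge>\<^sub>0" .
    qed
  qed
  have comm: "app (E x x' a a') (app (F y y' b b') v)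
      = app (F y y' b b') (app (E x x' a a') v)" for x x' a a' y y' b b' v
    using arg_cong[OF commute, of "\<lambda>T. app T v"] by simp
  \<comment> \<open>On the span the compressions multiply because it is invariant
    (\<open>SWES\<close>, \<open>SWFS\<close>); on the complement both operators are
    scalars.\<close>
  have "D E x x' a a' o\<^sub>L D F y y' b b' = D F y y' b b' o\<^sub>L D E x x' a a'" for x x' a a' y y' b b'
    by (rule blinfun_eqI)
      (simp add: D_apply blinfun.add_right blinfun.diff_right clinD[OF S] clinD[OF W] bopD[OF E.bop] bopD[OF F.bop]
        SWS SWES SWFS comm scaleC_scaleC mult.commute)
  moreover have "norm (app W \<xi>) = 1"
  proof -
    have "complex_of_real ((norm (app W \<xi>))\<^sup>2) = complex_of_real ((norm \<xi>)\<^sup>2)"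
      unfolding cinner_self[symmetric] WS xiM ..
    then have "(norm (app W \<xi>))\<^sup>2 = (norm \<xi>)\<^sup>2" by (simp only: of_real_eq_iff)
    then have "norm (app W \<xi>) = norm \<xi>" by (rule power2_eq_imp_eq) auto
    then show ?thesis by (simp add: norm_xi)
  qed
  ultimately have "commuting_pair (D E) (D F) (app W \<xi>)"
    by unfold_locales (auto intro: D_stoch E.stochastic F.stochastic)
  moreover have "cinner (app (D E x x' a a' o\<^sub>L D F y y' b b') (app W \<xi>)) (app W \<xi>)
        = cinner (app (E x x' a a' o\<^sub>L F y y' b b') \<xi>) \<xi>" for x x' a a' y y' b b'
    by (simp add: D_apply xiM FxiM WS)
  ultimately show ?thesis by blast
qed

section \<open>Representations of the universal algebra and traces\<close>

text \<open>Lets \<open>C_XA_minimal\<close> show that compression maps \<open>C_XA\<close> into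
  \<B>, given only that the generators land there.\<close>

lemma unital_cstar_algebra_compress_vimage:
  assumes "unital_cstar_algebra \<B>"
  shows "unital_cstar_algebra {z \<in> block_diag i. compress i z \<in> \<B>}"
proof -
  note B = unital_cstar_algebraD[OF assms]
  note D = unital_cstar_algebraD[OF unital_cstar_algebra_block_diag[of i]]
  have "closed (block_diag i \<inter> compress i -` \<B>)"
    unfolding compress_def
    by (intro closed_Int D(2) closed_vimage B(2) bounded_bilinear.continuous_on[OF bounded_bilinear_blinfun_compose]
        continuous_intros)
  moreover have "block_diag i \<inter> compress i -` \<B> = {z \<in> block_diag i. compress i z \<in> \<B>}" by auto
  ultimately have "closed {z \<in> block_diag i. compress i z \<in> \<B>}" by simp
  then show ?thesis
    unfolding unital_cstar_algebra_def using B D subsetD[OF D(1)]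
    by (auto simp: compress_simps compress_compose(1) compress_adj)
qed

text \<open>Since V is itself one of the summands of the universal isometry, compression to that
  summand is the representation with \<open>univ_e\<close> going to E. The functional is a trace on
  its own centralizer, so it pulls back to a trace.\<close>

lemma trace_through_compress:
  fixes V :: "'a::finite \<Rightarrow> 'x::finite \<Rightarrow> ell2 op"
  assumes V: "is_block_isometry V" "\<And>x x' a a'. op_adj (V a x) o\<^sub>L V a' x' = E x x' a a'"
    and D: "unital_cstar_algebra \<D>" "bounded_hermitian \<D> \<psi>" "state \<D> \<psi>"
    and E: "\<And>x x' a a'. E x x' a a' \<in> centralizer \<D> \<psi>"
  shows "\<exists>\<pi>. unital_star_hom C_XA (centralizer \<D> \<psi>) \<pi> \<and> (\<forall>x x' a a'. \<pi> (univ_e x x' a a') = E x x' a a') \<and>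
    tracial_state (centralizer \<D> \<psi>) \<psi> \<and> tracial_state (C_XA :: ('x, 'a) univ_space op set) (\<lambda>z. \<psi> (\<pi> z))"
proof -
  define i where "i = Abs_block_isometry V"
  have i: "Rep_block_isometry i = V" by (simp add: i_def Abs_block_isometry_inverse V(1))
  define \<B> where "\<B> = centralizer \<D> \<psi>"
  have cB: "unital_cstar_algebra \<B>" unfolding \<B>_def by (rule unital_cstar_algebra_centralizer[OF D(1,2)])
  note BD = unital_cstar_algebraD[OF cB]
  have sub: "\<B> \<subseteq> \<D>" by (auto simp: \<B>_def centralizer_def)
  have e: "compress i (univ_e x x' a a') = E x x' a a'" for x x' a a'
    by (simp add: compress_univ_e i V(2))
  have C: "(C_XA :: ('x, 'a) univ_space op set) \<subseteq> {z \<in> block_diag i. compress i z \<in> \<B>}"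
    by (intro C_XA_minimal unital_cstar_algebra_compress_vimage cB)
      (auto simp: univ_e_block_diag e E \<B>_def)
  note CD = unital_cstar_algebraD[OF unital_cstar_algebra_C_XA]
  have mem: "compress i z \<in> \<B>" "z \<in> block_diag i" "z \<in> bop" if "z \<in> C_XA" for z :: "('x, 'a) univ_space op"
    using that C CD(1) by auto
  have hom: "unital_star_hom C_XA \<B> (compress i)"
    unfolding unital_star_hom_def using mem by (auto simp: compress_simps compress_compose(1) compress_adj)
  have st: "state \<D> \<psi>" by (rule D(3))
  have add: "\<psi> (z + w) = \<psi> z + \<psi> w" if "z \<in> \<B>" "w \<in> \<B>" for z w
    using st subsetD[OF sub] that unfolding state_def clinear_on_def by blast
  have scl: "\<psi> (op_scaleC c z) = c * \<psi> z" and pos: "\<psi> (op_adj z o\<^sub>L z) \<in> \<real>\<^sub>\<ge>\<^sub>0" if "z \<in> \<B>" for z c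
    using st subsetD[OF sub] that unfolding state_def clinear_on_def by blast+
  have one: "\<psi> id_blinfun = 1" using st by (simp add: state_def)
  have tr: "\<psi> (z o\<^sub>L w) = \<psi> (w o\<^sub>L z)" if "z \<in> \<B>" "w \<in> \<B>" for z w
    using that subsetD[OF sub that(2)] unfolding \<B>_def centralizer_def by blast
  have "tracial_state \<B> \<psi>"
    unfolding tracial_state_def state_def clinear_on_def using add scl pos one tr by blast
  moreover have "tracial_state (C_XA :: ('x, 'a) univ_space op set) (\<lambda>z. \<psi> (compress i z))"
    unfolding tracial_state_def state_def clinear_on_def
  proof (intro conjI ballI allI)
    fix z w :: "('x, 'a) univ_space op" assume z: "z \<in> C_XA" and w: "w \<in> C_XA"
    note zm = mem[OF z] and wm = mem[OF w]
    show "\<psi> (compress i (z + w)) = \<psi> (compress i z) + \<psi> (compress i w)"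
      by (simp add: compress_simps add zm wm)
    show "\<psi> (compress i (z o\<^sub>L w)) = \<psi> (compress i (w o\<^sub>L z))"
      unfolding compress_compose(1)[OF zm(2)] compress_compose(1)[OF wm(2)] by (rule tr[OF zm(1) wm(1)])
  next
    fix z :: "('x, 'a) univ_space op" assume "z \<in> C_XA"
    note zm = mem[OF this]
    show "\<psi> (compress i (op_scaleC c z)) = c * \<psi> (compress i z)" for c
      by (simp add: compress_simps scl zm)
    show "\<psi> (compress i (op_adj z o\<^sub>L z)) \<in> \<real>\<^sub>\<ge>\<^sub>0"
      by (simp add: compress_compose(2)[OF zm(2)] compress_adj[OF zm(3)] pos zm)
  qed (simp add: compress_simps one)
  ultimately show ?thesis
    using hom e unfolding \<B>_def by blast
qed

lemma vector_state:
  assumes A: "unital_cstar_algebra \<A>" and "norm \<xi> = 1"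
  shows "bounded_hermitian \<A> (\<lambda>T. cinner (app T \<xi>) \<xi>)"
    and "state \<A> (\<lambda>T. cinner (app T \<xi>) \<xi>)"
proof -
  have Ab: "T \<in> bop" if "T \<in> \<A>" for T using that unital_cstar_algebraD(1)[OF A] by blast
  have "cmod (cinner (app T \<xi>) \<xi>) \<le> norm T" for T
    using order_trans[OF norm_cinner_le, of "app T \<xi>" \<xi>] norm_blinfun[of T \<xi>] assms(2) by simp
  moreover have "cinner (app (op_adj T) \<xi>) \<xi> = cnj (cinner (app T \<xi>) \<xi>)" if "T \<in> \<A>" for T
    using cinner_op_adj'[OF Ab[OF that]] cinner_commute by metis
  ultimately show "bounded_hermitian \<A> (\<lambda>T. cinner (app T \<xi>) \<xi>)"
    by (auto simp: bounded_hermitian_def clinear_on_def blinfun.add_left cinner_add_left op_scaleC_apply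
        cinner_scaleC_left)
  show "state \<A> (\<lambda>T. cinner (app T \<xi>) \<xi>)"
    using assms(2)
    by (auto simp: state_def clinear_on_def blinfun.add_left cinner_add_left op_scaleC_apply
        cinner_scaleC_left cinner_op_adj' Ab cinner_self complex_nonneg_Reals_iff)
qed

lemma (in commuting_pair) centralizer_vector_state:
  assumes "defect = 0" and "\<D> \<subseteq> commutant {F y y' b b' | y y' b b'. True}" and "E x x' a a' \<in> \<D>"
  shows "E x x' a a' \<in> centralizer \<D> (\<lambda>T. cinner (app T \<xi>) \<xi>)"
proof -
  have "cinner (app (E x x' a a' o\<^sub>L T) \<xi>) \<xi> = cinner (app (T o\<^sub>L E x x' a a') \<xi>) \<xi>" if "T \<in> \<D>" for T
  proof -
    have "T \<in> commutant {F y y' b b' | y y' b b'. True}" using that assms(2) by blast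
    then have "T \<in> bop" "\<And>y y' b b'. T o\<^sub>L F y y' b b' = F y y' b b' o\<^sub>L T"
      unfolding commutant_def by blast+
    from approx_trace[OF this] show ?thesis using assms(1) by simp
  qed
  then show ?thesis using assms(3) by (auto simp: centralizer_def)
qed

section \<open>Correlation matrices\<close>

lemma munit_tensor_component:
  "(munit a a' \<otimes>\<^sub>m munit b b') $ i $ j = (if fst i = a \<and> fst j = a' \<and> snd i = b \<and> snd j = b' then 1 else 0)"
  by (simp add: mtensor_def munit_def)

lemma mscale_component [simp]: "mscale c T $ i $ j = c * T $ i $ j"
  by (simp add: mscale_def)

lemma sum_munit_component:
  fixes c :: "'a::finite \<Rightarrow> 'a \<Rightarrow> 'b::finite \<Rightarrow> 'b \<Rightarrow> complex"
  shows "(\<Sum>a\<in>UNIV. \<Sum>a'\<in>UNIV. \<Sum>b\<in>UNIV. \<Sum>b'\<in>UNIV. mscale (c a a' b b') (munit a a' \<otimes>\<^sub>m munit b b')) $ i $ j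
    = c (fst i) (fst j) (snd i) (snd j)"
proof -
  have "(\<Sum>a\<in>UNIV. \<Sum>a'\<in>UNIV. \<Sum>b\<in>UNIV. \<Sum>b'\<in>UNIV. mscale (c a a' b b') (munit a a' \<otimes>\<^sub>m munit b b')) $ i $ j
    = (\<Sum>a\<in>UNIV. \<Sum>a'\<in>UNIV. \<Sum>b\<in>UNIV. \<Sum>b'\<in>UNIV. c a a' b b' *
        (if fst i = a \<and> fst j = a' \<and> snd i = b \<and> snd j = b' then 1 else 0))"
    by (simp only: sum_component mscale_component munit_tensor_component)
  also have "\<dots> = (\<Sum>b\<in>UNIV. \<Sum>b'\<in>UNIV. c (fst i) (fst j) b b' * (if snd i = b \<and> snd j = b' then 1 else 0))"
    by (subst sum_UNIV_single2[of "fst i" "fst j"]) auto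
  also have "\<dots> = c (fst i) (fst j) (snd i) (snd j)"
    by (subst sum_UNIV_single2[of "snd i" "snd j"]) auto
  finally show ?thesis .
qed

lemma matrix_eq_sum_munit_iff:
  "T = (\<Sum>a\<in>UNIV. \<Sum>a'\<in>UNIV. \<Sum>b\<in>UNIV. \<Sum>b'\<in>UNIV. mscale (c a a' b b') (munit a a' \<otimes>\<^sub>m munit b b'))
    \<longleftrightarrow> (\<forall>a a' b b'. T $ (a, b) $ (a', b') = c a a' b b')"
  unfolding vec_eq_iff sum_munit_component by auto

definition coef :: "(('x::finite \<times> 'y::finite) cmat \<Rightarrow> ('a::finite \<times> 'b::finite) cmat)
    \<Rightarrow> 'x \<Rightarrow> 'x \<Rightarrow> 'y \<Rightarrow> 'y \<Rightarrow> 'a \<Rightarrow> 'a \<Rightarrow> 'b \<Rightarrow> 'b \<Rightarrow> complex" where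
  "coef \<Gamma> x x' y y' a a' b b' = \<Gamma> (munit x x' \<otimes>\<^sub>m munit y y') $ (a, b) $ (a', b')"

lemma is_trace_correlation_iff:
  "is_trace_correlation \<Gamma> \<tau> \<longleftrightarrow>
    (\<forall>x x' y y' a a' b b'. coef \<Gamma> x x' y y' a a' b b' = \<tau> (univ_e x x' a a' o\<^sub>L univ_e y' y b' b))"
  unfolding is_trace_correlation_def matrix_eq_sum_munit_iff coef_def ..

text \<open>Proportional to \<open>Tr(\<Gamma>(J_X) J_A)\<close>.\<close>

definition score :: "(('x::finite \<times> 'x) cmat \<Rightarrow> ('a::finite \<times> 'a) cmat) \<Rightarrow> complex" where
  "score \<Gamma> = (\<Sum>x\<in>UNIV. \<Sum>x'\<in>UNIV. \<Sum>a\<in>UNIV. \<Sum>a'\<in>UNIV. coef \<Gamma> x x' x x' a a' a a')"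

section \<open>The maximally entangled projection and the value of the correlation on it\<close>

lemma J_proj_component:
  "(J_proj :: ('z::finite \<times> 'z) cmat) $ i $ j = (if fst i = snd i \<and> fst j = snd j then 1 / of_nat CARD('z) else 0)"
proof -
  have "J_proj $ i $ j = (1 / real CARD('z)) *\<^sub>R ((\<Sum>z\<in>UNIV. \<Sum>z'\<in>UNIV. munit (z::'z) z' \<otimes>\<^sub>m munit z z') $ i $ j)"
    by (simp only: J_proj_def vector_scaleR_component)
  also have "(\<Sum>z\<in>UNIV. \<Sum>z'\<in>UNIV. munit (z::'z) z' \<otimes>\<^sub>m munit z z') $ i $ j
      = (\<Sum>z\<in>UNIV. \<Sum>z'\<in>UNIV. (if fst i = z \<and> fst j = z' \<and> snd i = z \<and> snd j = z' then 1 else 0 :: complex))"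
    by (simp only: sum_component munit_tensor_component)
  also have "\<dots> = (if fst i = snd i \<and> fst j = snd j then 1 else 0)"
    by (subst sum_UNIV_single2[of "fst i" "fst j"]) auto
  finally show ?thesis by (simp add: scaleR_conv_of_real)
qed

lemma sum_pairs: "(\<Sum>p\<in>UNIV. f p) = (\<Sum>x\<in>UNIV. \<Sum>y\<in>UNIV. f (x::'a::finite, y::'b::finite))"
  by (simp add: UNIV_Times_UNIV[symmetric] sum.cartesian_product' del: UNIV_Times_UNIV)

lemma J_proj_projection: "(J_proj :: ('z::finite \<times> 'z) cmat) \<in> projections"
proof -
  have "(J_proj ** J_proj :: ('z \<times> 'z) cmat) $ i $ j = J_proj $ i $ j" for i j
  proof -
    have "(\<Sum>x\<in>UNIV. \<Sum>y\<in>UNIV. J_proj $ i $ (x, y) * J_proj $ (x, y) $ j)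
        = (\<Sum>x\<in>(UNIV::'z set). J_proj $ i $ j / of_nat CARD('z))"
      by (intro sum.cong refl, subst sum_UNIV_single) (auto simp: J_proj_component)
    then show ?thesis by (simp add: matrix_matrix_mult_def sum_pairs)
  qed
  then show ?thesis
    by (auto simp: projections_def vec_eq_iff madj_def J_proj_component)
qed

lemma trace_J_proj: "trace (J_proj :: ('z::finite \<times> 'z) cmat) = 1"
proof -
  have "(\<Sum>x\<in>UNIV. \<Sum>y\<in>UNIV. (J_proj :: ('z \<times> 'z) cmat) $ (x, y) $ (x, y)) = (\<Sum>x\<in>(UNIV::'z set). 1 / of_nat CARD('z))"
    by (intro sum.cong refl, subst sum_UNIV_single) (auto simp: J_proj_component)
  then show ?thesis by (simp add: trace_def sum_pairs)
qed

lemma trace_mult_J_proj: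
  fixes T :: "('z::finite \<times> 'z) cmat"
  shows "trace (T ** J_proj) = (\<Sum>a\<in>UNIV. \<Sum>a'\<in>UNIV. T $ (a, a) $ (a', a')) / of_nat CARD('z)"
proof -
  have "trace (T ** J_proj) = (\<Sum>a\<in>UNIV. \<Sum>b\<in>UNIV. \<Sum>a'\<in>UNIV. \<Sum>b'\<in>UNIV. T $ (a, b) $ (a', b') * J_proj $ (a', b') $ (a, b))"
    by (simp add: trace_def matrix_matrix_mult_def sum_pairs)
  also have "\<dots> = (\<Sum>a\<in>UNIV. \<Sum>a'\<in>UNIV. T $ (a, a) $ (a', a') / of_nat CARD('z))"
  proof (rule sum.cong[OF refl])
    fix a
    have "(\<Sum>b\<in>UNIV. \<Sum>a'\<in>UNIV. \<Sum>b'\<in>UNIV. T $ (a, b) $ (a', b') * J_proj $ (a', b') $ (a, b))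
        = (\<Sum>a'\<in>UNIV. \<Sum>b'\<in>UNIV. T $ (a, a) $ (a', b') * J_proj $ (a', b') $ (a, a))"
      by (rule sum_UNIV_single) (simp add: J_proj_component)
    also have "\<dots> = (\<Sum>a'\<in>UNIV. T $ (a, a) $ (a', a') / of_nat CARD('z))"
    proof (rule sum.cong[OF refl])
      fix a'
      have "(\<Sum>b'\<in>UNIV. T $ (a, a) $ (a', b') * J_proj $ (a', b') $ (a, a))
          = T $ (a, a) $ (a', a') * J_proj $ (a', a') $ (a, a)"
        by (rule sum_UNIV_single) (simp add: J_proj_component)
      then show "(\<Sum>b'\<in>UNIV. T $ (a, a) $ (a', b') * J_proj $ (a', b') $ (a, a))
          = T $ (a, a) $ (a', a') / of_nat CARD('z)"
        by (simp add: J_proj_component)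
    qed
    finally show "(\<Sum>b\<in>UNIV. \<Sum>a'\<in>UNIV. \<Sum>b'\<in>UNIV. T $ (a, b) $ (a', b') * J_proj $ (a', b') $ (a, b))
        = (\<Sum>a'\<in>UNIV. T $ (a, a) $ (a', a') / of_nat CARD('z))" .
  qed
  finally show ?thesis by (simp add: sum_divide_distrib)
qed

lemma scaleR_eq_mscale: "r *\<^sub>R S = mscale (of_real r) S"
  unfolding vec_eq_iff by (simp only: vector_scaleR_component mscale_component) (simp add: scaleR_conv_of_real)

lemma matrix_clinear_scaleR: "matrix_clinear \<Gamma> \<Longrightarrow> \<Gamma> (r *\<^sub>R T) = r *\<^sub>R \<Gamma> T"
  by (simp add: matrix_clinear_def scaleR_eq_mscale)

lemma matrix_clinear_sum:
  assumes "matrix_clinear \<Gamma>"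
  shows "\<Gamma> (\<Sum>i\<in>I. f i) = (\<Sum>i\<in>I. \<Gamma> (f i))"
proof -
  have "\<Gamma> 0 = 0" using matrix_clinear_scaleR[OF assms, of 0 0] by simp
  then show ?thesis
    using assms by (induction I rule: infinite_finite_induct) (auto simp: matrix_clinear_def)
qed

lemma trace_mult_mat_1_minus: "trace (S ** (mat 1 - T)) = trace S - trace (S ** (T :: 'z::finite cmat))"
proof -
  have "S ** (mat 1 - T) = S ** mat 1 - S ** T"
    by (simp add: vec_eq_iff matrix_matrix_mult_def algebra_simps sum_subtractf)
  then show ?thesis by (simp add: trace_sub)
qed

text \<open>Perfectness at \<open>J_proj\<close>, with trace preservation, says that the trace of
  \<open>\<Gamma> J_proj ** J_proj\<close> is 1. The factors |X| and |A| clear the normalisations of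
  the two projections.\<close>

lemma perfect_score:
  fixes \<phi> \<Gamma> :: "('x::finite \<times> 'x) cmat \<Rightarrow> ('a::finite \<times> 'a) cmat"
  assumes "QNS_correlation \<Gamma>" "concurrent \<phi>" "perfect_strategy \<phi> \<Gamma>"
  shows "score \<Gamma> = of_nat CARD('x) * of_nat CARD('a)"
proof -
  have lin: "matrix_clinear \<Gamma>" and tr: "\<And>T. trace (\<Gamma> T) = trace T"
    using assms(1) by (auto simp: QNS_correlation_def quantum_channel_def completely_positive_def)
  have "trace (\<Gamma> J_proj ** (mat 1 - \<phi> J_proj)) = 0"
    using assms(3) J_proj_projection unfolding perfect_strategy_def by blast
  then have "0 = trace (\<Gamma> J_proj ** (mat 1 - J_proj))"
    using assms(2) by (simp add: concurrent_def)
  also have "\<dots> = trace (\<Gamma> J_proj) - trace (\<Gamma> J_proj ** J_proj)"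
    by (rule trace_mult_mat_1_minus)
  finally have "trace (\<Gamma> J_proj ** J_proj) = 1" by (simp add: tr trace_J_proj)
  then have S: "(\<Sum>a\<in>UNIV. \<Sum>a'\<in>UNIV. \<Gamma> J_proj $ (a, a) $ (a', a')) = of_nat CARD('a)"
    by (simp add: trace_mult_J_proj divide_eq_1_iff)
  have G: "\<Gamma> J_proj $ (a, a) $ (a', a') = (1 / of_nat CARD('x)) * (\<Sum>x\<in>UNIV. \<Sum>x'\<in>UNIV. coef \<Gamma> x x' x x' a a' a a')" for a a'
    unfolding J_proj_def matrix_clinear_scaleR[OF lin] matrix_clinear_sum[OF lin] coef_def
    by (simp only: scaleR_eq_mscale mscale_component sum_component) simp
  have "(1 / of_nat CARD('x)) * (\<Sum>a\<in>UNIV. \<Sum>a'\<in>UNIV. \<Sum>x\<in>UNIV. \<Sum>x'\<in>UNIV. coef \<Gamma> x x' x x' a a' a a')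
      = of_nat CARD('a)"
    using S unfolding G sum_distrib_left .
  then have "(\<Sum>a\<in>UNIV. \<Sum>a'\<in>UNIV. \<Sum>x\<in>UNIV. \<Sum>x'\<in>UNIV. coef \<Gamma> x x' x x' a a' a a')
      = of_nat CARD('x) * of_nat CARD('a)"
    by (simp add: field_simps)
  then show ?thesis unfolding score_def by (subst sum_swap22)
qed

lemma (in commuting_pair) defect_eq_score:
  assumes "\<And>x x' y y' a a' b b'. coef \<Gamma> x x' y y' a a' b b' = cinner (app (E x x' a a' o\<^sub>L F y y' b b') \<xi>) \<xi>"
  shows "defect = sqrt (2 * (real CARD('x) * real CARD('a) - Re (score \<Gamma>)))"
  unfolding defect_def score_def assms ..

lemma (in commuting_pair) coef_of_defect_0:
  assumes "\<And>x x' y y' a a' b b'. coef \<Gamma> x x' y y' a a' b b' = cinner (app (E x x' a a' o\<^sub>L F y y' b b') \<xi>) \<xi>"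
    and "defect = 0"
  shows "coef \<Gamma> x x' y y' a a' b b' = cinner (app (E x x' a a' o\<^sub>L E y' y b' b) \<xi>) \<xi>"
  using approx_correlation[of x x' a a' y y' b b'] assms by simp

text \<open>The algebra \<D> may be any one between the entries of E and the commutant of F. The
  whole commutant serves in general, and a commutative choice makes the target \<B> commutative for
  local correlations.\<close>

lemma commuting_pair_trace:
  fixes E F :: "'x::finite \<Rightarrow> 'x \<Rightarrow> 'a::finite \<Rightarrow> 'a \<Rightarrow> ell2 op"
  assumes "commuting_pair E F \<xi>"
    and coef: "\<And>x x' y y' a a' b b'. coef \<Gamma> x x' y y' a a' b b' = cinner (app (E x x' a a' o\<^sub>L F y y' b b') \<xi>) \<xi>"
    and score: "score \<Gamma> = of_nat CARD('x) * of_nat CARD('a)"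
    and D: "unital_cstar_algebra \<D>" "\<D> \<subseteq> commutant {F y y' b b' | y y' b b'. True}" "\<And>x x' a a'. E x x' a a' \<in> \<D>"
  shows "\<exists>\<B> \<pi> \<psi>. \<B> \<subseteq> \<D> \<and> unital_cstar_algebra \<B> \<and> unital_star_hom C_XA \<B> \<pi> \<and> tracial_state \<B> \<psi> \<and>
    tracial_state C_XA (\<lambda>z. \<psi> (\<pi> z)) \<and> is_trace_correlation \<Gamma> (\<lambda>z. \<psi> (\<pi> z))"
proof -
  interpret commuting_pair E F \<xi> by (rule assms(1))
  define \<psi> where "\<psi> T = cinner (app T \<xi>) \<xi>" for T
  have defect: "defect = 0" using defect_eq_score[OF coef] score by simp
  obtain V where V: "is_block_isometry V" "\<And>x x' a a'. op_adj (V a x) o\<^sub>L V a' x' = E x x' a a'"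
    using ex_block_isometry_factor[OF E.stochastic] by blast
  note vs = vector_state[OF D(1) norm_xi, folded \<psi>_def]
  have "E x x' a a' \<in> centralizer \<D> \<psi>" for x x' a a'
    unfolding \<psi>_def by (rule centralizer_vector_state[OF defect D(2,3)])
  from trace_through_compress[OF V D(1) vs this] obtain \<pi> where
    \<pi>: "unital_star_hom C_XA (centralizer \<D> \<psi>) \<pi>" "\<And>x x' a a'. \<pi> (univ_e x x' a a') = E x x' a a'"
    "tracial_state (centralizer \<D> \<psi>) \<psi>" "tracial_state C_XA (\<lambda>z. \<psi> (\<pi> z))" by blast
  have "\<pi> (univ_e x x' a a' o\<^sub>L univ_e y' y b' b) = E x x' a a' o\<^sub>L E y' y b' b" for x x' a a' y y' b b'
    using \<pi>(1,2) univ_e_C_XA[where 'x = 'x and 'a = 'a] by (simp add: unital_star_hom_def)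
  then have "is_trace_correlation \<Gamma> (\<lambda>z. \<psi> (\<pi> z))"
    unfolding is_trace_correlation_iff by (simp add: coef_of_defect_0[OF coef defect] \<psi>_def)
  moreover have "centralizer \<D> \<psi> \<subseteq> \<D>" by (auto simp: centralizer_def)
  ultimately show ?thesis using \<pi> unital_cstar_algebra_centralizer[OF D(1) vs(1)] by blast
qed

lemma quantum_commuting_trace:
  fixes \<Gamma> :: "('x::finite \<times> 'x) cmat \<Rightarrow> ('a::finite \<times> 'a) cmat"
  assumes "quantum_commuting TYPE('h::chilbert_space) \<Gamma>"
    and score: "score \<Gamma> = of_nat CARD('x) * of_nat CARD('a)"
  shows "\<exists>\<tau>. tracial_state C_XA \<tau> \<and> is_trace_correlation \<Gamma> \<tau>"
proof -
  obtain \<xi> :: 'h and E F where "norm \<xi> = 1" "stochastic_operator_matrix E" "stochastic_operator_matrix F"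
    "\<And>x x' a a' y y' b b'. E x x' a a' o\<^sub>L F y y' b b' = F y y' b b' o\<^sub>L E x x' a a'"
    and \<Gamma>: "\<And>x x' y y'. \<Gamma> (munit x x' \<otimes>\<^sub>m munit y y') =
           (\<Sum>a\<in>UNIV. \<Sum>a'\<in>UNIV. \<Sum>b\<in>UNIV. \<Sum>b'\<in>UNIV.
              mscale (cinner (app (E x x' a a' o\<^sub>L F y y' b b') \<xi>) \<xi>)
                (munit a a' \<otimes>\<^sub>m munit b b'))"
    using assms(1) unfolding quantum_commuting_def by blast
  then interpret commuting_pair E F \<xi> by unfold_locales
  have \<Gamma>': "coef \<Gamma> x x' y y' a a' b b' = cinner (app (E x x' a a' o\<^sub>L F y y' b b') \<xi>) \<xi>" for x x' y y' a a' b b'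
    using \<Gamma>[unfolded matrix_eq_sum_munit_iff] by (simp add: coef_def)
  obtain E' F' :: "'x \<Rightarrow> 'x \<Rightarrow> 'a \<Rightarrow> 'a \<Rightarrow> ell2 op" and \<xi>' where cp: "commuting_pair E' F' \<xi>'"
    and c: "\<And>x x' a a' y y' b b'. cinner (app (E' x x' a a' o\<^sub>L F' y y' b b') \<xi>') \<xi>'
        = cinner (app (E x x' a a' o\<^sub>L F y y' b b') \<xi>) \<xi>"
    using ex_ell2_pair by blast
  interpret ell2: commuting_pair E' F' \<xi>' by (rule cp)
  let ?D = "commutant {F' y y' b b' | y y' b b'. True}"
  have "unital_cstar_algebra ?D"
    by (rule unital_cstar_algebra_commutant) (auto simp: ell2.F.bop, metis ell2.F.op_adj_E)
  moreover have "E' x x' a a' \<in> ?D" for x x' a a'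
    by (auto simp: commutant_def ell2.E.bop ell2.commute)
  moreover have "coef \<Gamma> x x' y y' a a' b b' = cinner (app (E' x x' a a' o\<^sub>L F' y y' b b') \<xi>') \<xi>'"
    for x x' y y' a a' b b' by (simp only: \<Gamma>' c)
  ultimately show ?thesis
    using commuting_pair_trace[OF cp _ score, of ?D] by blast
qed

section \<open>Amplifications and direct sums\<close>

lemma has_sum_sum:
  fixes f :: "'i \<Rightarrow> 'j \<Rightarrow> 'b::{topological_comm_monoid_add}"
  assumes "\<And>i. i \<in> I \<Longrightarrow> (f i has_sum s i) A"
  shows "((\<lambda>j. \<Sum>i\<in>I. f i j) has_sum (\<Sum>i\<in>I. s i)) A"
  using assms by (induction I rule: infinite_finite_induct) (auto intro: has_sum_add)

lemma has_sum_nonneg_Reals: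
  fixes f :: "'i \<Rightarrow> complex"
  assumes "(f has_sum s) A" "\<And>i. i \<in> A \<Longrightarrow> f i \<in> \<real>\<^sub>\<ge>\<^sub>0"
  shows "s \<in> \<real>\<^sub>\<ge>\<^sub>0"
proof (rule Lim_in_closed_set[OF closed_nonneg_Reals_complex])
  show "(sum f \<longlongrightarrow> s) (finite_subsets_at_top A)" using assms(1) by (simp add: has_sum_def)
  show "\<forall>\<^sub>F F in finite_subsets_at_top A. sum f F \<in> \<real>\<^sub>\<ge>\<^sub>0"
    by (rule eventually_finite_subsets_at_top_weakI) (auto intro!: sum_nonneg_Reals assms(2))
qed simp

lemma has_sum_cinner_hsum:
  "((\<lambda>i. cinner (app (proj i) f) (app (proj i) g)) has_sum cinner f g) UNIV"
  unfolding cinner_hsum_def hsum_cinner_def proj_apply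
  by (intro has_sum_infsum sq_summable_cinner sq_summable_Rep)

lemma stochastic_diag_op:
  fixes E :: "'i \<Rightarrow> 'x::finite \<Rightarrow> 'x \<Rightarrow> 'a::finite \<Rightarrow> 'a \<Rightarrow> 'h::chilbert_space op"
  assumes "\<And>i. stochastic_operator_matrix (E i)" "\<And>i x x' a a'. norm (E i x x' a a') \<le> B"
  shows "stochastic_operator_matrix (\<lambda>x x' a a'. diag_op (\<lambda>i. E i x x' a a'))"
proof -
  interpret E: stochastic "E i" for i by standard (rule assms(1))
  note p = diag_op_proj[OF assms(2)]
  show ?thesis
    unfolding stochastic_operator_matrix_iff psd_op_matrix_def
  proof (intro conjI allI)
    show "diag_op (\<lambda>i. E i x x' a a') \<in> bop" for x x' a a'
      by (intro diag_op_bop[OF assms(2)] E.bop)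
    show "(\<Sum>a\<in>UNIV. diag_op (\<lambda>i. E i x x' a a)) = (if x = x' then id_blinfun else 0)" for x x'
    proof (intro blinfun_eqI hsum_eq_proj)
      fix f i
      have "app (proj i) (app (\<Sum>a\<in>UNIV. diag_op (\<lambda>i. E i x x' a a)) f)
          = app (\<Sum>a\<in>UNIV. E i x x' a a) (app (proj i) f)"
        by (simp add: blinfun.sum_left blinfun.sum_right p)
      then show "app (proj i) (app (\<Sum>a\<in>UNIV. diag_op (\<lambda>i. E i x x' a a)) f)
          = app (proj i) (app (if x = x' then id_blinfun else 0) f)"
        by (simp add: E.sum_diag)
    qed
    fix h :: "'x \<times> 'a \<Rightarrow> ('i, 'h) hsum"
    show "(\<Sum>p\<in>UNIV. \<Sum>q\<in>UNIV. cinner (app (diag_op (\<lambda>i. flat (E i) p q)) (h q)) (h p)) \<in> \<real>\<^sub>\<ge>\<^sub>0"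
    proof (rule has_sum_nonneg_Reals)
      show "((\<lambda>i. \<Sum>p\<in>UNIV. \<Sum>q\<in>UNIV. cinner (app (proj i) (app (diag_op (\<lambda>i. flat (E i) p q)) (h q)))
          (app (proj i) (h p))) has_sum
          (\<Sum>p\<in>UNIV. \<Sum>q\<in>UNIV. cinner (app (diag_op (\<lambda>i. flat (E i) p q)) (h q)) (h p))) UNIV"
        by (intro has_sum_sum has_sum_cinner_hsum)
      show "(\<Sum>p\<in>UNIV. \<Sum>q\<in>UNIV. cinner (app (proj i) (app (diag_op (\<lambda>i. flat (E i) p q)) (h q)))
          (app (proj i) (h p))) \<in> \<real>\<^sub>\<ge>\<^sub>0" for i
        using E.psd[of i] unfolding p psd_op_matrix_def by simp
    qed
  qed
qed

section \<open>Local correlations\<close>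

text \<open>The Choi matrix of the channel, its entries read as operators on the space of complex
  numbers.\<close>

lemma channel_stochastic:
  fixes \<Phi> :: "'x::finite cmat \<Rightarrow> 'a::finite cmat"
  assumes "quantum_channel \<Phi>"
  shows "stochastic_operator_matrix (\<lambda>x x' a a'. op_scaleC (\<Phi> (munit x x') $ a $ a') (id_blinfun :: complex op))"
  unfolding stochastic_operator_matrix_def
proof (intro conjI allI)
  show "op_scaleC (\<Phi> (munit x x') $ a $ a') (id_blinfun :: complex op) \<in> bop" for x x' a a'
    by (intro bop_intros)
  have lin: "matrix_clinear \<Phi>" and tr: "trace (\<Phi> T) = trace T" for T
    using assms by (auto simp: quantum_channel_def completely_positive_def)
  show "(\<Sum>a\<in>UNIV. op_scaleC (\<Phi> (munit x x') $ a $ a) (id_blinfun :: complex op)) = (if x = x' then id_blinfun else 0)"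
    for x x'
  proof -
    have "(\<Sum>a\<in>UNIV. \<Phi> (munit x x') $ a $ a) = trace (munit x x' :: 'x cmat)"
      using tr[of "munit x x'"] by (simp add: trace_def)
    also have "\<dots> = (if x = x' then 1 else 0)"
      unfolding trace_def by (subst sum_UNIV_single[of x]) (auto simp: munit_def)
    finally show ?thesis
      by (intro blinfun_eqI) (simp add: blinfun.sum_left op_scaleC_apply scaleC_complex_def sum_distrib_right[symmetric])
  qed
  fix h :: "'x \<Rightarrow> 'a \<Rightarrow> complex"
  let ?n = "CARD('x)"
  \<comment> \<open>\<open>block_psd\<close> is indexed by natural numbers, hence an enumeration of
    the input set.\<close>
  obtain e :: "nat \<Rightarrow> 'x" where e: "bij_betw e {..<?n} UNIV"
    using ex_bij_betw_nat_finite[of "UNIV :: 'x set"] by (auto simp: atLeast0LessThan)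
  \<comment> \<open>This block matrix is the unnormalised maximally entangled state; its form is the
    squared modulus of one sum.\<close>
  have "block_psd ?n (\<lambda>i j. munit (e i) (e j))"
    unfolding block_psd_def
  proof
    fix v :: "nat \<Rightarrow> complex ^ 'x"
    have "(\<Sum>z\<in>UNIV. (munit (e i) (e j) *v v j) $ z * cnj (v i $ z)) = v j $ e j * cnj (v i $ e i)" for i j
    proof (subst sum_UNIV_single[of "e i"])
      show "(munit (e i) (e j) *v v j) $ z * cnj (v i $ z) = 0" if "z \<noteq> e i" for z
        using that by (simp add: matrix_vector_mult_def munit_def)
      have "(munit (e i) (e j) *v v j) $ e i = v j $ e j"
        unfolding matrix_vector_mult_def by (simp, subst sum_UNIV_single[of "e j"]) (auto simp: munit_def)
      then show "(munit (e i) (e j) *v v j) $ e i * cnj (v i $ e i) = v j $ e j * cnj (v i $ e i)" by simp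
    qed
    then have "(\<Sum>i<?n. \<Sum>j<?n. \<Sum>z\<in>UNIV. (munit (e i) (e j) *v v j) $ z * cnj (v i $ z))
        = (\<Sum>j<?n. v j $ e j) * cnj (\<Sum>i<?n. v i $ e i)"
      by (simp add: sum_distrib_left sum_distrib_right)
    also have "\<dots> = complex_of_real ((cmod (\<Sum>j<?n. v j $ e j))\<^sup>2)" by (rule complex_norm_square[symmetric])
    finally show "(\<Sum>i<?n. \<Sum>j<?n. \<Sum>z\<in>UNIV. (munit (e i) (e j) *v v j) $ z * cnj (v i $ z)) \<in> \<real>\<^sub>\<ge>\<^sub>0"
      by simp
  qed
  then have "block_psd ?n (\<lambda>i j. \<Phi> (munit (e i) (e j)))"
    using assms by (auto simp: quantum_channel_def completely_positive_def)
  then have "(\<Sum>i<?n. \<Sum>j<?n. \<Sum>a\<in>UNIV. (\<Phi> (munit (e i) (e j)) *v (\<chi> a. h (e j) a)) $ a * cnj ((\<chi> a. h (e i) a) $ a)) \<in> \<real>\<^sub>\<ge>\<^sub>0"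
    unfolding block_psd_def by (rule allE)
  also have "(\<Sum>i<?n. \<Sum>j<?n. \<Sum>a\<in>UNIV. (\<Phi> (munit (e i) (e j)) *v (\<chi> a. h (e j) a)) $ a * cnj ((\<chi> a. h (e i) a) $ a))
      = (\<Sum>x\<in>UNIV. \<Sum>x'\<in>UNIV. \<Sum>a\<in>UNIV. (\<Phi> (munit x x') *v (\<chi> a. h x' a)) $ a * cnj ((\<chi> a. h x a) $ a))"
    using sum.reindex_bij_betw[OF e] by (simp add: sum.reindex_bij_betw[OF e, symmetric])
  also have "\<dots> = (\<Sum>x\<in>UNIV. \<Sum>x'\<in>UNIV. \<Sum>a\<in>UNIV. \<Sum>a'\<in>UNIV.
      cinner (app (op_scaleC (\<Phi> (munit x x') $ a $ a') id_blinfun) (h x' a')) (h x a))"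
    by (simp add: matrix_vector_mult_def op_scaleC_apply scaleC_complex_def cinner_complex_def sum_distrib_right)
  finally show "(\<Sum>x\<in>UNIV. \<Sum>x'\<in>UNIV. \<Sum>a\<in>UNIV. \<Sum>a'\<in>UNIV.
      cinner (app (op_scaleC (\<Phi> (munit x x') $ a $ a') id_blinfun) (h x' a')) (h x a)) \<in> \<real>\<^sub>\<ge>\<^sub>0" .
qed

text \<open>Written as a commutant so that the C*-algebra structure is immediate; commutativity is
  then read off the basis vectors.\<close>

definition diagonal :: "ell2 op set" where
  "diagonal = commutant {kb n n | n. True}"

lemma unital_cstar_algebra_diagonal: "unital_cstar_algebra diagonal"
  unfolding diagonal_def by (rule unital_cstar_algebra_commutant) (auto simp: kb_bop kb_adj)

lemma diagonal_ket:
  assumes "T \<in> diagonal"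
  shows "\<exists>c. app T (ket n) = c *\<^sub>C ket n"
proof -
  have "T \<in> block_diag n" using assms by (auto simp: diagonal_def block_diag_def commutant_def)
  then show ?thesis by (subst block_diag_emb) (auto simp: emb_complex[of n "app _ _"])
qed

lemma abelian_diagonal: "abelian diagonal"
  unfolding abelian_def
proof (intro ballI)
  fix S T :: "ell2 op" assume S: "S \<in> diagonal" and T: "T \<in> diagonal"
  have b: "clin S" "clin T" using S T by (auto simp: diagonal_def commutant_def bop_iff_clin)
  show "S o\<^sub>L T = T o\<^sub>L S"
  proof (intro blinfun_ell2_eqI clin_compose b)
    fix n
    obtain c d where "app S (ket n) = c *\<^sub>C ket n" "app T (ket n) = d *\<^sub>C ket n"
      using diagonal_ket[OF S] diagonal_ket[OF T] by blast
    then show "app (S o\<^sub>L T) (ket n) = app (T o\<^sub>L S) (ket n)"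
      by (simp add: clinD b scaleC_scaleC mult.commute)
  qed
qed

text \<open>The convex combination becomes one vector state: the i-th channels act on the i-th
  coordinate, whose amplitude is the root of the weight.\<close>

lemma local_correlation_trace:
  fixes \<Gamma> :: "('x::finite \<times> 'x) cmat \<Rightarrow> ('a::finite \<times> 'a) cmat"
  assumes "local_correlation \<Gamma>"
    and score: "score \<Gamma> = of_nat CARD('x) * of_nat CARD('a)"
  shows "\<exists>\<tau>. tracial_state C_XA \<tau> \<and> is_trace_correlation \<Gamma> \<tau> \<and> factors_through abelian C_XA \<tau>"
proof -
  obtain k p \<Phi> \<Psi> where ch: "\<And>i. i < (k::nat) \<Longrightarrow> 0 \<le> p i \<and> quantum_channel (\<Phi> i) \<and> quantum_channel (\<Psi> i)"
    and p1: "(\<Sum>i<k. p i) = (1::real)"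
    and \<Gamma>: "\<And>S T. \<Gamma> (S \<otimes>\<^sub>m T) = (\<Sum>i<k. p i *\<^sub>R (\<Phi> i S \<otimes>\<^sub>m \<Psi> i T))"
    using assms(1) unfolding local_correlation_def by blast
  \<comment> \<open>Coordinates beyond the k channels repeat channel 0, so that every diagonal entry
    is stochastic; \<xi> has no component there.\<close>
  define idx where "idx n = (if n < k then n else 0)" for n
  have "k > 0" using p1 by (cases k) auto
  then have idx: "idx n < k" for n by (simp add: idx_def)
  define D where "D \<Phi> x x' a a' = diag_op (\<lambda>n. op_scaleC (\<Phi> (idx n) (munit x x') $ a $ a') (id_blinfun :: complex op))"
    for \<Phi> :: "nat \<Rightarrow> 'x cmat \<Rightarrow> 'a cmat" and x x' a a'
  have bnd: "\<exists>B. \<forall>n x x' a a'. norm (op_scaleC (\<Phi> (idx n) (munit x x') $ a $ a') (id_blinfun :: complex op)) \<le> B"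
    for \<Phi> :: "nat \<Rightarrow> 'x cmat \<Rightarrow> 'a cmat"
  proof -
    \<comment> \<open>Finitely many channels and entries give one bound for all coordinates, as
      \<open>diag_op\<close> requires.\<close>
    let ?N = "\<lambda>(i, x, x', a, a'). norm (op_scaleC (\<Phi> i (munit x x') $ a $ a') (id_blinfun :: complex op))"
    have "?N (idx n, x, x', a, a') \<le> Max (?N ` ({..<k} \<times> UNIV))" for n x x' a a'
    proof (rule Max_ge)
      show "?N (idx n, x, x', a, a') \<in> ?N ` ({..<k} \<times> UNIV)"
        by (rule imageI) (simp add: idx)
    qed simp
    then show ?thesis by auto
  qed
  have st: "stochastic_operator_matrix (D \<Phi>)" and dg: "D \<Phi> x x' a a' \<in> diagonal"
    and ap: "app (D \<Phi> x x' a a') (ket i) = (\<Phi> i (munit x x') $ a $ a') *\<^sub>C ket i \<or> \<not> i < k"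
    if "\<And>i. i < k \<Longrightarrow> quantum_channel (\<Phi> i)" for \<Phi> x x' a a' i
  proof -
    obtain B where B: "\<And>n x x' a a'. norm (op_scaleC (\<Phi> (idx n) (munit x x') $ a $ a') (id_blinfun :: complex op)) \<le> B"
      using bnd[of \<Phi>] by blast
    show "stochastic_operator_matrix (D \<Phi>)"
      unfolding D_def by (rule stochastic_diag_op[OF channel_stochastic[OF that[OF idx]] B])
    have "D \<Phi> x x' a a' \<in> block_diag n" for n
      unfolding D_def by (rule diag_op_block_diag[OF B]) (intro bop_intros)
    then show "D \<Phi> x x' a a' \<in> diagonal"
      by (auto simp: diagonal_def block_diag_def commutant_def)
    show "app (D \<Phi> x x' a a') (ket i) = (\<Phi> i (munit x x') $ a $ a') *\<^sub>C ket i \<or> \<not> i < k"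
      unfolding D_def diag_op_emb[OF B] op_scaleC_apply
      by (simp add: idx_def clinD[OF clin_emb])
  qed
  define \<xi> :: ell2 where "\<xi> = (\<Sum>i<k. complex_of_real (sqrt (p i)) *\<^sub>C ket i)"
  have cp: "commuting_pair (D \<Phi>) (D \<Psi>) \<xi>"
  proof unfold_locales
    show "stochastic_operator_matrix (D \<Phi>)" "stochastic_operator_matrix (D \<Psi>)" using st ch by auto
    show "D \<Phi> x x' a a' o\<^sub>L D \<Psi> y y' b b' = D \<Psi> y y' b b' o\<^sub>L D \<Phi> x x' a a'" for x x' a a' y y' b b'
      using abelian_diagonal dg ch by (auto simp: abelian_def)
    have "complex_of_real ((norm \<xi>)\<^sup>2) = (\<Sum>i<k. complex_of_real (p i))"
      unfolding cinner_self[symmetric] \<xi>_def cinner_sum_ket using ch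
      by (intro sum.cong) (auto simp flip: of_real_mult)
    also have "\<dots> = 1" unfolding of_real_sum[symmetric] p1 by simp
    finally have "(norm \<xi>)\<^sup>2 = 1\<^sup>2" by (simp only: of_real_eq_1_iff) simp
    then show "norm \<xi> = 1" by (rule power2_eq_imp_eq) auto
  qed
  moreover have "coef \<Gamma> x x' y y' a a' b b' = cinner (app (D \<Phi> x x' a a' o\<^sub>L D \<Psi> y y' b b') \<xi>) \<xi>"
    for x x' y y' a a' b b'
  proof -
    have bp: "D \<Phi> x x' a a' \<in> bop" "D \<Psi> y y' b b' \<in> bop"
      using dg ch by (auto simp: diagonal_def commutant_def)
    have ap\<Phi>: "app (D \<Phi> x x' a a') (ket i) = (\<Phi> i (munit x x') $ a $ a') *\<^sub>C ket i"
      and ap\<Psi>: "app (D \<Psi> y y' b b') (ket i) = (\<Psi> i (munit y y') $ b $ b') *\<^sub>C ket i" if "i < k" for i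
      using ap[of \<Phi> x x' a a' i] ap[of \<Psi> y y' b b' i] ch that by auto
    have "app (D \<Phi> x x' a a' o\<^sub>L D \<Psi> y y' b b') \<xi>
        = (\<Sum>i<k. (complex_of_real (sqrt (p i)) * \<Phi> i (munit x x') $ a $ a' * \<Psi> i (munit y y') $ b $ b') *\<^sub>C ket i)"
      unfolding \<xi>_def
      by (simp add: blinfun.sum_right bopD[OF bp(1)] bopD[OF bp(2)], intro sum.cong refl)
        (simp add: ap\<Phi> ap\<Psi> bopD[OF bp(1)] scaleC_scaleC mult_ac)
    then have "cinner (app (D \<Phi> x x' a a' o\<^sub>L D \<Psi> y y' b b') \<xi>) \<xi>
        = (\<Sum>i<k. complex_of_real (sqrt (p i)) * \<Phi> i (munit x x') $ a $ a' * \<Psi> i (munit y y') $ b $ b' * complex_of_real (sqrt (p i)))"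
      by (simp add: \<xi>_def cinner_sum_ket)
    also have "\<dots> = (\<Sum>i<k. complex_of_real (sqrt (p i) * sqrt (p i)) * (\<Phi> i (munit x x') $ a $ a' * \<Psi> i (munit y y') $ b $ b'))"
      by (simp only: of_real_mult mult_ac)
    also have "\<dots> = coef \<Gamma> x x' y y' a a' b b'"
      unfolding coef_def \<Gamma> using ch
      by (simp only: sum_component scaleR_eq_mscale mscale_component, intro sum.cong) (auto simp: mtensor_def)
    finally show ?thesis by simp
  qed
  moreover have "diagonal \<subseteq> commutant {D \<Psi> y y' b b' | y y' b b'. True}"
    using abelian_diagonal dg[of \<Psi>] ch by (auto simp: abelian_def commutant_def diagonal_def)
  moreover have "D \<Phi> x x' a a' \<in> diagonal" for x x' a a' using dg[of \<Phi>] ch by auto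
  ultimately obtain \<B> \<pi> \<psi> where B: "\<B> \<subseteq> diagonal" "unital_cstar_algebra \<B>" "unital_star_hom C_XA \<B> \<pi>" "tracial_state \<B> \<psi>"
    "tracial_state C_XA (\<lambda>z. \<psi> (\<pi> z))" "is_trace_correlation \<Gamma> (\<lambda>z. \<psi> (\<pi> z))"
    using commuting_pair_trace[OF _ _ score unital_cstar_algebra_diagonal, of "D \<Phi>" "D \<Psi>" \<xi>] by blast
  moreover have "abelian \<B>" using B(1) abelian_diagonal by (auto simp: abelian_def)
  ultimately show ?thesis unfolding factors_through_def by blast
qed

section \<open>Finite dimensional operator matrices\<close>

text \<open>T tensor 1: the direct sum of copies plays the tensor product, with the second factor as
  its index. Scalar matrices acting on the index, as in \<open>fd_op\<close>, are the operators 1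
  tensor M and commute with these.\<close>

abbreviation amp :: "'h::chilbert_space op \<Rightarrow> (nat, 'h) hsum op" where
  "amp T \<equiv> diag_op (\<lambda>_. T)"

lemma amp_proj: "app (proj i) (app (amp T) f) = app T (app (proj i) f)"
  by (rule diag_op_proj) (rule order_refl)

lemma amp_bop: "T \<in> bop \<Longrightarrow> amp T \<in> bop"
  by (rule diag_op_bop) auto

lemma amp_simps:
  "amp (S + T) = amp S + amp T" "amp (S o\<^sub>L T) = amp S o\<^sub>L amp T" "amp id_blinfun = id_blinfun"
  "amp (op_scaleC c T) = op_scaleC c (amp T)"
  by (auto intro!: blinfun_eqI hsum_eq_proj
      simp: amp_proj blinfun.add_left blinfun.add_right op_scaleC_apply clinD[OF clin_proj])

lemma amp_adj: "T \<in> bop \<Longrightarrow> op_adj (amp T) = amp (op_adj T)"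
proof (rule op_adj_eqI)
  fix u v assume T: "T \<in> bop"
  have "((\<lambda>i. cinner (app (proj i) (app (amp T) u)) (app (proj i) v)) has_sum
      cinner (app (amp T) u) v) UNIV"
    by (rule has_sum_cinner_hsum)
  moreover have "((\<lambda>i. cinner (app (proj i) u) (app (proj i) (app (amp (op_adj T)) v))) has_sum
      cinner u (app (amp (op_adj T)) v)) UNIV"
    by (rule has_sum_cinner_hsum)
  ultimately show "cinner (app (amp T) u) v = cinner u (app (amp (op_adj T)) v)"
    unfolding amp_proj cinner_op_adj[OF T] by (rule has_sum_unique)
qed

lemma norm_amp_le: "norm (amp T) \<le> norm T"
proof (rule norm_blinfun_bound)
  fix f :: "(nat, 'a) hsum"
  have "(norm (app (amp T) f))\<^sup>2 \<le> (norm T * norm f)\<^sup>2"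
    unfolding norm_hsum_sq[of "app (amp T) f"]
  proof (rule sq_summable_of_bound)
    fix F :: "nat set" assume F: "finite F"
    have "(\<Sum>i\<in>F. (norm (Rep_hsum (app (amp T) f) i))\<^sup>2) \<le> (\<Sum>i\<in>F. (norm T * norm (Rep_hsum f i))\<^sup>2)"
      unfolding proj_apply[symmetric] amp_proj by (intro sum_mono power_mono norm_blinfun) auto
    also have "\<dots> = (norm T)\<^sup>2 * (\<Sum>i\<in>F. (norm (Rep_hsum f i))\<^sup>2)"
      by (simp add: power_mult_distrib sum_distrib_left)
    also have "\<dots> \<le> (norm T)\<^sup>2 * (norm f)\<^sup>2" by (intro mult_left_mono sum_le_norm_hsum F) auto
    finally show "(\<Sum>i\<in>F. (norm (Rep_hsum (app (amp T) f) i))\<^sup>2) \<le> (norm T * norm f)\<^sup>2"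
      by (simp add: power_mult_distrib)
  qed
  then show "norm (app (amp T) f) \<le> norm T * norm f" by (rule power2_le_imp_le) simp
qed simp

lemma amp_vector_state:
  fixes \<xi> :: "(nat, 'h::chilbert_space) hsum"
  assumes A: "unital_cstar_algebra \<A>" and "norm \<xi> = 1"
  shows "bounded_hermitian \<A> (\<lambda>T. cinner (app (amp T) \<xi>) \<xi>)"
    and "state \<A> (\<lambda>T. cinner (app (amp T) \<xi>) \<xi>)"
proof -
  have Ab: "T \<in> bop" if "T \<in> \<A>" for T using that unital_cstar_algebraD(1)[OF A] by blast
  note b = vector_state(1)[OF unital_cstar_algebra_bop assms(2)]
  note s = vector_state(2)[OF unital_cstar_algebra_bop assms(2)]
  show "bounded_hermitian \<A> (\<lambda>T. cinner (app (amp T) \<xi>) \<xi>)"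
  proof -
    have "cmod (cinner (app (amp T) \<xi>) \<xi>) \<le> norm T" if "T \<in> bop" for T
      using b amp_bop[OF that] order_trans[OF _ norm_amp_le] by (auto simp: bounded_hermitian_def)
    then show ?thesis
      using b Ab by (auto simp: bounded_hermitian_def clinear_on_def amp_simps amp_bop amp_adj[symmetric])
  qed
  show "state \<A> (\<lambda>T. cinner (app (amp T) \<xi>) \<xi>)"
    using s Ab
    by (auto simp: state_def clinear_on_def amp_simps amp_bop amp_adj[symmetric] simp del: blinfun_apply_blinfun_compose)
qed

text \<open>The matrix M on the first n coordinates and the scalar c on all others; c is subtracted
  on the corner because the last summand adds it everywhere.\<close>

definition fd_op :: "nat \<Rightarrow> (nat \<Rightarrow> nat \<Rightarrow> complex) \<Rightarrow> complex \<Rightarrow> (nat, 'h::chilbert_space) hsum op" where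
  "fd_op n M c = (\<Sum>i<n. \<Sum>j<n. op_scaleC (M i j - (if i = j then c else 0)) (kb i j)) + op_scaleC c id_blinfun"

lemma fd_op_bop: "fd_op n M c \<in> bop"
  unfolding fd_op_def by (intro bop_intros bop_sum kb_bop)

lemma fd_op_proj:
  "app (proj l) (app (fd_op n M c) f) =
    (if l < n then (\<Sum>j<n. M l j *\<^sub>C app (proj j) f) else c *\<^sub>C app (proj l) f)"
proof -
  define N where "N i j = M i j - (if i = j then c else 0)" for i j
  have "app (proj l) (app (fd_op n M c) f)
      = (\<Sum>i<n. \<Sum>j<n. N i j *\<^sub>C (if l = i then app (proj j) f else 0)) + c *\<^sub>C app (proj l) f"
    unfolding fd_op_def N_def[symmetric]
    by (simp add: blinfun.add_left blinfun.add_right blinfun.sum_left blinfun.sum_right op_scaleC_apply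
        clinD[OF clin_proj] kb_apply)
  also have "(\<Sum>i<n. \<Sum>j<n. N i j *\<^sub>C (if l = i then app (proj j) f else 0))
      = (\<Sum>i<n. if l = i then (\<Sum>j<n. N i j *\<^sub>C app (proj j) f) else 0)"
    by (intro sum.cong refl) auto
  also have "\<dots> = (if l < n then (\<Sum>j<n. M l j *\<^sub>C app (proj j) f) - c *\<^sub>C app (proj l) f else 0)"
  proof -
    have "(\<Sum>j<n. N l j *\<^sub>C app (proj j) f)
        = (\<Sum>j<n. M l j *\<^sub>C app (proj j) f - (if l = j then c *\<^sub>C app (proj l) f else 0))"
      by (intro sum.cong) (auto simp: N_def scaleC_diff_left)
    then show ?thesis by (simp add: sum_subtractf)
  qed
  finally show ?thesis by simp
qed

lemma fd_op_commute_amp: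
  assumes "T \<in> bop"
  shows "amp T o\<^sub>L fd_op n M c = fd_op n M c o\<^sub>L amp T"
  by (intro blinfun_eqI hsum_eq_proj)
    (simp add: amp_proj fd_op_proj blinfun.sum_right bopD[OF assms])

lemma cinner_fd_op:
  "cinner (app (fd_op n M c) f) g =
    (\<Sum>i<n. \<Sum>j<n. M i j * cinner (app (proj j) f) (app (proj i) g))
    + c * (cinner f g - (\<Sum>i<n. cinner (app (proj i) f) (app (proj i) g)))"
proof -
  have "cinner (app (fd_op n M c) f) g
      = (\<Sum>i<n. \<Sum>j<n. (M i j - (if i = j then c else 0)) * cinner (app (proj j) f) (app (proj i) g))
        + c * cinner f g"
    by (simp add: fd_op_def blinfun.add_left blinfun.sum_left cinner_add_left cinner_sum_left op_scaleC_apply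
        cinner_scaleC_left kb_apply cinner_emb_left)
  also have "(\<Sum>i<n. \<Sum>j<n. (M i j - (if i = j then c else 0)) * cinner (app (proj j) f) (app (proj i) g))
      = (\<Sum>i<n. \<Sum>j<n. M i j * cinner (app (proj j) f) (app (proj i) g))
        - (\<Sum>i<n. \<Sum>j<n. if i = j then c * cinner (app (proj i) f) (app (proj i) g) else 0)"
    unfolding sum_subtractf[symmetric] by (intro sum.cong refl) (auto simp: left_diff_distrib)
  also have "(\<Sum>i<n. \<Sum>j<n. if i = j then c * cinner (app (proj i) f) (app (proj i) g) else 0)
      = c * (\<Sum>i<n. cinner (app (proj i) f) (app (proj i) g))"
    by (simp add: sum_distrib_left)
  finally show ?thesis by (simp add: algebra_simps)
qed

text \<open>Acts as a scalar stochastic matrix off the finite dimensional corner.\<close>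

definition pad :: "'x \<Rightarrow> 'x \<Rightarrow> 'a \<Rightarrow> 'a \<Rightarrow> complex" where
  "pad x x' a a' = (if x = x' \<and> a = undefined \<and> a' = undefined then 1 else 0)"

text \<open>The condition \<open>vec\<close> is scalar positivity with vectors of the summand in
  place of coefficients. It is immediate for complex entries and follows coordinatewise for
  \<open>ell2\<close>.\<close>

lemma fd_op_stochastic:
  fixes E :: "'x::finite \<Rightarrow> 'x \<Rightarrow> 'a::finite \<Rightarrow> 'a \<Rightarrow> nat \<Rightarrow> nat \<Rightarrow> complex"
  assumes fd: "fd_stochastic_operator_matrix n E"
    and vec: "\<And>h :: 'x \<Rightarrow> 'a \<Rightarrow> nat \<Rightarrow> 'h::chilbert_space.
      (\<Sum>x\<in>UNIV. \<Sum>x'\<in>UNIV. \<Sum>a\<in>UNIV. \<Sum>a'\<in>UNIV. \<Sum>i<n. \<Sum>j<n.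
           E x x' a a' i j * cinner (h x' a' j) (h x a i)) \<in> \<real>\<^sub>\<ge>\<^sub>0"
  shows "stochastic_operator_matrix (\<lambda>x x' a a'. fd_op n (E x x' a a') (pad x x' a a') :: (nat, 'h) hsum op)"
  unfolding stochastic_operator_matrix_def
proof (intro conjI allI)
  show "(fd_op n (E x x' a a') (pad x x' a a') :: (nat, 'h) hsum op) \<in> bop" for x x' a a' by (rule fd_op_bop)
  show "(\<Sum>a\<in>UNIV. fd_op n (E x x' a a) (pad x x' a a) :: (nat, 'h) hsum op) = (if x = x' then id_blinfun else 0)" for x x'
  proof (intro blinfun_eqI hsum_eq_proj)
    fix f :: "(nat, 'h) hsum" and l
    have s: "(\<Sum>a\<in>UNIV. pad x x' a (a::'a) *\<^sub>C v) = (if x = x' then v else 0)" for v :: 'h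
      by (subst sum_UNIV_single[of undefined]) (auto simp: pad_def)
    have "(\<Sum>a\<in>UNIV. \<Sum>j<n. E x x' a a l j *\<^sub>C app (proj j) f)
        = (if x = x' then app (proj l) f else 0)" if l: "l < n"
    proof -
      have "(\<Sum>a\<in>UNIV. \<Sum>j<n. E x x' a a l j *\<^sub>C app (proj j) f)
          = (\<Sum>j<n. \<Sum>a\<in>UNIV. E x x' a a l j *\<^sub>C app (proj j) f)" by (rule sum.swap)
      also have "\<dots> = (\<Sum>j<n. (\<Sum>a\<in>UNIV. E x x' a a l j) *\<^sub>C app (proj j) f)"
      proof -
        have "(\<Sum>a\<in>A. z a *\<^sub>C v) = (\<Sum>a\<in>A. z a) *\<^sub>C v" for z :: "'a \<Rightarrow> complex" and A and v :: 'h
          by (induction A rule: infinite_finite_induct) (auto simp: scaleC_add_left)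
        then show ?thesis by simp
      qed
      also have "\<dots> = (\<Sum>j<n. if l = j then (if x = x' then app (proj j) f else 0) else 0)"
        using fd l by (intro sum.cong refl) (auto simp: fd_stochastic_operator_matrix_def)
      also have "\<dots> = (if x = x' then app (proj l) f else 0)" using l by simp
      finally show ?thesis .
    qed
    then show "app (proj l) (app (\<Sum>a\<in>UNIV. fd_op n (E x x' a a) (pad x x' a a)) f)
        = app (proj l) (app (if x = x' then id_blinfun else 0) f)"
      by (cases "l < n") (simp_all add: blinfun.sum_left blinfun.sum_right fd_op_proj s)
  qed
  fix h :: "'x \<Rightarrow> 'a \<Rightarrow> (nat, 'h) hsum"
  \<comment> \<open>The squared norm of the part outside the corner, which is all that the padding
    sees.\<close>
  define r where "r x = cinner (h x undefined) (h x undefined)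
      - (\<Sum>i<n. cinner (app (proj i) (h x undefined)) (app (proj i) (h x undefined)))" for x
  have r: "r x \<in> \<real>\<^sub>\<ge>\<^sub>0" for x
  proof -
    have "r x = complex_of_real ((norm (h x undefined))\<^sup>2 - (\<Sum>i<n. (norm (Rep_hsum (h x undefined) i))\<^sup>2))"
      by (simp add: r_def cinner_self proj_apply)
    then show ?thesis using sum_le_norm_hsum[of "{..<n}" "h x undefined"]
      by (simp add: complex_nonneg_Reals_iff del: of_real_diff)
  qed
  let ?q = "\<lambda>x x' a a'. cinner (h x' a') (h x a)
      - (\<Sum>i<n. cinner (app (proj i) (h x' a')) (app (proj i) (h x a)))"
  have "(\<Sum>x\<in>UNIV. \<Sum>x'\<in>UNIV. \<Sum>a\<in>UNIV. \<Sum>a'\<in>UNIV.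
      cinner (app (fd_op n (E x x' a a') (pad x x' a a')) (h x' a')) (h x a))
      = (\<Sum>x\<in>UNIV. \<Sum>x'\<in>UNIV. \<Sum>a\<in>UNIV. \<Sum>a'\<in>UNIV. \<Sum>i<n. \<Sum>j<n.
           E x x' a a' i j * cinner (app (proj j) (h x' a')) (app (proj i) (h x a)))
      + (\<Sum>x\<in>UNIV. \<Sum>x'\<in>UNIV. \<Sum>a\<in>UNIV. \<Sum>a'\<in>UNIV. pad x x' a a' * ?q x x' a a')"
    unfolding cinner_fd_op by (simp only: sum.distrib)
  also have "(\<Sum>x\<in>UNIV. \<Sum>x'\<in>UNIV. \<Sum>a\<in>UNIV. \<Sum>a'\<in>UNIV. pad x x' a a' * ?q x x' a a') = (\<Sum>x\<in>UNIV. r x)"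
  proof (intro sum.cong refl)
    fix x
    have "(\<Sum>a\<in>UNIV. \<Sum>a'\<in>UNIV. pad x x' a a' * ?q x x' a a') = (if x' = x then r x else 0)" for x'
      by (subst sum_UNIV_single2[of undefined undefined]) (auto simp: pad_def r_def)
    then show "(\<Sum>x'\<in>UNIV. \<Sum>a\<in>UNIV. \<Sum>a'\<in>UNIV. pad x x' a a' * ?q x x' a a') = r x" by simp
  qed
  also have "(\<Sum>x\<in>UNIV. \<Sum>x'\<in>UNIV. \<Sum>a\<in>UNIV. \<Sum>a'\<in>UNIV. \<Sum>i<n. \<Sum>j<n.
           E x x' a a' i j * cinner (app (proj j) (h x' a')) (app (proj i) (h x a)))
      + (\<Sum>x\<in>UNIV. r x) \<in> \<real>\<^sub>\<ge>\<^sub>0"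
    by (rule nonneg_Reals_add_I[OF vec[of "\<lambda>x a i. app (proj i) (h x a)"] sum_nonneg_Reals[OF r]])
  finally show "(\<Sum>x\<in>UNIV. \<Sum>x'\<in>UNIV. \<Sum>a\<in>UNIV. \<Sum>a'\<in>UNIV.
      cinner (app (fd_op n (E x x' a a') (pad x x' a a')) (h x' a')) (h x a)) \<in> \<real>\<^sub>\<ge>\<^sub>0" .
qed

lemma fd_stochastic_complex:
  assumes "fd_stochastic_operator_matrix n E"
  shows "(\<Sum>x\<in>UNIV. \<Sum>x'\<in>UNIV. \<Sum>a\<in>UNIV. \<Sum>a'\<in>UNIV. \<Sum>i<n. \<Sum>j<n.
           E x x' a a' i j * cinner (h x' a' j) (h x a i :: complex)) \<in> \<real>\<^sub>\<ge>\<^sub>0"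
  using assms by (simp add: fd_stochastic_operator_matrix_def cinner_complex_def mult.assoc)

lemma fd_stochastic_ell2:
  assumes "fd_stochastic_operator_matrix n E"
  shows "(\<Sum>x\<in>UNIV. \<Sum>x'\<in>UNIV. \<Sum>a\<in>UNIV. \<Sum>a'\<in>UNIV. \<Sum>i<n. \<Sum>j<n.
           E x x' a a' i j * cinner (h x' a' j) (h x a i :: ell2)) \<in> \<real>\<^sub>\<ge>\<^sub>0"
proof (rule has_sum_nonneg_Reals)
  show "((\<lambda>m. \<Sum>x\<in>UNIV. \<Sum>x'\<in>UNIV. \<Sum>a\<in>UNIV. \<Sum>a'\<in>UNIV. \<Sum>i<n. \<Sum>j<n.
      E x x' a a' i j * cinner (app (proj m) (h x' a' j)) (app (proj m) (h x a i))) has_sum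
      (\<Sum>x\<in>UNIV. \<Sum>x'\<in>UNIV. \<Sum>a\<in>UNIV. \<Sum>a'\<in>UNIV. \<Sum>i<n. \<Sum>j<n.
           E x x' a a' i j * cinner (h x' a' j) (h x a i))) UNIV"
    by (intro has_sum_sum has_sum_cmult_right has_sum_cinner_hsum)
  show "(\<Sum>x\<in>UNIV. \<Sum>x'\<in>UNIV. \<Sum>a\<in>UNIV. \<Sum>a'\<in>UNIV. \<Sum>i<n. \<Sum>j<n.
      E x x' a a' i j * cinner (app (proj m) (h x' a' j)) (app (proj m) (h x a i))) \<in> \<real>\<^sub>\<ge>\<^sub>0" for m
    by (rule fd_stochastic_complex[OF assms])
qed

text \<open>A copy of the n by n matrices plus one scalar for the remaining coordinates; as a
  commutant it is a C*-algebra at once.\<close>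

definition fd_algebra :: "nat \<Rightarrow> ell2 op set" where
  "fd_algebra n = commutant {kb i j | i j. n \<le> i \<and> n \<le> j}"

lemma unital_cstar_algebra_fd_algebra: "unital_cstar_algebra (fd_algebra n)"
  unfolding fd_algebra_def by (rule unital_cstar_algebra_commutant) (auto simp: kb_bop kb_adj, blast)

lemma fd_op_fd_algebra: "fd_op n M c \<in> fd_algebra n"
  unfolding fd_algebra_def commutant_def
  by (auto simp: fd_op_bop fd_op_proj kb_apply clinD[OF clin_emb] clinD[OF clin_proj] intro!: blinfun_eqI hsum_eq_proj)

lemma fd_algebra_fd_op:
  assumes "T \<in> fd_algebra n"
  shows "\<exists>M c. T = fd_op n M c"
proof -
  have b: "T \<in> bop" and comm: "\<And>i j. n \<le> i \<Longrightarrow> n \<le> j \<Longrightarrow> T o\<^sub>L kb i j = kb i j o\<^sub>L T"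
    using assms unfolding fd_algebra_def commutant_def by blast+
  have comm': "app T (app (kb i j) f) = app (kb i j) (app T f)"
    if "n \<le> i" "n \<le> j" for i j f
    using arg_cong[OF comm[OF that], of "\<lambda>S. app S f"] by simp
  define M where "M i j = app (proj i) (app T (ket j))" for i j
  \<comment> \<open>Commuting with \<open>kb l l\<close> leaves only the diagonal entry in row l
    beyond the corner.\<close>
  have off: "app (proj l) (app T (ket j)) = 0" if "n \<le> l" "j \<noteq> l" for l j
  proof -
    have "app (emb l) (app (proj l) (app T (ket j))) = 0"
      using comm'[OF that(1) that(1), of "ket j"] that(2) by (simp add: kb_apply blinfun.zero_right)
    then have "app (proj l) (app (emb l) (app (proj l) (app T (ket j)))) = 0"
      by (simp add: blinfun.zero_right)
    then show ?thesis by simp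
  qed
  \<comment> \<open>Commuting with \<open>kb j n\<close> transports the diagonal entry at n to every
    later coordinate, so the scalar is \<open>M n n\<close>.\<close>
  have up: "app T (ket j) = app (emb j) (M n n)" if "n \<le> j" for j
    using comm'[OF that order_refl, of "ket n"] by (simp add: kb_apply M_def)
  have "T = fd_op n M (M n n)"
  proof (rule blinfun_ell2_eqI)
    show "clin T" "clin (fd_op n M (M n n) :: ell2 op)" using b fd_op_bop by (auto simp: bop_iff_clin)
    fix j
    show "app T (ket j) = app (fd_op n M (M n n)) (ket j)"
    proof (rule hsum_eq_proj)
      fix l
      have "(\<Sum>j'<n. M l j' *\<^sub>C (if j' = j then 1 else 0)) = (if j < n then M l j else 0)"
        by (simp add: scaleC_complex_def if_distrib cong: if_cong)
      then show "app (proj l) (app T (ket j)) = app (proj l) (app (fd_op n M (M n n)) (ket j))"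
        using off[of l j] up[of j] by (auto simp: fd_op_proj M_def scaleC_complex_def)
    qed
  qed
  then show ?thesis by blast
qed

lemma finite_dimensional_fd_algebra: "finite_dimensional (fd_algebra n)"
proof -
  \<comment> \<open>\<open>span\<close> is the real span, so each generator is listed together with
    its multiple by the imaginary unit.\<close>
  define S :: "ell2 op set" where
    "S = (\<lambda>(i, j). kb i j) ` ({..<n} \<times> {..<n}) \<union> (\<lambda>(i, j). op_scaleC \<i> (kb i j)) ` ({..<n} \<times> {..<n})
      \<union> {id_blinfun, op_scaleC \<i> id_blinfun}"
  have sc: "op_scaleC c X \<in> span S" if "X \<in> S" "op_scaleC \<i> X \<in> S" for c X
  proof -
    have "op_scaleC c X = Re c *\<^sub>R X + Im c *\<^sub>R op_scaleC \<i> X"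
    proof (rule blinfun_eqI)
      fix f
      have "complex_of_real (Re c) + complex_of_real (Im c) * \<i> = c" by (simp add: complex_eq_iff)
      then have "c *\<^sub>C v = Re c *\<^sub>R v + Im c *\<^sub>R (\<i> *\<^sub>C v)" for v :: ell2
        unfolding scaleC_of_real[symmetric] scaleC_scaleC scaleC_add_left[symmetric]
        by simp
      then show "app (op_scaleC c X) f = app (Re c *\<^sub>R X + Im c *\<^sub>R op_scaleC \<i> X) f"
        by (simp add: op_scaleC_apply blinfun.add_left blinfun.scaleR_left)
    qed
    then show ?thesis using that by (simp add: span_add span_scale span_base)
  qed
  have "fd_op n M c \<in> span S" for M c
    unfolding fd_op_def by (intro span_add span_sum sc) (auto simp: S_def)
  then have "fd_algebra n \<subseteq> span S" using fd_algebra_fd_op by blast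
  moreover have "finite S" by (simp add: S_def)
  ultimately show ?thesis unfolding finite_dimensional_def by blast
qed

section \<open>Quantum correlations\<close>

text \<open>E acts inside each copy of \<open>ell2\<close> and F on the index of the copies. Every
  \<open>amp T\<close> commutes with F, so the trace estimate holds for all T in \<open>bop\<close>,
  and its constant depends on the score alone.\<close>

lemma quantum_correlation_model:
  fixes G :: "('x::finite \<times> 'x) cmat \<Rightarrow> ('a::finite \<times> 'a) cmat"
  assumes "quantum_correlation G"
  defines "d \<equiv> sqrt (2 * (real CARD('x) * real CARD('a) - Re (score G)))"
  shows "\<exists>n (E :: 'x \<Rightarrow> 'x \<Rightarrow> 'a \<Rightarrow> 'a \<Rightarrow> ell2 op) (\<xi> :: (nat, ell2) hsum).
    norm \<xi> = 1 \<and> stochastic_operator_matrix E \<and> (\<forall>x x' a a'. E x x' a a' \<in> fd_algebra n) \<and>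
    (\<forall>x x' a a'. \<forall>T\<in>bop. cmod (cinner (app (amp (E x x' a a' o\<^sub>L T)) \<xi>) \<xi>
       - cinner (app (amp (T o\<^sub>L E x x' a a')) \<xi>) \<xi>) \<le> 2 * norm T * d) \<and>
    (\<forall>x x' y y' a a' b b'. cmod (coef G x x' y y' a a' b b'
       - cinner (app (amp (E x x' a a' o\<^sub>L E y' y b' b)) \<xi>) \<xi>) \<le> d * sqrt (real CARD('x) * real CARD('a)))"
proof -
  obtain n m \<xi> E F where
    nrm: "(\<Sum>i<n. \<Sum>j<m. (cmod (\<xi> i j))\<^sup>2) = 1" and
    E: "fd_stochastic_operator_matrix n E" and F: "fd_stochastic_operator_matrix m F" and
    G: "\<And>x x' y y'. G (munit x x' \<otimes>\<^sub>m munit y y') =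
           (\<Sum>a\<in>UNIV. \<Sum>a'\<in>UNIV. \<Sum>b\<in>UNIV. \<Sum>b'\<in>UNIV.
              mscale (fd_tensor_form n m (E x x' a a') (F y y' b b') \<xi>)
                (munit a a' \<otimes>\<^sub>m munit b b'))"
    using assms(1) unfolding quantum_correlation_def by blast
  define E' :: "'x \<Rightarrow> 'x \<Rightarrow> 'a \<Rightarrow> 'a \<Rightarrow> ell2 op" where
    "E' x x' a a' = fd_op n (E x x' a a') (pad x x' a a')" for x x' a a'
  define F' :: "'x \<Rightarrow> 'x \<Rightarrow> 'a \<Rightarrow> 'a \<Rightarrow> (nat, ell2) hsum op" where
    "F' x x' a a' = fd_op m (F x x' a a') (pad x x' a a')" for x x' a a'
  \<comment> \<open>The j-th column of the coefficients of \<xi>, which becomes the component in the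
    j-th copy.\<close>
  define v where "v j = (\<Sum>i<n. \<xi> i j *\<^sub>C ket i)" for j
  define \<xi>' where "\<xi>' = (\<Sum>j<m. app (emb j) (v j))"
  have sE: "stochastic_operator_matrix E'"
    unfolding E'_def[abs_def] by (rule fd_op_stochastic[OF E fd_stochastic_complex[OF E]])
  have sF: "stochastic_operator_matrix F'"
    unfolding F'_def[abs_def] by (rule fd_op_stochastic[OF F fd_stochastic_ell2[OF F]])
  have Eb: "E' x x' a a' \<in> bop" for x x' a a' unfolding E'_def by (rule fd_op_bop)
  have sA: "stochastic_operator_matrix (\<lambda>x x' a a'. amp (E' x x' a a'))"
  proof (rule stochastic_diag_op[OF sE])
    let ?N = "\<lambda>(x, x', a, a'). norm (E' x x' a a')"
    fix x x' a a'
    have "?N (x, x', a, a') \<le> Max (range ?N)" by (rule Max_ge) (simp, rule rangeI)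
    then show "norm (E' x x' a a') \<le> Max (range ?N)" by simp
  qed
  have proj_xi: "app (proj l) \<xi>' = (if l < m then v l else 0)" for l
    by (simp add: \<xi>'_def blinfun.sum_right)
  have cinner_xi: "cinner f \<xi>' = (\<Sum>j<m. cinner (app (proj j) f) (v j))" for f
    by (simp add: \<xi>'_def cinner_sum_right cinner_emb_right)
  have vv: "cinner (v j') (v j) = (\<Sum>i<n. \<xi> i j' * cnj (\<xi> i j))" for j j'
    by (simp add: v_def cinner_sum_ket)
  have "norm \<xi>' = 1"
  proof -
    have "complex_of_real ((norm \<xi>')\<^sup>2) = (\<Sum>j<m. \<Sum>i<n. \<xi> i j * cnj (\<xi> i j))"
      unfolding cinner_self[symmetric] cinner_xi by (simp add: proj_xi vv)
    also have "\<dots> = (\<Sum>i<n. \<Sum>j<m. \<xi> i j * cnj (\<xi> i j))" by (rule sum.swap)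
    also have "\<dots> = complex_of_real 1" unfolding nrm[symmetric] by (simp add: complex_norm_square[symmetric])
    finally have "(norm \<xi>')\<^sup>2 = 1\<^sup>2" by (simp only: of_real_eq_iff) simp
    then show ?thesis by (rule power2_eq_imp_eq) auto
  qed
  have "commuting_pair (\<lambda>x x' a a'. amp (E' x x' a a')) F' \<xi>'"
    using sA sF \<open>norm \<xi>' = 1\<close> fd_op_commute_amp[OF Eb] by unfold_locales (auto simp: F'_def)
  then interpret commuting_pair "\<lambda>x x' a a'. amp (E' x x' a a')" F' \<xi>' .
  have coef: "coef G x x' y y' a a' b b' = cinner (app (amp (E' x x' a a') o\<^sub>L F' y y' b b') \<xi>') \<xi>'"
    for x x' y y' a a' b b'
  proof -
    let ?E = "E x x' a a'" and ?F = "F y y' b b'"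
    have Ev: "cinner (app (E' x x' a a') (v j')) (v j) = (\<Sum>i<n. \<Sum>i'<n. ?E i i' * (\<xi> i' j' * cnj (\<xi> i j)))"
      for j j'
      unfolding E'_def cinner_fd_op vv by (simp add: v_def proj_sum_ket cinner_complex_def)
    have "cinner (app (amp (E' x x' a a') o\<^sub>L F' y y' b b') \<xi>') \<xi>'
        = (\<Sum>j<m. cinner (app (E' x x' a a') (\<Sum>j'<m. ?F j j' *\<^sub>C v j')) (v j))"
      unfolding cinner_xi by (simp add: amp_proj F'_def fd_op_proj proj_xi)
    also have "\<dots> = (\<Sum>j<m. \<Sum>j'<m. ?F j j' * cinner (app (E' x x' a a') (v j')) (v j))"
      by (simp add: blinfun.sum_right bopD[OF Eb] cinner_sum_left cinner_scaleC_left)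
    also have "\<dots> = (\<Sum>j<m. \<Sum>j'<m. \<Sum>i<n. \<Sum>i'<n. ?E i i' * ?F j j' * \<xi> i' j' * cnj (\<xi> i j))"
      unfolding Ev by (simp add: sum_distrib_left mult_ac)
    also have "\<dots> = fd_tensor_form n m ?E ?F \<xi>"
      unfolding fd_tensor_form_def by (rule sum_swap22)
    finally show ?thesis using G[unfolded matrix_eq_sum_munit_iff] by (simp add: coef_def)
  qed
  have d: "defect = d" unfolding d_def by (rule defect_eq_score[OF coef])
  have "cmod (cinner (app (amp (E' x x' a a' o\<^sub>L T)) \<xi>') \<xi>'
       - cinner (app (amp (T o\<^sub>L E' x x' a a')) \<xi>') \<xi>') \<le> 2 * norm T * d" if T: "T \<in> bop" for x x' a a' T
  proof -
    have "cmod (cinner (app (amp (E' x x' a a') o\<^sub>L amp T) \<xi>') \<xi>'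
       - cinner (app (amp T o\<^sub>L amp (E' x x' a a')) \<xi>') \<xi>') \<le> 2 * norm (amp T) * defect"
      by (rule approx_trace) (auto simp: amp_bop T F'_def fd_op_commute_amp)
    also have "\<dots> \<le> 2 * norm T * defect"
      by (intro mult_right_mono mult_left_mono norm_amp_le defect_nonneg) auto
    finally show ?thesis unfolding amp_simps d .
  qed
  moreover have "cmod (coef G x x' y y' a a' b b'
       - cinner (app (amp (E' x x' a a' o\<^sub>L E' y' y b' b)) \<xi>') \<xi>') \<le> d * sqrt (real CARD('x) * real CARD('a))"
    for x x' y y' a a' b b'
    unfolding coef amp_simps d[symmetric] by (rule approx_correlation)
  moreover have "E' x x' a a' \<in> fd_algebra n" for x x' a a' unfolding E'_def by (rule fd_op_fd_algebra)
  ultimately show ?thesis using \<open>norm \<xi>' = 1\<close> sE by blast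
qed

lemma quantum_correlation_trace:
  fixes \<Gamma> :: "('x::finite \<times> 'x) cmat \<Rightarrow> ('a::finite \<times> 'a) cmat"
  assumes "quantum_correlation \<Gamma>"
    and score: "score \<Gamma> = of_nat CARD('x) * of_nat CARD('a)"
  shows "\<exists>\<tau>. tracial_state C_XA \<tau> \<and> is_trace_correlation \<Gamma> \<tau> \<and> factors_through finite_dimensional C_XA \<tau>"
  using quantum_correlation_model[OF assms(1)]
proof (elim exE conjE)
  fix n and E :: "'x \<Rightarrow> 'x \<Rightarrow> 'a \<Rightarrow> 'a \<Rightarrow> ell2 op" and \<xi> :: "(nat, ell2) hsum"
  assume xi: "norm \<xi> = 1" and E: "stochastic_operator_matrix E" "\<forall>x x' a a'. E x x' a a' \<in> fd_algebra n" and
    tr': "\<forall>x x' a a'. \<forall>T\<in>bop. cmod (cinner (app (amp (E x x' a a' o\<^sub>L T)) \<xi>) \<xi>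
       - cinner (app (amp (T o\<^sub>L E x x' a a')) \<xi>) \<xi>)
       \<le> 2 * norm T * sqrt (2 * (real CARD('x) * real CARD('a) - Re (score \<Gamma>)))" and
    co': "\<forall>x x' y y' a a' b b'. cmod (coef \<Gamma> x x' y y' a a' b b'
       - cinner (app (amp (E x x' a a' o\<^sub>L E y' y b' b)) \<xi>) \<xi>)
       \<le> sqrt (2 * (real CARD('x) * real CARD('a) - Re (score \<Gamma>))) * sqrt (real CARD('x) * real CARD('a))"
  \<comment> \<open>At the exact score the square root is 0, so both estimates become
    equalities.\<close>
  have tr: "cinner (app (amp (E x x' a a' o\<^sub>L T)) \<xi>) \<xi>
       = cinner (app (amp (T o\<^sub>L E x x' a a')) \<xi>) \<xi>" if "T \<in> bop" for x x' a a' T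
    using tr' that by (simp add: score)
  have co: "coef \<Gamma> x x' y y' a a' b b' = cinner (app (amp (E x x' a a' o\<^sub>L E y' y b' b)) \<xi>) \<xi>"
    for x x' y y' a a' b b'
    using co' by (simp add: score)
  define \<psi> where "\<psi> T = cinner (app (amp T) \<xi>) \<xi>" for T
  note cD = unital_cstar_algebra_fd_algebra[of n]
  note vs = amp_vector_state[OF cD xi, folded \<psi>_def]
  obtain V where V: "is_block_isometry V" "\<And>x x' a a'. op_adj (V a x) o\<^sub>L V a' x' = E x x' a a'"
    using ex_block_isometry_factor[OF E(1)] by blast
  have "E x x' a a' \<in> centralizer (fd_algebra n) \<psi>" for x x' a a'
    using E(2) tr unital_cstar_algebraD(1)[OF cD] by (auto simp: centralizer_def \<psi>_def)
  from trace_through_compress[OF V cD vs this] obtain \<pi> where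
    \<pi>: "unital_star_hom C_XA (centralizer (fd_algebra n) \<psi>) \<pi>" "\<And>x x' a a'. \<pi> (univ_e x x' a a') = E x x' a a'"
    "tracial_state (centralizer (fd_algebra n) \<psi>) \<psi>" "tracial_state C_XA (\<lambda>z. \<psi> (\<pi> z))" by blast
  have "\<pi> (univ_e x x' a a' o\<^sub>L univ_e y' y b' b) = E x x' a a' o\<^sub>L E y' y b' b" for x x' a a' y y' b b'
    using \<pi>(1,2) univ_e_C_XA[where 'x = 'x and 'a = 'a] by (simp add: unital_star_hom_def)
  then have "is_trace_correlation \<Gamma> (\<lambda>z. \<psi> (\<pi> z))"
    unfolding is_trace_correlation_iff by (simp add: co \<psi>_def)
  moreover have "finite_dimensional (centralizer (fd_algebra n) \<psi>)"
    using finite_dimensional_fd_algebra[of n] by (auto simp: finite_dimensional_def centralizer_def)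
  ultimately show ?thesis
    using \<pi> unital_cstar_algebra_centralizer[OF cD vs(1)] unfolding factors_through_def by blast
qed

section \<open>Approximately quantum correlations\<close>

text \<open>The indices will be all operators on a space, where a pointwise convergent subsequence
  cannot be expected. A cluster point in the product of discs, compact by Tychonoff's theorem,
  yields a finer filter instead.\<close>

lemma ex_pointwise_limit:
  fixes \<Phi> :: "nat \<Rightarrow> 'i \<Rightarrow> complex"
  assumes "\<And>k i. cmod (\<Phi> k i) \<le> B i"
  shows "\<exists>\<phi> U. U \<noteq> bot \<and> U \<le> sequentially \<and> (\<forall>i. ((\<lambda>k. \<Phi> k i) \<longlongrightarrow> \<phi> i) U)"
proof -
  let ?K = "PiE UNIV (\<lambda>i. cball 0 (B i)) :: ('i \<Rightarrow> complex) set"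
  have "compactin (product_topology (\<lambda>i. euclidean) UNIV) ?K"
    unfolding compactin_PiE by simp
  then have "compact ?K" by (simp add: euclidean_product_topology)
  moreover have "filtermap \<Phi> sequentially \<noteq> bot" by (simp add: filtermap_bot_iff)
  moreover have "eventually (\<lambda>f. f \<in> ?K) (filtermap \<Phi> sequentially)"
    using assms by (auto simp: eventually_filtermap PiE_iff intro!: always_eventually)
  ultimately obtain \<phi> where \<phi>: "inf (nhds \<phi>) (filtermap \<Phi> sequentially) \<noteq> bot"
    unfolding compact_filter by blast
  \<comment> \<open>Indices whose values are near the cluster point; lying below
    \<open>sequentially\<close>, this filter inherits all ordinary limits in k.\<close>
  define U where "U = inf (filtercomap \<Phi> (nhds \<phi>)) sequentially"
  have "U \<noteq> bot"
  proof
    assume "U = bot"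
    then have "eventually (\<lambda>_. False) U" by simp
    then obtain P Q where PQ: "eventually P (filtercomap \<Phi> (nhds \<phi>))" "eventually Q sequentially" "\<And>k. P k \<Longrightarrow> Q k \<Longrightarrow> False"
      unfolding U_def eventually_inf by blast
    then obtain P' where P': "eventually P' (nhds \<phi>)" "\<And>k. P' (\<Phi> k) \<Longrightarrow> P k"
      unfolding eventually_filtercomap by blast
    have "eventually (\<lambda>f. \<not> P' f) (filtermap \<Phi> sequentially)"
      unfolding eventually_filtermap using PQ(2) by eventually_elim (use PQ(3) P'(2) in blast)
    then have "eventually (\<lambda>_. False) (inf (nhds \<phi>) (filtermap \<Phi> sequentially))"
      using P'(1) unfolding eventually_inf by blast
    then show False using \<phi> by (simp add: trivial_limit_def)
  qed
  moreover have "((\<lambda>k. \<Phi> k i) \<longlongrightarrow> \<phi> i) U" for i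
  proof (rule continuous_on_tendsto_compose[OF continuous_on_product_coordinates[of i], of \<Phi> \<phi> U])
    have "filterlim \<Phi> (nhds \<phi>) (filtercomap \<Phi> (nhds \<phi>))" by (rule filterlim_filtercomap)
    then show "(\<Phi> \<longlongrightarrow> \<phi>) U" by (rule filterlim_mono) (auto simp: U_def)
  qed auto
  ultimately show ?thesis by (intro exI[of _ \<phi>] exI[of _ U]) (auto simp: U_def)
qed

text \<open>If u is centralized then conjugating T by u can be undone cyclically, so the functional
  on \<open>bop\<close> is itself the invariant extension.\<close>

lemma amenable_traceI:
  fixes \<phi> :: "('x::finite, 'a::finite) univ_space op \<Rightarrow> complex"
  assumes bh: "bounded_hermitian bop \<phi>" and st: "state bop \<phi>"
    and e: "\<And>x x' a a'. univ_e x x' a a' \<in> centralizer bop \<phi>"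
  shows "tracial_state C_XA \<phi>" "amenable_trace C_XA \<phi>"
proof -
  note CD = unital_cstar_algebraD[OF unital_cstar_algebra_C_XA[where 'x = 'x and 'a = 'a]]
  have C: "C_XA \<subseteq> centralizer bop \<phi>"
    by (intro C_XA_minimal unital_cstar_algebra_centralizer unital_cstar_algebra_bop bh e)
  have tr: "\<phi> (z o\<^sub>L w) = \<phi> (w o\<^sub>L z)" if "z \<in> C_XA" "w \<in> bop" for z w
    using C that unfolding centralizer_def by blast
  have "state C_XA \<phi>"
    using st CD(1) unfolding state_def clinear_on_def by blast
  then show t: "tracial_state C_XA \<phi>"
    using tr CD(1) unfolding tracial_state_def by blast
  have "\<phi> (u o\<^sub>L T o\<^sub>L op_adj u) = \<phi> T"
    if u: "u \<in> C_XA" and uu: "op_adj u o\<^sub>L u = id_blinfun" and T: "T \<in> bop" for u T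
  proof -
    have "\<phi> (u o\<^sub>L (T o\<^sub>L op_adj u)) = \<phi> ((T o\<^sub>L op_adj u) o\<^sub>L u)"
      using u T CD(1) by (intro tr bop_intros op_adj_bop) auto
    also have "(T o\<^sub>L op_adj u) o\<^sub>L u = T" by (simp add: blinfun_compose_assoc uu)
    finally show ?thesis by (simp add: blinfun_compose_assoc)
  qed
  then show "amenable_trace C_XA \<phi>"
    unfolding amenable_trace_def using t st by blast
qed

text \<open>Compression is not multiplicative on all of \<open>bop\<close>, so positivity is checked
  copy by copy: each term is the squared norm of z applied to an embedded component of
  \<xi>.\<close>

lemma compress_amp_state:
  fixes \<xi> :: "(nat, 'h::chilbert_space) hsum" and \<Phi> :: "('i, 'h) hsum op \<Rightarrow> complex"
  assumes "norm \<xi> = 1"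
    and \<Phi>_def: "\<And>T. \<Phi> T = cinner (app (amp (compress i T)) \<xi>) \<xi>"
  shows "bounded_hermitian bop \<Phi>" "state bop \<Phi>" "cmod (\<Phi> T) \<le> norm T"
proof -
  note vs = amp_vector_state[OF unital_cstar_algebra_bop assms(1)]
  show b: "cmod (\<Phi> T) \<le> norm T" for T
  proof -
    have "cmod (\<Phi> T) \<le> norm (app (amp (compress i T)) \<xi>) * norm \<xi>"
      unfolding \<Phi>_def by (rule norm_cinner_le)
    also have "\<dots> \<le> norm (amp (compress i T))"
      using norm_blinfun[of "amp (compress i T)" \<xi>] by (simp add: assms(1))
    also have "\<dots> \<le> norm T" by (rule order_trans[OF norm_amp_le norm_compress_le])
    finally show ?thesis .
  qed
  show "bounded_hermitian bop \<Phi>"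
    using vs(1) b unfolding \<Phi>_def bounded_hermitian_def clinear_on_def
    by (simp add: compress_simps compress_adj)
  have "\<Phi> (op_adj z o\<^sub>L z) \<in> \<real>\<^sub>\<ge>\<^sub>0" if "z \<in> bop" for z
    unfolding \<Phi>_def
  proof (rule has_sum_nonneg_Reals[OF has_sum_cinner_hsum])
    fix j
    show "cinner (app (proj j) (app (amp (compress i (op_adj z o\<^sub>L z))) \<xi>)) (app (proj j) \<xi>) \<in> \<real>\<^sub>\<ge>\<^sub>0"
      by (simp add: amp_proj compress_apply cinner_emb_right[symmetric] cinner_op_adj'[OF that] cinner_self)
  qed
  moreover have "\<Phi> id_blinfun = 1"
    using vs(2) unfolding \<Phi>_def state_def by (simp add: compress_simps)
  ultimately show "state bop \<Phi>"
    using \<open>bounded_hermitian bop \<Phi>\<close> by (simp add: state_def bounded_hermitian_def)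
qed

text \<open>The approximants have different representations, but each is a summand of the one
  universal space. Compression to it gives states on a common \<open>bop\<close>, among which a
  limit point can be taken.\<close>

lemma approximately_quantum_trace:
  fixes \<Gamma> :: "('x::finite \<times> 'x) cmat \<Rightarrow> ('a::finite \<times> 'a) cmat"
  assumes "approximately_quantum \<Gamma>"
    and score: "score \<Gamma> = of_nat CARD('x) * of_nat CARD('a)"
  shows "\<exists>\<tau>. tracial_state C_XA \<tau> \<and> is_trace_correlation \<Gamma> \<tau> \<and> amenable_trace C_XA \<tau>"
proof -
  obtain G where G: "\<And>k::nat. quantum_correlation (G k)" and lim: "\<And>T. (\<lambda>k. G k T) \<longlonglongrightarrow> \<Gamma> T"
    using assms(1) unfolding approximately_quantum_def by blast
  define C where "C = sqrt (real CARD('x) * real CARD('a))"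
  define d where "d k = sqrt (2 * (real CARD('x) * real CARD('a) - Re (score (G k))))" for k
  have lim_coef: "(\<lambda>k. coef (G k) x x' y y' a a' b b') \<longlonglongrightarrow> coef \<Gamma> x x' y y' a a' b b'" for x x' y y' a a' b b'
    unfolding coef_def by (intro tendsto_vec_nth lim)
  then have "(\<lambda>k. score (G k)) \<longlonglongrightarrow> score \<Gamma>"
    unfolding score_def by (intro tendsto_sum)
  then have "d \<longlonglongrightarrow> sqrt (2 * (real CARD('x) * real CARD('a) - Re (score \<Gamma>)))"
    unfolding d_def by (intro tendsto_intros)
  then have d0: "d \<longlonglongrightarrow> 0" by (simp add: score)
  have "\<exists>(E :: 'x \<Rightarrow> 'x \<Rightarrow> 'a \<Rightarrow> 'a \<Rightarrow> ell2 op) (\<xi> :: (nat, ell2) hsum).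
    norm \<xi> = 1 \<and> stochastic_operator_matrix E \<and>
    (\<forall>x x' a a'. \<forall>T\<in>bop. cmod (cinner (app (amp (E x x' a a' o\<^sub>L T)) \<xi>) \<xi>
       - cinner (app (amp (T o\<^sub>L E x x' a a')) \<xi>) \<xi>) \<le> 2 * norm T * d k) \<and>
    (\<forall>x x' y y' a a' b b'. cmod (coef (G k) x x' y y' a a' b b'
       - cinner (app (amp (E x x' a a' o\<^sub>L E y' y b' b)) \<xi>) \<xi>) \<le> d k * C)" for k
    using quantum_correlation_model[OF G[of k]] unfolding d_def C_def by blast
  then obtain E :: "nat \<Rightarrow> 'x \<Rightarrow> 'x \<Rightarrow> 'a \<Rightarrow> 'a \<Rightarrow> ell2 op" and \<xi> :: "nat \<Rightarrow> (nat, ell2) hsum" where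
    xi: "\<And>k. norm (\<xi> k) = 1" and E: "\<And>k. stochastic_operator_matrix (E k)" and
    tr: "\<And>k x x' a a' T. T \<in> bop \<Longrightarrow> cmod (cinner (app (amp (E k x x' a a' o\<^sub>L T)) (\<xi> k)) (\<xi> k)
       - cinner (app (amp (T o\<^sub>L E k x x' a a')) (\<xi> k)) (\<xi> k)) \<le> 2 * norm T * d k" and
    co: "\<And>k x x' y y' a a' b b'. cmod (coef (G k) x x' y y' a a' b b'
       - cinner (app (amp (E k x x' a a' o\<^sub>L E k y' y b' b)) (\<xi> k)) (\<xi> k)) \<le> d k * C"
    by metis
  \<comment> \<open>\<open>sqrt\<close> of a negative number is negative here, so the sign is taken
    from the bound \<open>co\<close> instead of from the root.\<close>
  have d_nonneg: "0 \<le> d k" for k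
    using order_trans[OF norm_ge_zero co, of k] by (auto simp: C_def zero_le_mult_iff mult_le_0_iff)
  have "\<exists>V. \<forall>x x' a a'. compress V (univ_e x x' a a') = E k x x' a a'" for k
  proof -
    obtain V where V: "is_block_isometry V" "\<And>x x' a a'. op_adj (V a x) o\<^sub>L V a' x' = E k x x' a a'"
      using ex_block_isometry_factor[OF E[of k]] by blast
    then show ?thesis
      by (intro exI[of _ "Abs_block_isometry V"]) (simp add: compress_univ_e Abs_block_isometry_inverse)
  qed
  then obtain V where V: "\<And>k x x' a a'. compress (V k) (univ_e x x' a a') = E k x x' a a'" by metis
  define \<Phi> where "\<Phi> k T = cinner (app (amp (compress (V k) T)) (\<xi> k)) (\<xi> k)"
    for k and T :: "('x, 'a) univ_space op"
  have \<Phi>: "bounded_hermitian bop (\<Phi> k)" "state bop (\<Phi> k)" "cmod (\<Phi> k T) \<le> norm T" for k T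
    by (rule compress_amp_state[OF xi \<Phi>_def])+
  obtain \<phi> U where U: "U \<noteq> bot" "U \<le> sequentially" and \<phi>: "\<And>T. ((\<lambda>k. \<Phi> k T) \<longlongrightarrow> \<phi> T) U"
    using ex_pointwise_limit[of \<Phi> norm] \<Phi>(3) by blast
  have lin: "clinear_on bop \<phi>"
    unfolding clinear_on_def
  proof (intro conjI ballI allI)
    fix z w :: "('x, 'a) univ_space op" assume z: "z \<in> bop" and w: "w \<in> bop"
    have "\<Phi> k (z + w) = \<Phi> k z + \<Phi> k w" for k
      using \<Phi>(2)[of k] z w by (simp add: state_def clinear_on_def)
    then have "((\<lambda>k. \<Phi> k (z + w)) \<longlongrightarrow> \<phi> z + \<phi> w) U" using tendsto_add[OF \<phi>[of z] \<phi>[of w]] by simp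
    then show "\<phi> (z + w) = \<phi> z + \<phi> w" by (rule tendsto_unique[OF U(1) \<phi>])
  next
    fix c and z :: "('x, 'a) univ_space op" assume z: "z \<in> bop"
    have "\<Phi> k (op_scaleC c z) = c * \<Phi> k z" for k
      using \<Phi>(2)[of k] z by (simp add: state_def clinear_on_def)
    then have "((\<lambda>k. \<Phi> k (op_scaleC c z)) \<longlongrightarrow> c * \<phi> z) U" using tendsto_mult_left[OF \<phi>[of z], of c] by simp
    then show "\<phi> (op_scaleC c z) = c * \<phi> z" by (rule tendsto_unique[OF U(1) \<phi>])
  qed
  have bh: "bounded_hermitian bop \<phi>"
    unfolding bounded_hermitian_def
  proof (intro conjI ballI lin)
    fix z :: "('x, 'a) univ_space op" assume z: "z \<in> bop"
    show "cmod (\<phi> z) \<le> norm z"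
      by (rule tendsto_upperbound[OF tendsto_norm[OF \<phi>[of z]] _ U(1)]) (simp add: \<Phi>(3))
    have "\<Phi> k (op_adj z) = cnj (\<Phi> k z)" for k
      using \<Phi>(1)[of k] z by (simp add: bounded_hermitian_def)
    then have "((\<lambda>k. \<Phi> k (op_adj z)) \<longlongrightarrow> cnj (\<phi> z)) U" using tendsto_cnj[OF \<phi>[of z]] by simp
    then show "\<phi> (op_adj z) = cnj (\<phi> z)" by (rule tendsto_unique[OF U(1) \<phi>])
  qed
  have state: "state bop \<phi>"
    unfolding state_def
  proof (intro conjI ballI lin)
    fix z :: "('x, 'a) univ_space op" assume z: "z \<in> bop"
    show "\<phi> (op_adj z o\<^sub>L z) \<in> \<real>\<^sub>\<ge>\<^sub>0"
      by (rule Lim_in_closed_set[OF closed_nonneg_Reals_complex _ U(1) \<phi>])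
        (use \<Phi>(2) z in \<open>simp add: state_def\<close>)
  next
    have "\<Phi> k id_blinfun = 1" for k using \<Phi>(2)[of k] by (simp add: state_def)
    then show "\<phi> id_blinfun = 1" using tendsto_unique[OF U(1) \<phi>[of id_blinfun], of 1] by simp
  qed
  \<comment> \<open>Serves both the trace property and the correlation: their errors are at most a
    multiple of \<open>d k\<close>, which tends to 0 along U.\<close>
  have lim0: "\<alpha> = \<beta>" if "(f \<longlongrightarrow> \<alpha>) U" "(g \<longlongrightarrow> \<beta>) U" "\<And>k. cmod (f k - g k) \<le> B * d k" for f g \<alpha> \<beta> B
  proof -
    have "((\<lambda>k. B * d k) \<longlongrightarrow> 0) U"
      using tendsto_mono[OF U(2) tendsto_mult_left[OF d0, of B]] by simp
    then have "((\<lambda>k. f k - g k) \<longlongrightarrow> 0) U"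
      by (rule Lim_null_comparison[rotated]) (use that(3) in simp)
    from tendsto_unique[OF U(1) this tendsto_diff[OF that(1,2)]] show ?thesis by simp
  qed
  have e: "univ_e x x' a a' \<in> centralizer bop \<phi>" for x x' a a'
  proof -
    have "\<phi> (univ_e x x' a a' o\<^sub>L T) = \<phi> (T o\<^sub>L univ_e x x' a a')" if T: "T \<in> bop" for T
    proof (rule lim0[OF \<phi> \<phi>])
      fix k
      have "cmod (\<Phi> k (univ_e x x' a a' o\<^sub>L T) - \<Phi> k (T o\<^sub>L univ_e x x' a a')) \<le> 2 * norm (compress (V k) T) * d k"
        unfolding \<Phi>_def compress_compose(1)[OF univ_e_block_diag] compress_compose(2)[OF univ_e_block_diag] V
        by (intro tr compress_simps T)
      also have "\<dots> \<le> 2 * norm T * d k"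
        by (intro mult_right_mono mult_left_mono norm_compress_le d_nonneg) auto
      finally show "cmod (\<Phi> k (univ_e x x' a a' o\<^sub>L T) - \<Phi> k (T o\<^sub>L univ_e x x' a a')) \<le> (2 * norm T) * d k" .
    qed
    then show ?thesis
      using subsetD[OF unital_cstar_algebraD(1)[OF unital_cstar_algebra_C_XA] univ_e_C_XA]
      by (simp add: centralizer_def)
  qed
  have "is_trace_correlation \<Gamma> \<phi>"
    unfolding is_trace_correlation_iff
  proof (intro allI)
    fix x x' y y' a a' b b'
    show "coef \<Gamma> x x' y y' a a' b b' = \<phi> (univ_e x x' a a' o\<^sub>L univ_e y' y b' b)"
    proof (rule lim0[OF tendsto_mono[OF U(2) lim_coef] \<phi>])
      show "cmod (coef (G k) x x' y y' a a' b b' - \<Phi> k (univ_e x x' a a' o\<^sub>L univ_e y' y b' b)) \<le> C * d k" for k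
        unfolding \<Phi>_def compress_compose(1)[OF univ_e_block_diag] V using co[of k x x' y y' a a' b b']
        by (simp add: mult.commute)
    qed
  qed
  then show ?thesis using amenable_traceI[OF bh state e] by blast
qed

theorem theorem4p1:
  fixes \<phi> \<Gamma> :: "('x::finite \<times> 'x) cmat \<Rightarrow> ('a::finite \<times> 'a) cmat"
  assumes "quantum_game \<phi>"
    and "concurrent \<phi>"
    and "quantum_commuting TYPE('h::chilbert_space) \<Gamma>"
    and "perfect_strategy \<phi> \<Gamma>"
  shows "(\<exists>\<tau>. tracial_state C_XA \<tau> \<and> is_trace_correlation \<Gamma> \<tau>) \<and>
    (approximately_quantum \<Gamma> \<longrightarrow>
      (\<exists>\<tau>. tracial_state C_XA \<tau> \<and> is_trace_correlation \<Gamma> \<tau> \<and> amenable_trace C_XA \<tau>)) \<and>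
    (quantum_correlation \<Gamma> \<longrightarrow>
      (\<exists>\<tau>. tracial_state C_XA \<tau> \<and> is_trace_correlation \<Gamma> \<tau> \<and>
        factors_through finite_dimensional C_XA \<tau>)) \<and>
    (local_correlation \<Gamma> \<longrightarrow>
      (\<exists>\<tau>. tracial_state C_XA \<tau> \<and> is_trace_correlation \<Gamma> \<tau> \<and>
        factors_through abelian C_XA \<tau>))"
proof -
  have "QNS_correlation \<Gamma>" using assms(3) unfolding quantum_commuting_def by blast
  then have "score \<Gamma> = of_nat CARD('x) * of_nat CARD('a)" using assms(2,4) by (rule perfect_score)
  then show ?thesis
    using quantum_commuting_trace[OF assms(3)] approximately_quantum_trace quantum_correlation_trace
      local_correlation_trace by blast
qed

end
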